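(* Let $m,\alpha,\beta$ be positive real numbers. Then $(\Gamma_m^+,\Lambda_{\alpha,\beta})$ is a Heisenberg uniqueness pair if and only if $\alpha\beta m^2<16\pi^2$. Moreover, if $\alpha\beta m^2=16\pi^2$, then $(\Gamma_m^+,\Lambda_{\alpha,\beta})$ is a Heisenberg uniqueness pair with defect $1$.
   Context: For a finite complex-valued Borel measure $\mu$ on $\mathbb{R}^2$, the Fourier transform is $\widehat\mu(\xi)=\int_{\mathbb{R}^2}e^{\pi i\langle x,\xi\rangle}\,d\mu(x)$ for $\xi\in\mathbb{R}^2$, where $\langle x,\xi\rangle=x_1\xi_1+x_2\xi_2$. For $m>0$, $\Gamma_m^+=\{x\in\mathbb{R}^2: x_1x_2=-m^2/(4\pi^2),\ x_1>0\}$ is one branch of a hyperbola. $\mathrm{AC}(\Gamma_m^+)$ is the space of finite complex-valued Borel measures on $\mathbb{R}^2$ supported on $\Gamma_m^+$ and absolutely continuous with respect to arc length measure on $\Gamma_m^+$. For $\alpha,\beta>0$, the lattice-cross is $\Lambda_{\alpha,\beta}=(\alpha\mathbb{Z}\times\{0\})\cup(\{0\}\times\beta\mathbb{Z})\subset\mathbb{R}^2$. For $\Lambda\subset\mathbb{R}^2$, $(\Gamma_m^+,\Lambda)$ is a Heisenberg uniqueness pair if every $\mu\in\mathrm{AC}(\Gamma_m^+)$ with $\widehat\mu|_\Lambda=0$ satisfies $\mu=0$; it is a Heisenberg uniqueness pair with defect $d$ if the complex vector space $\{\mu\in\mathrm{AC}(\Gamma_m^+):\widehat\mu|_\Lambda=0\}$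 has dimension $d$. *)

theory Defs
  imports "HOL-Analysis.Analysis" "HOL-Library.Function_Algebras"
begin

text \<open>A complex measure is a set function on the measurable sets of a space, made total by the
  value \<open>0\<close> on non-measurable sets so that equality of measures is equality of functions.
  Finiteness is automatic, since the values are complex numbers, and \<open>\<mu> {} = 0\<close>
  follows from the convergence of the constant series.\<close>

definition complex_measure :: "'a measure \<Rightarrow> ('a set \<Rightarrow> complex) \<Rightarrow> bool" where
  "complex_measure M \<mu> \<longleftrightarrow>
     (\<forall>A. A \<notin> sets M \<longrightarrow> \<mu> A = 0) \<and>
     (\<forall>A :: nat \<Rightarrow> 'a set. range A \<subseteq> sets M \<longrightarrow> disjoint_family A \<longrightarrow>
        (\<lambda>n. \<mu> (A n)) sums \<mu> (\<Union>n. A n))"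

text \<open>The upper variation of a signed measure \<open>\<nu>\<close>; together with the upper variation of
  \<open>- \<nu>\<close> it forms the Jordan decomposition of \<open>\<nu>\<close>. The truncation of negative values by
  \<^const>\<open>ennreal\<close> is harmless because \<open>B = {}\<close> takes part in the supremum.\<close>

definition upper_variation :: "'a measure \<Rightarrow> ('a set \<Rightarrow> real) \<Rightarrow> 'a measure" where
  "upper_variation M \<nu> = measure_of (space M) (sets M)
     (\<lambda>A. SUP B \<in> {B \<in> sets M. B \<subseteq> A}. ennreal (\<nu> B))"

definition signed_integral :: "'a measure \<Rightarrow> ('a set \<Rightarrow> real) \<Rightarrow> ('a \<Rightarrow> complex) \<Rightarrow> complex" where
  "signed_integral M \<nu> f =
     (\<integral>x. f x \<partial>upper_variation M \<nu>) - (\<integral>x. f x \<partial>upper_variation M (\<lambda>A. - \<nu> A))"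

definition complex_measure_integral ::
    "'a measure \<Rightarrow> ('a set \<Rightarrow> complex) \<Rightarrow> ('a \<Rightarrow> complex) \<Rightarrow> complex" where
  "complex_measure_integral M \<mu> f =
     signed_integral M (\<lambda>A. Re (\<mu> A)) f + \<i> * signed_integral M (\<lambda>A. Im (\<mu> A)) f"

definition fourier_transform :: "((real \<times> real) set \<Rightarrow> complex) \<Rightarrow> real \<times> real \<Rightarrow> complex" where
  "fourier_transform \<mu> \<xi> =
     complex_measure_integral borel \<mu> (\<lambda>x. exp (pi * \<i> * of_real (x \<bullet> \<xi>)))"

definition hyperbola_branch :: "real \<Rightarrow> (real \<times> real) set" where
  "hyperbola_branch m = {(x1, x2). x1 * x2 = - m\<^sup>2 / (4 * pi\<^sup>2) \<and> x1 > 0}"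

definition hyperbola_param :: "real \<Rightarrow> real \<Rightarrow> real \<times> real" where
  "hyperbola_param m t = (t, - m\<^sup>2 / (4 * pi\<^sup>2 * t))"

lemma hyperbola_branch_eq: "hyperbola_branch m = hyperbola_param m ` {0<..}"
  by (auto simp: hyperbola_branch_def hyperbola_param_def image_iff field_simps)

text \<open>Arc length measure of an injective continuously differentiable curve \<open>\<gamma>\<close> on the parameter
  set \<open>I\<close>: the image under \<open>\<gamma>\<close> of the measure with density \<open>norm (\<gamma>' t)\<close>, regarded as a
  measure on the whole ambient space.\<close>

definition arc_length_measure ::
    "(real \<Rightarrow> 'a :: euclidean_space) \<Rightarrow> real set \<Rightarrow> 'a measure" where
  "arc_length_measure \<gamma> I =
     distr (density (restrict_space lborel I) (\<lambda>t. ennreal (norm (vector_derivative \<gamma> (at t)))))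
       borel \<gamma>"

text \<open>The branch is closed, so that \<open>\<mu>\<close> is supported on it if and only if \<open>\<mu>\<close> vanishes on all
  Borel sets disjoint from it.\<close>

definition AC :: "real \<Rightarrow> ((real \<times> real) set \<Rightarrow> complex) set" where
  "AC m = {\<mu>. complex_measure borel \<mu> \<and>
     (\<forall>A \<in> sets borel. A \<inter> hyperbola_branch m = {} \<longrightarrow> \<mu> A = 0) \<and>
     (\<forall>A \<in> sets borel.
        emeasure (arc_length_measure (hyperbola_param m) {0<..}) A = 0 \<longrightarrow> \<mu> A = 0)}"

definition lattice_cross :: "real \<Rightarrow> real \<Rightarrow> (real \<times> real) set" where
  "lattice_cross \<alpha> \<beta> =
     range (\<lambda>j::int. (\<alpha> * of_int j, 0)) \<union> range (\<lambda>k::int. (0, \<beta> * of_int k))"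

definition annihilated_measures ::
    "real \<Rightarrow> (real \<times> real) set \<Rightarrow> ((real \<times> real) set \<Rightarrow> complex) set" where
  "annihilated_measures m \<Lambda> = {\<mu> \<in> AC m. \<forall>\<xi>\<in>\<Lambda>. fourier_transform \<mu> \<xi> = 0}"

definition heisenberg_uniqueness_pair :: "real \<Rightarrow> (real \<times> real) set \<Rightarrow> bool" where
  "heisenberg_uniqueness_pair m \<Lambda> \<longleftrightarrow>
     (\<forall>\<mu> \<in> AC m. (\<forall>\<xi>\<in>\<Lambda>. fourier_transform \<mu> \<xi> = 0) \<longrightarrow> \<mu> = 0)"

definition scale_fun :: "complex \<Rightarrow> ('a \<Rightarrow> complex) \<Rightarrow> 'a \<Rightarrow> complex" where
  "scale_fun c f = (\<lambda>x. c * f x)"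

global_interpretation complex_fun: vector_space "scale_fun :: complex \<Rightarrow> ('a \<Rightarrow> complex) \<Rightarrow> _"
  by unfold_locales (auto simp: scale_fun_def algebra_simps)

text \<open>The dimension is expressed by a finite basis, because the library's \<open>dim\<close> is \<open>0\<close> on
  infinite-dimensional spaces.\<close>

definition heisenberg_uniqueness_pair_defect :: "real \<Rightarrow> (real \<times> real) set \<Rightarrow> nat \<Rightarrow> bool" where
  "heisenberg_uniqueness_pair_defect m \<Lambda> d \<longleftrightarrow>
     (\<exists>B. finite B \<and> card B = d \<and> complex_fun.independent B \<and>
        complex_fun.span B = annihilated_measures m \<Lambda>)"

end

theory Submission
  imports Defs "HOL-Probability.Probability"
begin

text \<open>In the coordinate \<open>s = \<alpha> t / 2\<close> on the branch, the measures in question are densities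
  \<open>f \<in> L\<^sup>1(0, \<infinity>)\<close>, and with \<open>\<gamma> = \<alpha> \<beta> m\<^sup>2 / (16
  \<pi>\<^sup>2)\<close> the vanishing on the lattice-cross says that the images of \<open>f ds\<close> on the circle
  under \<open>s mod 1\<close> and \<open>\<gamma> / s mod 1\<close> are both zero. For \<open>\<gamma> \<le> 1\<close>
  this makes \<open>f\<close> on \<open>(0, 1)\<close> invariant under the square of the Gauss-type map \<open>s
  \<mapsto> \<gamma> / s mod 1\<close> of \<open>(0, \<gamma>)\<close> into \<open>[0, 1)\<close>. For \<open>\<gamma> <
  1\<close> almost every orbit of this map leaves its domain, so \<open>f = 0\<close>. For \<open>\<gamma> = 1\<close>
  the Gauss map is mixing, because its transfer operator halves the oscillation of monotone functions; so
  \<open>f\<close> is on \<open>(0, 1)\<close> a multiple of the Gauss density. For \<open>\<gamma> > 1\<close> consider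
  the chain that moves from \<open>s \<in> [0, 1)\<close> to \<open>\<gamma> / s mod 1\<close> or, with probability
  \<open>(1 - s)\<^sup>2\<close>, to \<open>\<gamma> / (1 + s) mod 1\<close>. A Lasota--Yorke estimate gives it a
  stationary density. Lifting this to a density \<open>p\<close> on \<open>(0, 2)\<close> yields the nonzero solution
  \<open>f s = p s - \<gamma> / s\<^sup>2 \<cdot> p (\<gamma> / s)\<close>.\<close>

section \<open>Complex measures and densities\<close>

text \<open>For \<open>\<gamma> > 1\<close> the plain map \<open>s\<close> to
  \<open>\<gamma> / s mod 1\<close> on \<open>[0, 1)\<close> is expanding, with slopes of modulus
  above \<open>\<gamma>\<close>. But it is broken at the ends of the interval, so integrating a
  derivative against the transported density leaves boundary terms that can outweigh the
  contraction. The random choice of \<open>x = s\<close> or \<open>x = 1 + s\<close> removes the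
  cut. The probability \<open>(1 - s)\<^sup>2\<close> of \<open>x = 1 + s\<close> is 1 at
  \<open>s = 0\<close> and 0 at \<open>s = 1\<close>, so both ends of \<open>[0, 1)\<close> use the
  same point \<open>x = 1\<close>, and the branch at \<open>x = 0\<close>, where
  \<open>\<gamma> / x\<close> is unbounded, has weight 0. On \<open>(1, 2)\<close> the slope can
  fall to \<open>\<gamma> / 4\<close>, possibly below 1; the square compensates, since the averaged
  inverse slope \<open>((1 - (1 - s)\<^sup>2) s\<^sup>2 + (1 - s)\<^sup>2 (1 + s)\<^sup>2) /
  \<gamma>\<close> is at most \<open>1 / \<gamma>\<close>. Hence the laws of the chain have
  uniformly bounded densities, and a weak limit of their time averages inherits the bound. Without
  it the limit might be singular and would give no element of \<open>AC\<close>.\<close>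

lemma complex_measure_sums:
  assumes "complex_measure M \<mu>" "range A \<subseteq> sets M" "disjoint_family A"
  shows "(\<lambda>n. \<mu> (A n)) sums \<mu> (\<Union>n. A n)"
  using assms by (auto simp: complex_measure_def)

section \<open>Jordan decomposition of finite signed measures\<close>

text \<open>Real and imaginary parts of a complex measure are instances, and so are their negatives
  by \<open>uminus\<close>. Boundedness is not assumed; it is derived in
  \<open>upper_finite\<close>.\<close>

locale finite_signed_measure =
  fixes M :: "'a measure" and \<nu> :: "'a set \<Rightarrow> real"
  assumes sums: "\<And>A :: nat \<Rightarrow> 'a set. range A \<subseteq> sets M \<Longrightarrow> disjoint_family A \<Longrightarrow>
    (\<lambda>n. \<nu> (A n)) sums \<nu> (\<Union>n. A n)"
begin

lemma empty [simp]: "\<nu> {} = 0"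
proof -
  have "(\<lambda>n::nat. \<nu> {}) sums \<nu> (\<Union>n::nat. {})"
    by (rule sums) (auto simp: disjoint_family_on_def)
  then show ?thesis
    using sums_summable summable_const_iff by blast
qed

lemma Un:
  assumes "A \<in> sets M" "B \<in> sets M" "A \<inter> B = {}"
  shows "\<nu> (A \<union> B) = \<nu> A + \<nu> B"
proof -
  have "(\<lambda>n. \<nu> (binaryset A B n)) sums \<nu> (\<Union>n. binaryset A B n)"
    using assms by (intro sums)
      (auto simp: binaryset_def disjoint_family_on_def split: if_splits)
  moreover have "(\<lambda>n. \<nu> (binaryset A B n)) sums (\<Sum>n<2. \<nu> (binaryset A B n))"
    by (rule sums_finite) (auto simp: binaryset_def)
  ultimately show ?thesis
    by (simp add: sums_unique2 UN_binaryset_eq numeral_2_eq_2 binaryset_def)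
qed

lemma Diff:
  assumes "A \<in> sets M" "B \<in> sets M" "B \<subseteq> A"
  shows "\<nu> (A - B) = \<nu> A - \<nu> B"
proof -
  have "\<nu> (B \<union> (A - B)) = \<nu> B + \<nu> (A - B)"
    using assms by (intro Un) auto
  with assms show ?thesis by (simp add: Un_absorb1)
qed

lemma uminus: "finite_signed_measure M (\<lambda>A. - \<nu> A)"
  by unfold_locales (use sums sums_minus in blast)

text \<open>The set function that \<open>upper_variation\<close> hands to \<open>measure_of\<close>;
  it is the \<open>emeasure\<close> of that measure only once
  \<open>upper_countably_additive\<close> is available.\<close>

definition upper :: "'a set \<Rightarrow> ennreal" where
  "upper A = (SUP B \<in> {B \<in> sets M. B \<subseteq> A}. ennreal (\<nu> B))"

lemma upper_ge: "B \<in> sets M \<Longrightarrow> B \<subseteq> A \<Longrightarrow> ennreal (\<nu> B) \<le> upper A"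
  unfolding upper_def by (rule SUP_upper) auto

lemma upper_mono: "A \<subseteq> B \<Longrightarrow> upper A \<le> upper B"
  unfolding upper_def by (rule SUP_subset_mono) auto

lemma upper_empty [simp]: "upper {} = 0"
proof -
  have "{B \<in> sets M. B \<subseteq> {}} = {{}}" by auto
  then show ?thesis by (simp add: upper_def)
qed

lemma upper_superadditive:
  assumes "A \<inter> B = {}"
  shows "upper A + upper B \<le> upper (A \<union> B)"
proof -
  have *: "ennreal (\<nu> C) + ennreal (\<nu> D) \<le> upper (A \<union> B)"
    if "C \<in> sets M" "C \<subseteq> A" "D \<in> sets M" "D \<subseteq> B" for C D
  \<comment> \<open>A negative value is truncated to 0 by \<open>ennreal\<close>, and then the other
    set alone is a competitor for the union.\<close>
  proof (cases "\<nu> C \<ge> 0 \<and> \<nu> D \<ge> 0")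
    case True
    then have "ennreal (\<nu> C) + ennreal (\<nu> D) = ennreal (\<nu> (C \<union> D))"
      using that assms by (subst Un) auto
    also have "\<dots> \<le> upper (A \<union> B)"
      using that by (intro upper_ge) auto
    finally show ?thesis .
  next
    case False
    moreover have "ennreal (\<nu> C) \<le> upper (A \<union> B)" "ennreal (\<nu> D) \<le> upper (A \<union> B)"
      using that by (auto intro!: upper_ge)
    ultimately show ?thesis by (auto simp: ennreal_neg)
  qed
  have ne: "{E \<in> sets M. E \<subseteq> X} \<noteq> {}" for X by auto
  show ?thesis
    unfolding upper_def[of A] upper_def[of B]
    by (subst ennreal_SUP_add_left[OF ne, symmetric], rule SUP_least,
        subst ennreal_SUP_add_right[OF ne], rule SUP_least) (use * in auto)
qed

text \<open>Superadditivity and monotonicity bound the partial sums by the value of the union.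
  Conversely a competitor \<open>B\<close> for the union is cut into the pieces
  \<open>B \<inter> A i\<close>, and replacing their masses by the positive parts only increases the
  partial sums.\<close>

lemma upper_countably_additive: "countably_additive (sets M) upper"
proof (rule countably_additiveI)
  fix A :: "nat \<Rightarrow> 'a set"
  assume A: "range A \<subseteq> sets M" "disjoint_family A"
  show "(\<Sum>i. upper (A i)) = upper (\<Union>i. A i)"
  proof (rule antisym)
    have "(\<Sum>i<n. upper (A i)) \<le> upper (\<Union>i<n. A i)" for n
    proof (induction n)
      case (Suc n)
      have "(\<Union>i<n. A i) \<inter> A n = {}"
        using A(2) by (auto simp: disjoint_family_on_def) (metis IntI empty_iff less_irrefl)
      then have "upper (\<Union>i<n. A i) + upper (A n) \<le> upper ((\<Union>i<n. A i) \<union> A n)"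
        by (rule upper_superadditive)
      also have "(\<Union>i<n. A i) \<union> A n = (\<Union>i<Suc n. A i)"
        by (auto simp: less_Suc_eq)
      finally show ?case
        using Suc by (auto intro: order_trans add_right_mono)
    qed simp
    also have "upper (\<Union>i<n. A i) \<le> upper (\<Union>i. A i)" for n
      by (rule upper_mono) auto
    finally show "(\<Sum>i. upper (A i)) \<le> upper (\<Union>i. A i)"
      by (intro suminf_le_const) auto
  next
    show "upper (\<Union>i. A i) \<le> (\<Sum>i. upper (A i))"
      unfolding upper_def[of "\<Union>i. A i"]
    proof (rule SUP_least, clarify)
      fix B assume B: "B \<in> sets M" "B \<subseteq> (\<Union>i. A i)"
      have "(\<lambda>i. \<nu> (B \<inter> A i)) sums \<nu> (\<Union>i. B \<inter> A i)"
        using A B by (intro sums) (auto simp: disjoint_family_on_def)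
      also have "(\<Union>i. B \<inter> A i) = B" using B by auto
      finally have "(\<lambda>n. \<Sum>i<n. \<nu> (B \<inter> A i)) \<longlonglongrightarrow> \<nu> B" by (simp add: sums_def)
      then have lim: "(\<lambda>n. ennreal (\<Sum>i<n. \<nu> (B \<inter> A i))) \<longlonglongrightarrow> ennreal (\<nu> B)"
        by (rule tendsto_ennrealI)
      have "ennreal (\<Sum>i<n. \<nu> (B \<inter> A i)) \<le> (\<Sum>i. upper (A i))" for n
      proof -
        have "(\<Sum>i<n. \<nu> (B \<inter> A i)) \<le> (\<Sum>i<n. max 0 (\<nu> (B \<inter> A i)))"
          by (rule sum_mono) auto
        then have "ennreal (\<Sum>i<n. \<nu> (B \<inter> A i)) \<le> ennreal (\<Sum>i<n. max 0 (\<nu> (B \<inter> A i)))"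
          by (rule ennreal_leI)
        also have "\<dots> = (\<Sum>i<n. ennreal (max 0 (\<nu> (B \<inter> A i))))"
          by (rule sum_ennreal[symmetric]) auto
        also have "\<dots> \<le> (\<Sum>i<n. upper (A i))"
        proof (rule sum_mono)
          fix i
          show "ennreal (max 0 (\<nu> (B \<inter> A i))) \<le> upper (A i)"
            using A B upper_ge[of "B \<inter> A i" "A i"] by (auto simp: max_def)
        qed
        also have "\<dots> \<le> (\<Sum>i. upper (A i))"
          by (rule sum_le_suminf) auto
        finally show ?thesis .
      qed
      then show "ennreal (\<nu> B) \<le> (\<Sum>i. upper (A i))"
        by (intro LIMSEQ_le_const2[OF lim]) auto
    qed
  qed
qed

lemma sets_upper_variation [simp]: "sets (upper_variation M \<nu>) = sets M"
  and space_upper_variation [simp]: "space (upper_variation M \<nu>) = space M"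
  by (simp_all add: upper_variation_def)

lemma emeasure_upper_variation:
  assumes "A \<in> sets M"
  shows "emeasure (upper_variation M \<nu>) A = upper A"
  unfolding upper_variation_def upper_def[symmetric, abs_def]
  by (rule emeasure_measure_of_sigma)
     (use assms upper_countably_additive sets.sigma_algebra_axioms in
       \<open>auto simp: positive_def\<close>)

text \<open>If the upper variation were infinite, one could split off pieces of mass at least \<open>1\<close>
  forever, which contradicts the convergence of the series of their masses.\<close>

lemma upper_finite: "upper (space M) < \<infinity>"
proof (rule ccontr)
  assume "\<not> upper (space M) < \<infinity>"
  then have inf: "upper (space M) = \<infinity>" by (simp add: less_top[symmetric])
  define P where "P A \<longleftrightarrow> A \<in> sets M \<and> upper A = \<infinity>" for A
  have step: "\<exists>A'. P A' \<and> A' \<subseteq> A \<and> \<bar>\<nu> (A - A')\<bar> \<ge> 1" if "P A" for A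
  proof -
    have A: "A \<in> sets M" "upper A = \<infinity>" using that by (auto simp: P_def)
    \<comment> \<open>The margin makes both \<open>\<nu> C\<close> and \<open>\<nu> (A - C)\<close>
      at least 1 in absolute value. One of the two pieces still has infinite variation and is kept;
      the other one is split off.\<close>
    have "ennreal (\<bar>\<nu> A\<bar> + 1) < upper A" using A by simp
    then obtain C where C: "C \<in> sets M" "C \<subseteq> A" "ennreal (\<bar>\<nu> A\<bar> + 1) < ennreal (\<nu> C)"
      unfolding upper_def less_SUP_iff by auto
    then have nuC: "\<nu> C > \<bar>\<nu> A\<bar> + 1"
      by (subst (asm) ennreal_less_iff) auto
    have nuD: "\<nu> (A - C) = \<nu> A - \<nu> C" using A C by (intro Diff) auto
    have "upper A = upper C + upper (A - C)"
      using sets.countably_additive_additive[OF _ upper_countably_additive] C A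
        additiveD[of "sets M" upper C "A - C"]
      by (simp add: positive_def Un_absorb1)
    then consider "upper C = \<infinity>" | "upper (A - C) = \<infinity>"
      using A by (metis ennreal_add_eq_top infinity_ennreal_def)
    then show ?thesis
    proof cases
      case 1
      then show ?thesis using A C nuC nuD by (intro exI[of _ C]) (auto simp: P_def)
    next
      case 2
      have "A - (A - C) = C" using C by auto
      then show ?thesis using A C 2 nuC by (intro exI[of _ "A - C"]) (auto simp: P_def)
    qed
  qed
  have "\<exists>A :: nat \<Rightarrow> 'a set. \<forall>n. P (A n) \<and> (A (Suc n) \<subseteq> A n \<and> \<bar>\<nu> (A n - A (Suc n))\<bar> \<ge> 1)"
    by (rule dependent_nat_choice) (use inf step in \<open>auto simp: P_def\<close>)
  then obtain A :: "nat \<Rightarrow> 'a set" where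
    A: "\<And>n. P (A n)" "\<And>n. A (Suc n) \<subseteq> A n" "\<And>n. \<bar>\<nu> (A n - A (Suc n))\<bar> \<ge> 1" by auto
  have dec: "decseq A" using A(2) by (rule decseq_SucI)
  have "disjoint_family (\<lambda>n. A n - A (Suc n))"
    unfolding disjoint_family_on_def
  proof (intro ballI impI)
    fix i j :: nat assume "i \<noteq> j"
    then consider "Suc i \<le> j" | "Suc j \<le> i" by linarith
    then show "(A i - A (Suc i)) \<inter> (A j - A (Suc j)) = {}"
      by cases (use dec decseqD in blast)+
  qed
  then have "(\<lambda>n. \<nu> (A n - A (Suc n))) sums \<nu> (\<Union>n. A n - A (Suc n))"
    using A(1) by (intro sums) (auto simp: P_def)
  then have "(\<lambda>n. \<nu> (A n - A (Suc n))) \<longlonglongrightarrow> 0"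
    using sums_summable summable_LIMSEQ_zero by blast
  then have "\<forall>\<^sub>F n in sequentially. \<bar>\<nu> (A n - A (Suc n))\<bar> < 1"
    by (auto dest!: tendstoD[of _ _ _ 1] simp: dist_real_def)
  with A(3) show False
    by (auto simp: eventually_sequentially) (meson linorder_not_le order_refl)
qed

lemma finite_measure_upper_variation: "finite_measure (upper_variation M \<nu>)"
  by (rule finite_measureI)
     (use upper_finite in \<open>simp add: emeasure_upper_variation less_top\<close>)

lemma le_measure_upper_variation:
  assumes "B \<in> sets M" "B \<subseteq> A" "A \<in> sets M"
  shows "\<nu> B \<le> measure (upper_variation M \<nu>) A"
proof -
  interpret finite_measure "upper_variation M \<nu>" by (rule finite_measure_upper_variation)
  have "ennreal (\<nu> B) \<le> ennreal (measure (upper_variation M \<nu>) A)"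
    using assms upper_ge[of B A] by (simp add: emeasure_upper_variation flip: emeasure_eq_measure)
  then show ?thesis by (simp add: ennreal_le_iff)
qed

lemma measure_upper_variation_le:
  assumes "A \<in> sets M" "\<And>B. B \<in> sets M \<Longrightarrow> B \<subseteq> A \<Longrightarrow> \<nu> B \<le> c"
  shows "measure (upper_variation M \<nu>) A \<le> c"
proof -
  interpret finite_measure "upper_variation M \<nu>" by (rule finite_measure_upper_variation)
  have "0 \<le> c" using assms(2)[of "{}"] by simp
  have "upper A \<le> ennreal c"
    unfolding upper_def by (rule SUP_least) (use assms in \<open>auto intro: ennreal_leI\<close>)
  then show ?thesis
    using assms \<open>0 \<le> c\<close> by (simp add: emeasure_eq_measure flip: emeasure_upper_variation)
qed

text \<open>Complements exchange competitors: \<open>\<nu> B = \<nu> A - \<nu> (A - B)\<close>, and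
  \<open>A - B\<close> competes in the upper variation of the opposite sign. Applied in both
  directions this gives the two inequalities.\<close>

lemma jordan_decomposition:
  assumes "A \<in> sets M"
  shows "\<nu> A = measure (upper_variation M \<nu>) A - measure (upper_variation M (\<lambda>A. - \<nu> A)) A"
proof -
  interpret neg: finite_signed_measure M "\<lambda>A. - \<nu> A" by (rule uminus)
  have "measure (upper_variation M \<nu>) A \<le> \<nu> A + measure (upper_variation M (\<lambda>A. - \<nu> A)) A"
  proof (rule measure_upper_variation_le)
    fix B assume B: "B \<in> sets M" "B \<subseteq> A"
    have "- \<nu> (A - B) \<le> measure (upper_variation M (\<lambda>A. - \<nu> A)) A"
      using assms B by (intro neg.le_measure_upper_variation) auto
    then show "\<nu> B \<le> \<nu> A + measure (upper_variation M (\<lambda>A. - \<nu> A)) A"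
      using assms B by (simp add: Diff)
  qed fact
  moreover have "measure (upper_variation M (\<lambda>A. - \<nu> A)) A \<le> measure (upper_variation M \<nu>) A - \<nu> A"
  proof (rule neg.measure_upper_variation_le)
    fix B assume B: "B \<in> sets M" "B \<subseteq> A"
    have "\<nu> (A - B) \<le> measure (upper_variation M \<nu>) A"
      using assms B by (intro le_measure_upper_variation) auto
    then show "- \<nu> B \<le> measure (upper_variation M \<nu>) A - \<nu> A"
      using assms B by (simp add: Diff)
  qed fact
  ultimately show ?thesis by linarith
qed

section \<open>Radon-Nikodym theorem for signed and complex measures\<close>

text \<open>Measurable subsets of a \<open>\<rho>\<close>-null set are \<open>\<rho>\<close>-null,
  so \<open>\<nu>\<close> vanishes on all competitors and the upper variation is absolutely
  continuous. Its finiteness makes the \<open>ennreal\<close> density finite almost everywhere,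
  hence replaceable by an integrable real function.\<close>

lemma upper_variation_density:
  assumes \<rho>: "sigma_finite_measure \<rho>" "sets \<rho> = sets M"
    and ac: "\<And>A. A \<in> sets M \<Longrightarrow> emeasure \<rho> A = 0 \<Longrightarrow> \<nu> A = 0"
  obtains g :: "'a \<Rightarrow> real" where "integrable \<rho> g"
    "\<And>A. A \<in> sets M \<Longrightarrow> measure (upper_variation M \<nu>) A = (\<integral>x. indicator A x * g x \<partial>\<rho>)"
proof -
  interpret \<rho>: sigma_finite_measure \<rho> by fact
  interpret U: finite_measure "upper_variation M \<nu>" by (rule finite_measure_upper_variation)
  have "absolutely_continuous \<rho> (upper_variation M \<nu>)"
    unfolding absolutely_continuous_def
  proof
    fix A assume A: "A \<in> null_sets \<rho>"
    then have "A \<in> sets M" using \<rho>(2) by auto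
    have "upper A \<le> 0"
      unfolding upper_def
    proof (rule SUP_least, clarify)
      fix B assume "B \<in> sets M" "B \<subseteq> A"
      then have "\<nu> B = 0"
        using ac A \<rho>(2) null_sets_subset[OF A, of B] by auto
      then show "ennreal (\<nu> B) \<le> 0" by simp
    qed
    then show "A \<in> null_sets (upper_variation M \<nu>)"
      using \<open>A \<in> sets M\<close> by (simp add: null_sets_def emeasure_upper_variation)
  qed
  then obtain f where f[measurable]: "f \<in> borel_measurable \<rho>"
    and df: "density \<rho> f = upper_variation M \<nu>"
    using \<rho>.Radon_Nikodym[of "upper_variation M \<nu>"] \<rho>(2) by auto
  have em: "emeasure (upper_variation M \<nu>) A = (\<integral>\<^sup>+x. f x * indicator A x \<partial>\<rho>)" if "A \<in> sets M" for A
    using that \<rho>(2) by (simp add: df[symmetric] emeasure_density)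
  have "(\<integral>\<^sup>+x. f x \<partial>\<rho>) = emeasure (upper_variation M \<nu>) (space M)"
    using sets_eq_imp_space_eq[OF \<rho>(2)]
    by (subst em) (auto intro!: nn_integral_cong simp: indicator_def)
  then have fin: "(\<integral>\<^sup>+x. f x \<partial>\<rho>) \<noteq> \<infinity>"
    using U.emeasure_finite[of "space M"] by simp
  then have AE_fin: "AE x in \<rho>. f x \<noteq> \<infinity>" by (intro nn_integral_PInf_AE) auto
  define g where "g x = enn2real (f x)" for x
  have [measurable]: "g \<in> borel_measurable \<rho>" unfolding g_def by measurable
  have AE_eq: "AE x in \<rho>. ennreal (g x) = f x"
    using AE_fin by eventually_elim (simp add: g_def less_top)
  have gint: "integrable \<rho> g"
  proof (rule integrableI_nonneg)
    have "(\<integral>\<^sup>+x. g x \<partial>\<rho>) = (\<integral>\<^sup>+x. f x \<partial>\<rho>)"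
      by (rule nn_integral_cong_AE) (use AE_eq in auto)
    then show "(\<integral>\<^sup>+x. g x \<partial>\<rho>) < \<infinity>" using fin by (simp add: top.not_eq_extremum)
  qed (auto simp: g_def)
  show thesis
  proof
    show "integrable \<rho> g" by fact
    fix A assume A: "A \<in> sets M"
    then have A'[measurable]: "A \<in> sets \<rho>" using \<rho>(2) by simp
    have int: "integrable \<rho> (\<lambda>x. indicator A x * g x)"
      using integrable_mult_indicator[OF A' gint] by simp
    have "emeasure (upper_variation M \<nu>) A = (\<integral>\<^sup>+x. ennreal (indicator A x * g x) \<partial>\<rho>)"
      unfolding em[OF A]
      by (rule nn_integral_cong_AE) (use AE_eq in eventually_elim, auto simp: indicator_def)
    also have "\<dots> = ennreal (\<integral>x. indicator A x * g x \<partial>\<rho>)"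
      using int by (intro nn_integral_eq_integral) (auto simp: g_def)
    finally show "measure (upper_variation M \<nu>) A = (\<integral>x. indicator A x * g x \<partial>\<rho>)"
      by (simp add: U.emeasure_eq_measure g_def integral_nonneg_AE)
  qed
qed

lemma radon_nikodym_signed:
  assumes \<rho>: "sigma_finite_measure \<rho>" "sets \<rho> = sets M"
    and ac: "\<And>A. A \<in> sets M \<Longrightarrow> emeasure \<rho> A = 0 \<Longrightarrow> \<nu> A = 0"
  obtains g :: "'a \<Rightarrow> real" where "integrable \<rho> g"
    "\<And>A. A \<in> sets M \<Longrightarrow> \<nu> A = (\<integral>x. indicator A x * g x \<partial>\<rho>)"
proof -
  interpret neg: finite_signed_measure M "\<lambda>A. - \<nu> A" by (rule uminus)
  obtain g1 where g1: "integrable \<rho> g1"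
    "\<And>A. A \<in> sets M \<Longrightarrow> measure (upper_variation M \<nu>) A = (\<integral>x. indicator A x * g1 x \<partial>\<rho>)"
    using upper_variation_density[OF \<rho> ac] by blast
  obtain g2 where g2: "integrable \<rho> g2"
    "\<And>A. A \<in> sets M \<Longrightarrow> measure (upper_variation M (\<lambda>A. - \<nu> A)) A = (\<integral>x. indicator A x * g2 x \<partial>\<rho>)"
    using neg.upper_variation_density[OF \<rho>] ac by (metis neg_equal_0_iff_equal)
  show thesis
  proof
    show "integrable \<rho> (\<lambda>x. g1 x - g2 x)" using g1 g2 by simp
    fix A assume A: "A \<in> sets M"
    have "integrable \<rho> (\<lambda>x. indicator A x * g x)" if "integrable \<rho> g" for g :: "'a \<Rightarrow> real"
      using integrable_mult_indicator[of A \<rho> g] that A \<rho>(2) by simp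
    with g1 g2 A show "\<nu> A = (\<integral>x. indicator A x * (g1 x - g2 x) \<partial>\<rho>)"
      by (simp add: jordan_decomposition right_diff_distrib)
  qed
qed

end

lemma finite_signed_measure_complex:
  assumes "complex_measure M \<mu>"
  shows "finite_signed_measure M (\<lambda>A. Re (\<mu> A))" "finite_signed_measure M (\<lambda>A. Im (\<mu> A))"
  using complex_measure_sums[OF assms]
  by (unfold_locales, auto simp: sums_complex_iff)

lemma radon_nikodym_complex:
  assumes \<mu>: "complex_measure M \<mu>"
    and \<rho>: "sigma_finite_measure \<rho>" "sets \<rho> = sets M"
    and ac: "\<And>A. A \<in> sets M \<Longrightarrow> emeasure \<rho> A = 0 \<Longrightarrow> \<mu> A = 0"
  obtains F :: "'a \<Rightarrow> complex" where "integrable \<rho> F"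
    "\<And>A. A \<in> sets M \<Longrightarrow> \<mu> A = (\<integral>x. indicator A x * F x \<partial>\<rho>)"
proof -
  interpret re: finite_signed_measure M "\<lambda>A. Re (\<mu> A)" by (rule finite_signed_measure_complex[OF \<mu>])
  interpret im: finite_signed_measure M "\<lambda>A. Im (\<mu> A)" by (rule finite_signed_measure_complex[OF \<mu>])
  obtain g where g: "integrable \<rho> g" "\<And>A. A \<in> sets M \<Longrightarrow> Re (\<mu> A) = (\<integral>x. indicator A x * g x \<partial>\<rho>)"
    using re.radon_nikodym_signed[OF \<rho>] ac by (metis zero_complex.sel(1))
  obtain h where h: "integrable \<rho> h" "\<And>A. A \<in> sets M \<Longrightarrow> Im (\<mu> A) = (\<integral>x. indicator A x * h x \<partial>\<rho>)"
    using im.radon_nikodym_signed[OF \<rho>] ac by (metis zero_complex.sel(2))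
  define F where "F x = complex_of_real (g x) + \<i> * complex_of_real (h x)" for x
  show thesis
  proof
    show F: "integrable \<rho> F" unfolding F_def using g h by auto
    fix A assume A: "A \<in> sets M"
    have I: "integrable \<rho> (\<lambda>x. indicator A x * k x)" if "integrable \<rho> k" for k :: "'a \<Rightarrow> real"
      using integrable_mult_indicator[of A \<rho> k] that A \<rho>(2) by simp
    have "(\<integral>x. indicator A x * F x \<partial>\<rho>) =
        (\<integral>x. complex_of_real (indicator A x * g x) + \<i> * complex_of_real (indicator A x * h x) \<partial>\<rho>)"
      by (rule Bochner_Integration.integral_cong) (auto simp: F_def indicator_def)
    also have "\<dots> = complex_of_real (Re (\<mu> A)) + \<i> * complex_of_real (Im (\<mu> A))"
      using I[OF g(1)] I[OF h(1)] A g(2) h(2)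
      by (subst Bochner_Integration.integral_add) (auto simp del: of_real_mult)
    also have "\<dots> = \<mu> A" by (rule complex_eq[symmetric])
    finally show "\<mu> A = (\<integral>x. indicator A x * F x \<partial>\<rho>)" by simp
  qed
qed

section \<open>Measures given by a density, and integration against them\<close>

lemma integrable_indicator_mult:
  fixes F :: "'a \<Rightarrow> 'b :: {real_normed_field, banach, second_countable_topology}"
  assumes "integrable \<rho> F" "A \<in> sets \<rho>"
  shows "integrable \<rho> (\<lambda>x. indicator A x * F x)"
proof -
  have "(\<lambda>x. indicator A x * F x) = (\<lambda>x. indicator A x *\<^sub>R F x)"
    by (auto simp: indicator_def fun_eq_iff)
  then show ?thesis using integrable_mult_indicator[OF assms(2,1)] by simp
qed

lemma complex_measure_density:
  fixes F :: "'a \<Rightarrow> complex"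
  assumes F: "integrable \<rho> F" and M: "sets \<rho> = sets M"
  shows "complex_measure M (\<lambda>A. if A \<in> sets M then \<integral>x. indicator A x * F x \<partial>\<rho> else 0)"
  unfolding complex_measure_def
proof (intro conjI allI impI)
  fix A :: "nat \<Rightarrow> 'a set"
  assume A: "range A \<subseteq> sets M" "disjoint_family A"
  have A': "A i \<in> sets \<rho>" for i using A(1) M by auto
  have [measurable]: "F \<in> borel_measurable \<rho>" using F by auto
  have "(\<Sum>i<n. \<integral>x. indicator (A i) x * F x \<partial>\<rho>) = (\<integral>x. indicator (\<Union>i<n. A i) x * F x \<partial>\<rho>)" for n
  proof -
    have "indicator (\<Union>i<n. A i) x = (\<Sum>i<n. indicator (A i) x :: complex)" for x
      using A(2) by (intro indicator_UN_disjoint) (auto simp: disjoint_family_on_def)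
    then have "(\<integral>x. indicator (\<Union>i<n. A i) x * F x \<partial>\<rho>) = (\<integral>x. (\<Sum>i<n. indicator (A i) x * F x) \<partial>\<rho>)"
      by (simp only: sum_distrib_right)
    also have "\<dots> = (\<Sum>i<n. \<integral>x. indicator (A i) x * F x \<partial>\<rho>)"
      using F A' by (intro Bochner_Integration.integral_sum integrable_indicator_mult)
    finally show ?thesis by simp
  qed
  moreover have "(\<lambda>n. \<integral>x. indicator (\<Union>i<n. A i) x * F x \<partial>\<rho>) \<longlonglongrightarrow>
      (\<integral>x. indicator (\<Union>i. A i) x * F x \<partial>\<rho>)"
  proof (rule integral_dominated_convergence)
    show "integrable \<rho> (\<lambda>x. norm (F x))" using F by simp
    show "AE x in \<rho>. (\<lambda>n. indicator (\<Union>i<n. A i) x * F x) \<longlonglongrightarrow> indicator (\<Union>i. A i) x * F x"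
      by (intro AE_I2 tendsto_mult_right LIMSEQ_indicator_UN)
    show "AE x in \<rho>. norm (indicator (\<Union>i<n. A i) x * F x) \<le> norm (F x)" for n
      by (intro AE_I2) (auto simp: indicator_def)
  qed (use A' in measurable)
  ultimately have "(\<lambda>n. \<integral>x. indicator (A n) x * F x \<partial>\<rho>) sums (\<integral>x. indicator (\<Union>n. A n) x * F x \<partial>\<rho>)"
    by (simp add: sums_def)
  then show "(\<lambda>n. if A n \<in> sets M then \<integral>x. indicator (A n) x * F x \<partial>\<rho> else 0) sums
       (if (\<Union>n. A n) \<in> sets M then \<integral>x. indicator (\<Union>n. A n) x * F x \<partial>\<rho> else 0)"
    using A by (auto simp: range_subsetD)
qed simp

text \<open>The supremum over subsets of \<open>A\<close> is attained at the part of
  \<open>A\<close> where \<open>F > 0\<close>. The density on the right is the positive part of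
  \<open>F\<close>, since \<open>ennreal\<close> truncates negative values.\<close>

lemma upper_variation_of_density:
  fixes F :: "'a \<Rightarrow> real"
  assumes F: "integrable \<rho> F" and M: "sets \<rho> = sets M"
  shows "upper_variation M (\<lambda>A. if A \<in> sets M then \<integral>x. indicator A x * F x \<partial>\<rho> else 0) =
    density \<rho> (\<lambda>x. ennreal (F x))"
proof -
  let ?\<nu> = "\<lambda>A. if A \<in> sets M then \<integral>x. indicator A x * F x \<partial>\<rho> else 0"
  have [measurable]: "F \<in> borel_measurable \<rho>" using F by auto
  have eq: "(SUP B \<in> {B \<in> sets M. B \<subseteq> A}. ennreal (?\<nu> B)) = emeasure (density \<rho> (\<lambda>x. ennreal (F x))) A"
    if A: "A \<in> sets M" for A
  proof (rule antisym)
    have A'[measurable]: "A \<in> sets \<rho>" using A M by simp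
    have nn: "ennreal (\<integral>x. indicator B x * max 0 (F x) \<partial>\<rho>) = (\<integral>\<^sup>+x. ennreal (F x) * indicator B x \<partial>\<rho>)"
      if "B \<in> sets \<rho>" for B
    proof -
      have "(\<integral>\<^sup>+x. ennreal (F x) * indicator B x \<partial>\<rho>) = (\<integral>\<^sup>+x. ennreal (indicator B x * max 0 (F x)) \<partial>\<rho>)"
        by (rule nn_integral_cong) (auto simp: indicator_def max_def ennreal_neg)
      also have "\<dots> = ennreal (\<integral>x. indicator B x * max 0 (F x) \<partial>\<rho>)"
        using F that by (intro nn_integral_eq_integral integrable_indicator_mult) auto
      finally show ?thesis by simp
    qed
    show "(SUP B \<in> {B \<in> sets M. B \<subseteq> A}. ennreal (?\<nu> B)) \<le> emeasure (density \<rho> (\<lambda>x. ennreal (F x))) A"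
    proof (rule SUP_least, clarify)
      fix B assume B: "B \<in> sets M" "B \<subseteq> A"
      then have B': "B \<in> sets \<rho>" using M by simp
      have "ennreal (?\<nu> B) \<le> ennreal (\<integral>x. indicator B x * max 0 (F x) \<partial>\<rho>)"
      proof -
        have "(\<integral>x. indicator B x * F x \<partial>\<rho>) \<le> (\<integral>x. indicator B x * max 0 (F x) \<partial>\<rho>)"
          using B' F by (intro integral_mono integrable_indicator_mult mult_left_mono) auto
        then show ?thesis using B by (simp add: ennreal_leI)
      qed
      also have "\<dots> = (\<integral>\<^sup>+x. ennreal (F x) * indicator B x \<partial>\<rho>)" using nn B' by simp
      also have "\<dots> \<le> (\<integral>\<^sup>+x. ennreal (F x) * indicator A x \<partial>\<rho>)"
        using B by (intro nn_integral_mono) (auto simp: indicator_def)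
      finally show "ennreal (?\<nu> B) \<le> emeasure (density \<rho> (\<lambda>x. ennreal (F x))) A"
        using A' by (simp add: emeasure_density)
    qed
    define B where "B = A \<inter> {x \<in> space \<rho>. F x > 0}"
    have B: "B \<in> sets \<rho>" unfolding B_def by measurable
    have "emeasure (density \<rho> (\<lambda>x. ennreal (F x))) A = (\<integral>\<^sup>+x. ennreal (F x) * indicator B x \<partial>\<rho>)"
      unfolding emeasure_density[OF measurable_compose[OF \<open>F \<in> borel_measurable \<rho>\<close> measurable_ennreal] A']
      by (rule nn_integral_cong) (auto simp: B_def indicator_def ennreal_neg)
    also have "\<dots> = ennreal (\<integral>x. indicator B x * max 0 (F x) \<partial>\<rho>)" using nn B by simp
    also have "(\<integral>x. indicator B x * max 0 (F x) \<partial>\<rho>) = (\<integral>x. indicator B x * F x \<partial>\<rho>)"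
      by (rule Bochner_Integration.integral_cong) (auto simp: B_def indicator_def)
    also have "ennreal \<dots> = ennreal (?\<nu> B)" using B M by simp
    also have "\<dots> \<le> (SUP B \<in> {B \<in> sets M. B \<subseteq> A}. ennreal (?\<nu> B))"
      using B M by (intro SUP_upper) (auto simp: B_def)
    finally show "emeasure (density \<rho> (\<lambda>x. ennreal (F x))) A \<le> \<dots>" .
  qed
  have "upper_variation M ?\<nu> = measure_of (space M) (sets M) (emeasure (density \<rho> (\<lambda>x. ennreal (F x))))"
    unfolding upper_variation_def
    by (rule measure_of_eq) (use sets.space_closed eq in \<open>auto simp: sets.sigma_sets_eq\<close>)
  also have "\<dots> = density \<rho> (\<lambda>x. ennreal (F x))"
    using measure_of_of_measure[of "density \<rho> (\<lambda>x. ennreal (F x))"] M sets_eq_imp_space_eq[OF M] by simp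
  finally show ?thesis .
qed

lemma integrable_mult_bounded:
  fixes F :: "'a \<Rightarrow> 'b :: {real_normed_field, banach, second_countable_topology}"
  assumes "integrable \<rho> F" "\<phi> \<in> borel_measurable \<rho>" "\<And>x. norm (\<phi> x) \<le> C"
  shows "integrable \<rho> (\<lambda>x. F x * \<phi> x)"
proof (rule Bochner_Integration.integrable_bound)
  show "integrable \<rho> (\<lambda>x. C * norm (F x))" using assms by simp
  show "AE x in \<rho>. norm (F x * \<phi> x) \<le> norm (C * norm (F x))"
  proof (rule AE_I2)
    fix x
    have "norm (\<phi> x) * norm (F x) \<le> \<bar>C\<bar> * norm (F x)"
      using assms(3)[of x] by (intro mult_right_mono) auto
    then show "norm (F x * \<phi> x) \<le> norm (C * norm (F x))" by (simp add: norm_mult abs_mult mult.commute)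
  qed
qed (use assms in auto)

text \<open>By \<open>upper_variation_of_density\<close> the two variations have the densities
  \<open>max 0 F\<close> and \<open>max 0 (- F)\<close>, whose difference is \<open>F\<close>;
  boundedness of \<open>\<phi>\<close> makes both integrals finite, so that they can be combined
  into one.\<close>

lemma signed_integral_density:
  fixes F :: "'a \<Rightarrow> real"
  assumes F: "integrable \<rho> F" and M: "sets \<rho> = sets M"
    and \<phi>: "\<phi> \<in> borel_measurable \<rho>" "\<And>x. norm (\<phi> x) \<le> C"
    and \<nu>: "\<nu> = (\<lambda>A. if A \<in> sets M then \<integral>x. indicator A x * F x \<partial>\<rho> else 0)"
  shows "signed_integral M \<nu> \<phi> = (\<integral>x. of_real (F x) * \<phi> x \<partial>\<rho>)"
proof -
  have [measurable]: "F \<in> borel_measurable \<rho>" "\<phi> \<in> borel_measurable \<rho>" using F \<phi> by auto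
  have *: "(\<integral>x. \<phi> x \<partial>upper_variation M (\<lambda>A. if A \<in> sets M then \<integral>x. indicator A x * G x \<partial>\<rho> else 0)) =
      (\<integral>x. of_real (max 0 (G x)) * \<phi> x \<partial>\<rho>)" if G: "integrable \<rho> G" for G :: "'a \<Rightarrow> real"
  proof -
    have [measurable]: "G \<in> borel_measurable \<rho>" using G by auto
    have "(\<lambda>x. ennreal (G x)) = (\<lambda>x. ennreal (max 0 (G x)))"
      by (auto simp: fun_eq_iff max_def ennreal_neg)
    then have "density \<rho> (\<lambda>x. ennreal (G x)) = density \<rho> (\<lambda>x. ennreal (max 0 (G x)))" by simp
    then show ?thesis
      unfolding upper_variation_of_density[OF G M]
      using integral_density[of \<phi> \<rho> "\<lambda>x. max 0 (G x)"] by (simp add: scaleR_conv_of_real)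
  qed
  have neg: "(\<lambda>A. - \<nu> A) = (\<lambda>A. if A \<in> sets M then \<integral>x. indicator A x * (- F x) \<partial>\<rho> else 0)"
    by (auto simp: \<nu> fun_eq_iff)
  have "integrable \<rho> (\<lambda>x. complex_of_real (max 0 (G x)) * \<phi> x)" if G: "integrable \<rho> G" for G :: "'a \<Rightarrow> real"
    using that by (intro integrable_mult_bounded[where C = C] \<phi>) auto
  then have "signed_integral M \<nu> \<phi> =
      (\<integral>x. of_real (max 0 (F x)) * \<phi> x - of_real (max 0 (- F x)) * \<phi> x \<partial>\<rho>)"
    unfolding signed_integral_def neg unfolding \<nu> using F by (subst (1 2) *) auto
  also have "\<dots> = (\<integral>x. of_real (F x) * \<phi> x \<partial>\<rho>)"
    by (rule Bochner_Integration.integral_cong) (auto simp: max_def)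
  finally show ?thesis .
qed

lemma complex_measure_integral_density:
  fixes F :: "'a \<Rightarrow> complex"
  assumes F: "integrable \<rho> F" and M: "sets \<rho> = sets M"
    and \<phi>: "\<phi> \<in> borel_measurable \<rho>" "\<And>x. norm (\<phi> x) \<le> C"
    and \<mu>: "\<mu> = (\<lambda>A. if A \<in> sets M then \<integral>x. indicator A x * F x \<partial>\<rho> else 0)"
  shows "complex_measure_integral M \<mu> \<phi> = (\<integral>x. F x * \<phi> x \<partial>\<rho>)"
proof -
  have I: "integrable \<rho> (\<lambda>x. indicator A x * F x)" if "A \<in> sets M" for A
    using F that M by (intro integrable_indicator_mult) auto
  have re: "(\<lambda>A. Re (\<mu> A)) = (\<lambda>A. if A \<in> sets M then \<integral>x. indicator A x * Re (F x) \<partial>\<rho> else 0)"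
  proof
    fix A
    have "Re (indicator A x * F x) = indicator A x * Re (F x)" for x by (auto simp: indicator_def)
    then show "Re (\<mu> A) = (if A \<in> sets M then \<integral>x. indicator A x * Re (F x) \<partial>\<rho> else 0)"
      using integral_Re[OF I, of A] by (simp add: \<mu>)
  qed
  have im: "(\<lambda>A. Im (\<mu> A)) = (\<lambda>A. if A \<in> sets M then \<integral>x. indicator A x * Im (F x) \<partial>\<rho> else 0)"
  proof
    fix A
    have "Im (indicator A x * F x) = indicator A x * Im (F x)" for x by (auto simp: indicator_def)
    then show "Im (\<mu> A) = (if A \<in> sets M then \<integral>x. indicator A x * Im (F x) \<partial>\<rho> else 0)"
      using integral_Im[OF I, of A] by (simp add: \<mu>)
  qed
  have int: "integrable \<rho> (\<lambda>x. complex_of_real (G x) * \<phi> x)" if "integrable \<rho> G" for G :: "'a \<Rightarrow> real"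
    using that by (intro integrable_mult_bounded[where C = C] \<phi>) auto
  have "complex_measure_integral M \<mu> \<phi> =
      (\<integral>x. of_real (Re (F x)) * \<phi> x \<partial>\<rho>) + \<i> * (\<integral>x. of_real (Im (F x)) * \<phi> x \<partial>\<rho>)"
    unfolding complex_measure_integral_def
    using signed_integral_density[OF _ M \<phi> re] signed_integral_density[OF _ M \<phi> im] F by simp
  also have "\<dots> = (\<integral>x. of_real (Re (F x)) * \<phi> x + \<i> * (of_real (Im (F x)) * \<phi> x) \<partial>\<rho>)"
    using int F by (subst Bochner_Integration.integral_add) auto
  also have "\<dots> = (\<integral>x. F x * \<phi> x \<partial>\<rho>)"
  proof (rule Bochner_Integration.integral_cong[OF refl])
    fix x
    have "of_real (Re (F x)) * \<phi> x + \<i> * (of_real (Im (F x)) * \<phi> x) =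
      (of_real (Re (F x)) + \<i> * of_real (Im (F x))) * \<phi> x" by (simp add: algebra_simps)
    then show "of_real (Re (F x)) * \<phi> x + \<i> * (of_real (Im (F x)) * \<phi> x) = F x * \<phi> x"
      by (simp only: complex_eq[symmetric])
  qed
  finally show ?thesis .
qed

section \<open>Measures on the hyperbola branch\<close>

text \<open>On the sets where \<open>g > 0\<close> and where \<open>g < 0\<close> the integrand has
  constant sign, and there a vanishing integral forces vanishing almost everywhere.\<close>

lemma AE_eq_0_if_set_integrals_0_real:
  fixes g :: "'a \<Rightarrow> real"
  assumes g: "integrable M g" and 0: "\<And>A. A \<in> sets M \<Longrightarrow> (\<integral>x. indicator A x * g x \<partial>M) = 0"
  shows "AE x in M. g x = 0"
proof -
  have [measurable]: "g \<in> borel_measurable M" using g by auto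
  have pos: "AE x in M. indicator {x \<in> space M. h x > 0} x * h x = 0"
    if "integrable M h" "\<And>A. A \<in> sets M \<Longrightarrow> (\<integral>x. indicator A x * h x \<partial>M) = 0" for h :: "'a \<Rightarrow> real"
  proof -
    have [measurable]: "h \<in> borel_measurable M" using that by auto
    have "integrable M (\<lambda>x. indicator {x \<in> space M. h x > 0} x * h x)"
      by (rule integrable_indicator_mult[OF that(1)]) measurable
    moreover have "(\<integral>x. indicator {x \<in> space M. h x > 0} x * h x \<partial>M) = 0"
      by (rule that(2)) measurable
    moreover have "AE x in M. 0 \<le> indicator {x \<in> space M. h x > 0} x * h x"
      by (auto simp: indicator_def)
    ultimately show ?thesis using integral_nonneg_eq_0_iff_AE by blast
  qed
  have "AE x in M. indicator {x \<in> space M. g x > 0} x * g x = 0" using pos[OF g 0] .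
  moreover have "AE x in M. indicator {x \<in> space M. - g x > 0} x * (- g x) = 0"
    by (rule pos) (use g 0 in simp_all)
  moreover have "AE x in M. x \<in> space M" by simp
  ultimately show ?thesis
    by eventually_elim (auto simp: indicator_def split: if_splits)
qed

lemma AE_eq_0_if_set_integrals_0:
  fixes f :: "'a \<Rightarrow> complex"
  assumes f: "integrable M f" and 0: "\<And>A. A \<in> sets M \<Longrightarrow> (\<integral>x. indicator A x * f x \<partial>M) = 0"
  shows "AE x in M. f x = 0"
proof -
  have "AE x in M. Re (f x) = 0"
  proof (rule AE_eq_0_if_set_integrals_0_real)
    fix A assume A: "A \<in> sets M"
    have "Re (\<integral>x. indicator A x * f x \<partial>M) = (\<integral>x. Re (indicator A x * f x) \<partial>M)"
      by (rule integral_Re[symmetric, OF integrable_indicator_mult[OF f A]])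
    also have "(\<lambda>x. Re (indicator A x * f x)) = (\<lambda>x. indicator A x * Re (f x))"
      by (auto simp: indicator_def)
    finally show "(\<integral>x. indicator A x * Re (f x) \<partial>M) = 0" using 0[OF A] by simp
  qed (use f in simp)
  moreover have "AE x in M. Im (f x) = 0"
  proof (rule AE_eq_0_if_set_integrals_0_real)
    fix A assume A: "A \<in> sets M"
    have "Im (\<integral>x. indicator A x * f x \<partial>M) = (\<integral>x. Im (indicator A x * f x) \<partial>M)"
      by (rule integral_Im[symmetric, OF integrable_indicator_mult[OF f A]])
    also have "(\<lambda>x. Im (indicator A x * f x)) = (\<lambda>x. indicator A x * Im (f x))"
      by (auto simp: indicator_def)
    finally show "(\<integral>x. indicator A x * Im (f x) \<partial>M) = 0" using 0[OF A] by simp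
  qed (use f in simp)
  ultimately show ?thesis by eventually_elim (simp add: complex_eq_iff)
qed

lemma borel_measurable_hyperbola_param [measurable]: "hyperbola_param m \<in> borel_measurable borel"
  unfolding hyperbola_param_def[abs_def] by measurable

lemma has_vector_derivative_hyperbola_param:
  assumes "t > 0"
  shows "(hyperbola_param m has_vector_derivative (1, m\<^sup>2 / (4 * pi\<^sup>2 * t\<^sup>2))) (at t)"
proof -
  have "((\<lambda>t. - m\<^sup>2 / (4 * pi\<^sup>2 * t)) has_real_derivative m\<^sup>2 / (4 * pi\<^sup>2 * t\<^sup>2)) (at t)"
    using assms by (auto intro!: derivative_eq_intros simp: field_simps power2_eq_square)
  then show ?thesis
    unfolding hyperbola_param_def[abs_def]
    by (intro has_vector_derivative_Pair)
      (auto simp: has_real_derivative_iff_has_vector_derivative)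
qed

text \<open>The first component of the velocity is 1, so the density of arc length is positive
  everywhere and has the same null sets as Lebesgue measure in the parameter.\<close>

lemma arc_length_null_iff:
  assumes A[measurable]: "A \<in> sets borel"
  shows "emeasure (arc_length_measure (hyperbola_param m) {0<..}) A = 0 \<longleftrightarrow>
    (AE t in lborel. t > 0 \<longrightarrow> hyperbola_param m t \<notin> A)"
proof -
  let ?L = "restrict_space lborel {0::real<..}"
  let ?d = "\<lambda>t. ennreal (norm (vector_derivative (hyperbola_param m) (at t)))"
  have d_eq: "vector_derivative (hyperbola_param m) (at t) = (1, m\<^sup>2 / (4 * pi\<^sup>2 * t\<^sup>2))" if "t > 0" for t
    using has_vector_derivative_hyperbola_param[OF that] by (rule vector_derivative_at)
  have "(\<lambda>t. ennreal (norm (1::real, m\<^sup>2 / (4 * pi\<^sup>2 * t\<^sup>2)))) \<in> borel_measurable ?L"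
    by (rule measurable_restrict_space1) measurable
  also have "?this \<longleftrightarrow> ?d \<in> borel_measurable ?L"
    by (rule measurable_cong) (simp add: d_eq space_restrict_space)
  finally have [measurable]: "?d \<in> borel_measurable ?L" .
  have [measurable]: "hyperbola_param m \<in> borel_measurable ?L"
    by (rule measurable_restrict_space1) measurable
  have "emeasure (arc_length_measure (hyperbola_param m) {0<..}) A = 0 \<longleftrightarrow>
      (AE x in arc_length_measure (hyperbola_param m) {0<..}. x \<notin> A)"
    by (subst AE_iff_measurable[of A]) (auto simp: arc_length_measure_def)
  also have "\<dots> \<longleftrightarrow> (AE t in density ?L ?d. hyperbola_param m t \<notin> A)"
    unfolding arc_length_measure_def by (rule AE_distr_iff) auto
  also have "\<dots> \<longleftrightarrow> (AE t in ?L. 0 < ?d t \<longrightarrow> hyperbola_param m t \<notin> A)"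
    by (rule AE_density) measurable
  also have "\<dots> \<longleftrightarrow> (AE t in lborel. t > 0 \<longrightarrow> (0 < ?d t \<longrightarrow> hyperbola_param m t \<notin> A))"
    by (subst AE_restrict_space_iff) auto
  also have "\<dots> \<longleftrightarrow> (AE t in lborel. t > 0 \<longrightarrow> hyperbola_param m t \<notin> A)"
    by (rule AE_cong) (auto simp: d_eq zero_prod_def)
  finally show ?thesis .
qed

text \<open>The scaling turns the characters at \<open>(\<alpha> * j, 0)\<close> into the
  exponentials of period 1 in \<open>s\<close>, and leaves \<open>\<gamma>\<close> as the only
  parameter of the problem.\<close>

definition scaled_param :: "real \<Rightarrow> real \<Rightarrow> real \<Rightarrow> real \<times> real" where
  "scaled_param m \<alpha> s = hyperbola_param m (2 / \<alpha> * s)"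

lemma borel_measurable_scaled_param [measurable]: "scaled_param m \<alpha> \<in> borel_measurable borel"
  unfolding scaled_param_def[abs_def] by measurable

lemma arc_length_null_iff_scaled:
  assumes A[measurable]: "A \<in> sets borel" and \<alpha>: "\<alpha> > 0"
  shows "emeasure (arc_length_measure (hyperbola_param m) {0<..}) A = 0 \<longleftrightarrow>
    (AE s in lborel. s > 0 \<longrightarrow> scaled_param m \<alpha> s \<notin> A)"
  unfolding arc_length_null_iff[OF A]
proof
  assume "AE t in lborel. t > 0 \<longrightarrow> hyperbola_param m t \<notin> A"
  then have "AE s in lborel. 0 + 2 / \<alpha> * s > 0 \<longrightarrow> hyperbola_param m (0 + 2 / \<alpha> * s) \<notin> A"
    using \<alpha> by (intro AE_borel_affine) auto
  then show "AE s in lborel. s > 0 \<longrightarrow> scaled_param m \<alpha> s \<notin> A"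
    using \<alpha> by (auto simp: scaled_param_def zero_less_divide_iff zero_less_mult_iff)
next
  assume "AE s in lborel. s > 0 \<longrightarrow> scaled_param m \<alpha> s \<notin> A"
  then have "AE t in lborel. 0 + \<alpha> / 2 * t > 0 \<longrightarrow> scaled_param m \<alpha> (0 + \<alpha> / 2 * t) \<notin> A"
    using \<alpha> by (intro AE_borel_affine) auto
  then show "AE t in lborel. t > 0 \<longrightarrow> hyperbola_param m t \<notin> A"
    using \<alpha> by (auto simp: scaled_param_def zero_less_divide_iff zero_less_mult_iff)
qed

lemma scaled_param_in_branch:
  assumes "\<alpha> > 0" "s > 0"
  shows "scaled_param m \<alpha> s \<in> hyperbola_branch m"
  using assms by (simp add: scaled_param_def hyperbola_branch_eq)

text \<open>Densities are taken with respect to \<open>ds\<close> instead of arc length, which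
  changes no null sets. For \<open>s \<le> 0\<close> the curve is off the branch; that
  \<open>f\<close> vanishes there is imposed separately where it matters.\<close>

definition hyperbola_measure :: "real \<Rightarrow> real \<Rightarrow> (real \<Rightarrow> complex) \<Rightarrow> (real \<times> real) set \<Rightarrow> complex" where
  "hyperbola_measure m \<alpha> f A =
     (if A \<in> sets borel then \<integral>s. indicator A (scaled_param m \<alpha> s) * f s \<partial>lborel else 0)"

lemma integrable_indicator_comp:
  fixes f :: "'a \<Rightarrow> complex"
  assumes "integrable M f" "X \<in> measurable M N" "A \<in> sets N"
  shows "integrable M (\<lambda>s. indicator A (X s) * f s)"
proof -
  have "integrable M (\<lambda>s. indicator (X -` A \<inter> space M) s * f s)"
    using assms by (intro integrable_indicator_mult) auto
  then show ?thesis
    by (rule Bochner_Integration.integrable_cong[THEN iffD1, rotated 2]) (auto simp: indicator_def)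
qed

lemma borel_measurable_fst_real [measurable]: "fst \<in> borel_measurable (borel :: (real \<times> real) measure)"
  by (intro borel_measurable_continuous_onI continuous_intros)

text \<open>The first coordinate of a point of the curve determines its parameter, so
  \<open>f\<close> can be transported to a function \<open>F\<close> on the plane. This puts the
  measure into the form to which the density lemmas apply.\<close>

lemma hyperbola_measure_density:
  fixes f :: "real \<Rightarrow> complex" and m \<alpha> :: real
  assumes \<alpha>: "\<alpha> > 0" and f: "integrable lborel f"
  defines "\<rho> \<equiv> distr lborel borel (scaled_param m \<alpha>)"
  defines "F \<equiv> \<lambda>x. f (\<alpha> / 2 * fst x)"
  shows "integrable \<rho> F"
    "hyperbola_measure m \<alpha> f = (\<lambda>A. if A \<in> sets borel then \<integral>x. indicator A x * F x \<partial>\<rho> else 0)"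
    "\<phi> \<in> borel_measurable borel \<Longrightarrow> (\<integral>x. F x * \<phi> x \<partial>\<rho>) = (\<integral>s. f s * \<phi> (scaled_param m \<alpha> s) \<partial>lborel)"
proof -
  have [measurable]: "f \<in> borel_measurable borel" using f by auto
  have [measurable]: "F \<in> borel_measurable borel" unfolding F_def by measurable
  have F: "F (scaled_param m \<alpha> s) = f s" for s
    using \<alpha> by (simp add: F_def scaled_param_def hyperbola_param_def)
  show "integrable \<rho> F"
    unfolding \<rho>_def by (subst integrable_distr_eq) (use F f in simp_all)
  show "hyperbola_measure m \<alpha> f = (\<lambda>A. if A \<in> sets borel then \<integral>x. indicator A x * F x \<partial>\<rho> else 0)"
    unfolding \<rho>_def hyperbola_measure_def[abs_def]
    by (intro ext if_cong refl, subst integral_distr) (simp_all add: F)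
  show "(\<integral>x. F x * \<phi> x \<partial>\<rho>) = (\<integral>s. f s * \<phi> (scaled_param m \<alpha> s) \<partial>lborel)"
    if "\<phi> \<in> borel_measurable borel"
    unfolding \<rho>_def using that by (subst integral_distr) (simp_all add: F)
qed

lemma hyperbola_measure_in_AC:
  assumes \<alpha>: "\<alpha> > 0" and f: "integrable lborel f" "\<And>s. s \<le> 0 \<Longrightarrow> f s = 0"
  shows "hyperbola_measure m \<alpha> f \<in> AC m"
proof -
  have "complex_measure borel (hyperbola_measure m \<alpha> f)"
    unfolding hyperbola_measure_density(2)[OF \<alpha> f(1)]
    by (rule complex_measure_density[OF hyperbola_measure_density(1)[OF \<alpha> f(1)]]) simp
  moreover have "hyperbola_measure m \<alpha> f A = 0" if "A \<in> sets borel" "A \<inter> hyperbola_branch m = {}" for A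
  proof -
    have "indicator A (scaled_param m \<alpha> s) * f s = 0" for s
      using that f(2)[of s] scaled_param_in_branch[OF \<alpha>, of s m]
      by (cases "s > 0") (auto simp: indicator_def)
    then have "(\<lambda>s. indicator A (scaled_param m \<alpha> s) * f s) = (\<lambda>_. 0)" by blast
    then show ?thesis by (simp only: hyperbola_measure_def) simp
  qed
  moreover have "hyperbola_measure m \<alpha> f A = 0"
    if A: "A \<in> sets borel" "emeasure (arc_length_measure (hyperbola_param m) {0<..}) A = 0" for A
  proof -
    have "AE s in lborel. indicator A (scaled_param m \<alpha> s) * f s = 0"
      using A(2) unfolding arc_length_null_iff_scaled[OF A(1) \<alpha>]
      by eventually_elim (use f(2) in \<open>force simp: indicator_def\<close>)
    then show ?thesis using A by (simp add: hyperbola_measure_def integral_eq_zero_AE)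
  qed
  ultimately show ?thesis by (simp add: AC_def)
qed

text \<open>Radon-Nikodym with respect to the image \<open>\<rho>\<close> of Lebesgue measure under
  the curve, whose null sets are arc length null.\<close>

lemma AC_eq_hyperbola_measure:
  assumes \<alpha>: "\<alpha> > 0" and \<mu>: "\<mu> \<in> AC m"
  obtains f where "integrable lborel f" "\<And>s. s \<le> 0 \<Longrightarrow> f s = 0" "\<mu> = hyperbola_measure m \<alpha> f"
proof -
  define \<rho> where "\<rho> = distr lborel borel (scaled_param m \<alpha>)"
  have sf: "sigma_finite_measure \<rho>"
  \<comment> \<open>The vertical strip \<open>|x1| \<le> n\<close> has finite
    \<open>\<rho>\<close>-measure, because only an interval of parameters of length
    \<open>\<alpha> * n\<close> maps into it.\<close>
  proof (rule sigma_finite_measure.intro, intro exI[of _ "range (\<lambda>n. fst -` {- real n..real n})"] conjI ballI)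
    have [measurable]: "fst -` {- real n..real n} \<in> sets (borel :: (real \<times> real) measure)" for n
      by (intro borel_closed closed_vimage_fst) auto
    show "range (\<lambda>n. fst -` {- real n..real n}) \<subseteq> sets \<rho>" by (auto simp: \<rho>_def)
    have "\<exists>n. - real n \<le> x \<and> x \<le> real n" for x
      using real_arch_simple[of "\<bar>x\<bar>"] by (auto simp: abs_le_iff intro: minus_le_iff[THEN iffD1])
    then show "\<Union> (range (\<lambda>n. fst -` {- real n..real n})) = space \<rho>" by (auto simp: \<rho>_def)
    fix B assume "B \<in> range (\<lambda>n. fst -` {- real n..real n} :: (real \<times> real) set)"
    then obtain n where B: "B = fst -` {- real n..real n}" by auto
    have "emeasure \<rho> B = emeasure lborel (scaled_param m \<alpha> -` fst -` {- real n..real n})"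
      by (simp add: \<rho>_def emeasure_distr B)
    also have "\<dots> \<le> emeasure lborel {- (\<alpha> / 2 * real n)..\<alpha> / 2 * real n}"
      using \<alpha> by (intro emeasure_mono)
        (auto simp: scaled_param_def hyperbola_param_def pos_le_divide_eq pos_divide_le_eq algebra_simps)
    also have "\<dots> < \<infinity>" using \<alpha> by (subst emeasure_lborel_Icc) auto
    finally show "emeasure \<rho> B \<noteq> \<infinity>" by simp
  qed simp
  have sets: "sets \<rho> = sets borel" by (simp add: \<rho>_def)
  have cm: "complex_measure borel \<mu>" and supp: "\<And>A. A \<in> sets borel \<Longrightarrow> A \<inter> hyperbola_branch m = {} \<Longrightarrow> \<mu> A = 0"
    and ac: "\<And>A. A \<in> sets borel \<Longrightarrow> emeasure (arc_length_measure (hyperbola_param m) {0<..}) A = 0 \<Longrightarrow> \<mu> A = 0"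
    using \<mu> by (auto simp: AC_def)
  \<comment> \<open>\<open>\<rho>\<close> also charges the parameters \<open>s \<le> 0\<close>, so
    being \<open>\<rho>\<close>-null is stronger than being null for arc length.\<close>
  have "\<mu> A = 0" if A: "A \<in> sets borel" "emeasure \<rho> A = 0" for A
  proof (rule ac[OF A(1)])
    have [measurable]: "A \<in> sets borel" by fact
    have "AE x in \<rho>. x \<notin> A"
      using A by (intro AE_not_in) (simp add: null_sets_def sets)
    then have "AE s in lborel. scaled_param m \<alpha> s \<notin> A"
      unfolding \<rho>_def by (subst (asm) AE_distr_iff) auto
    then show "emeasure (arc_length_measure (hyperbola_param m) {0<..}) A = 0"
      unfolding arc_length_null_iff_scaled[OF A(1) \<alpha>] by eventually_elim simp
  qed
  then obtain F where F: "integrable \<rho> F" "\<And>A. A \<in> sets borel \<Longrightarrow> \<mu> A = (\<integral>x. indicator A x * F x \<partial>\<rho>)"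
    using radon_nikodym_complex[OF cm sf sets] by metis
  have F_m[measurable]: "F \<in> borel_measurable borel" using F(1) by (auto simp: \<rho>_def)
  define f where "f s = indicator {0<..} s * F (scaled_param m \<alpha> s)" for s
  have intF: "integrable lborel (\<lambda>s. F (scaled_param m \<alpha> s))"
    using F(1) unfolding \<rho>_def by (subst (asm) integrable_distr_eq) auto
  show thesis
  proof
    show "integrable lborel f" unfolding f_def using intF by (rule integrable_indicator_mult) simp
    show "f s = 0" if "s \<le> 0" for s using that by (simp add: f_def)
    show "\<mu> = hyperbola_measure m \<alpha> f"
    proof
      fix A
      show "\<mu> A = hyperbola_measure m \<alpha> f A"
      proof (cases "A \<in> sets borel")
        case True
        \<comment> \<open>\<open>A2\<close>, the part with nonpositive first coordinate, misses the
          branch and has \<open>\<mu>\<close>-mass 0. On \<open>A1\<close> the cut-off in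
          \<open>f\<close> is invisible.\<close>
        define A1 where "A1 = A \<inter> fst -` {0<..}"
        define A2 where "A2 = A \<inter> fst -` {..0}"
        have "fst -` {0::real<..} \<in> sets (borel :: (real \<times> real) measure)"
          by (intro borel_open open_vimage_fst) auto
        moreover have "fst -` {..0::real} \<in> sets (borel :: (real \<times> real) measure)"
          by (intro borel_closed closed_vimage_fst) auto
        ultimately have A12[measurable]: "A1 \<in> sets borel" "A2 \<in> sets borel"
          using True by (auto simp: A1_def A2_def)
        interpret re: finite_signed_measure borel "\<lambda>A. Re (\<mu> A)" by (rule finite_signed_measure_complex[OF cm])
        interpret im: finite_signed_measure borel "\<lambda>A. Im (\<mu> A)" by (rule finite_signed_measure_complex[OF cm])
        have "A1 \<inter> A2 = {}" "A1 \<union> A2 = A" by (auto simp: A1_def A2_def)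
        then have "\<mu> A = \<mu> A1 + \<mu> A2"
          using re.Un[OF A12] im.Un[OF A12] by (simp add: complex_eq_iff)
        also have "\<mu> A2 = 0"
          using A12 by (intro supp) (auto simp: A2_def hyperbola_branch_def)
        also have "\<mu> A1 = (\<integral>x. indicator A1 x * F x \<partial>\<rho>)" using A12 F(2) by simp
        also have "\<dots> = (\<integral>s. indicator A1 (scaled_param m \<alpha> s) * F (scaled_param m \<alpha> s) \<partial>lborel)"
          unfolding \<rho>_def by (subst integral_distr) auto
        also have "\<dots> = (\<integral>s. indicator A (scaled_param m \<alpha> s) * f s \<partial>lborel)"
          using \<alpha> by (intro Bochner_Integration.integral_cong)
            (auto simp: A1_def f_def indicator_def scaled_param_def hyperbola_param_def zero_less_divide_iff zero_less_mult_iff)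
        finally show ?thesis using True by (simp add: hyperbola_measure_def)
      next
        case False
        then show ?thesis using cm by (simp add: complex_measure_def hyperbola_measure_def)
      qed
    qed
  qed
qed

lemma fourier_transform_hyperbola_measure:
  assumes \<alpha>: "\<alpha> > 0" and f: "integrable lborel f"
  shows "fourier_transform (hyperbola_measure m \<alpha> f) \<xi> =
    (\<integral>s. f s * cis (pi * (scaled_param m \<alpha> s \<bullet> \<xi>)) \<partial>lborel)"
proof -
  have e: "exp (pi * \<i> * of_real (x \<bullet> \<xi>)) = cis (pi * (x \<bullet> \<xi>))" for x :: "real \<times> real"
    by (simp add: cis_conv_exp mult_ac)
  have [measurable]: "(\<lambda>x :: real \<times> real. cis (pi * (x \<bullet> \<xi>))) \<in> borel_measurable borel"
    by (intro borel_measurable_continuous_onI continuous_intros)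
  show ?thesis
    unfolding fourier_transform_def e
    by (subst complex_measure_integral_density[OF hyperbola_measure_density(1)[OF \<alpha> f] _ _ _ hyperbola_measure_density(2)[OF \<alpha> f], where C = 1])
       (use hyperbola_measure_density(3)[OF \<alpha> f, of "\<lambda>x. cis (pi * (x \<bullet> \<xi>))"] in simp_all)
qed

text \<open>The constant in \<open>\<gamma>\<close> comes from \<open>t = 2 * s / \<alpha>\<close>
  in the second coordinate of the curve. That coordinate is negative, so the frequency
  \<open>j\<close> on the second axis appears as \<open>- j\<close>; this is harmless as
  \<open>j\<close> runs over all integers.\<close>

lemma annihilates_lattice_cross_iff:
  fixes m \<alpha> \<beta> :: real
  assumes \<alpha>: "\<alpha> > 0" and f: "integrable lborel f"
  defines "\<gamma> \<equiv> \<alpha> * \<beta> * m\<^sup>2 / (16 * pi\<^sup>2)"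
  shows "(\<forall>\<xi>\<in>lattice_cross \<alpha> \<beta>. fourier_transform (hyperbola_measure m \<alpha> f) \<xi> = 0) \<longleftrightarrow>
    (\<forall>j::int. (\<integral>s. f s * cis (2 * pi * j * s) \<partial>lborel) = 0) \<and>
    (\<forall>j::int. (\<integral>s. f s * cis (2 * pi * j * (\<gamma> / s)) \<partial>lborel) = 0)"
proof -
  have 1: "fourier_transform (hyperbola_measure m \<alpha> f) (\<alpha> * of_int j, 0) = (\<integral>s. f s * cis (2 * pi * j * s) \<partial>lborel)" for j :: int
  proof -
    have "pi * (scaled_param m \<alpha> s \<bullet> (\<alpha> * of_int j, 0)) = 2 * pi * j * s" for s
      using \<alpha> by (simp add: scaled_param_def hyperbola_param_def)
    then show ?thesis by (simp only: fourier_transform_hyperbola_measure[OF \<alpha> f])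
  qed
  have 2: "fourier_transform (hyperbola_measure m \<alpha> f) (0, \<beta> * of_int j) = (\<integral>s. f s * cis (2 * pi * of_int (- j) * (\<gamma> / s)) \<partial>lborel)" for j :: int
  proof -
    have "pi * (scaled_param m \<alpha> s \<bullet> (0, \<beta> * of_int j)) = 2 * pi * of_int (- j) * (\<gamma> / s)" for s
      using \<alpha> by (simp add: scaled_param_def hyperbola_param_def \<gamma>_def field_simps power2_eq_square)
    then show ?thesis by (simp only: fourier_transform_hyperbola_measure[OF \<alpha> f])
  qed
  have "(\<forall>\<xi>\<in>lattice_cross \<alpha> \<beta>. fourier_transform (hyperbola_measure m \<alpha> f) \<xi> = 0) \<longleftrightarrow>
    (\<forall>j::int. (\<integral>s. f s * cis (2 * pi * j * s) \<partial>lborel) = 0) \<and>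
    (\<forall>j::int. (\<integral>s. f s * cis (2 * pi * of_int (- j) * (\<gamma> / s)) \<partial>lborel) = 0)"
    unfolding 1[symmetric] 2[symmetric] lattice_cross_def by auto
  also have "(\<forall>j::int. (\<integral>s. f s * cis (2 * pi * of_int (- j) * (\<gamma> / s)) \<partial>lborel) = 0) \<longleftrightarrow>
    (\<forall>j::int. (\<integral>s. f s * cis (2 * pi * j * (\<gamma> / s)) \<partial>lborel) = 0)"
    by (metis minus_minus)
  finally show ?thesis .
qed

text \<open>Every Borel set of parameters is the preimage under the curve of a vertical cylinder, so
  the measure determines all set integrals of \<open>f\<close>.\<close>

lemma hyperbola_measure_eq_0_iff:
  assumes \<alpha>: "\<alpha> > 0" and f: "integrable lborel f"
  shows "hyperbola_measure m \<alpha> f = 0 \<longleftrightarrow> (AE s in lborel. f s = 0)"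
proof
  assume 0: "hyperbola_measure m \<alpha> f = 0"
  show "AE s in lborel. f s = 0"
  proof (rule AE_eq_0_if_set_integrals_0[OF f])
    fix B :: "real set" assume B: "B \<in> sets lborel"
    define A where "A = (\<lambda>x :: real \<times> real. \<alpha> / 2 * fst x) -` B"
    have "(\<lambda>x :: real \<times> real. \<alpha> / 2 * fst x) \<in> borel_measurable borel" by measurable
    from measurable_sets[OF this, of B] have A: "A \<in> sets borel" using B by (simp add: A_def)
    have "indicator A (scaled_param m \<alpha> s) = (indicator B s :: complex)" for s
      using \<alpha> by (simp add: A_def indicator_def scaled_param_def hyperbola_param_def)
    then have "(\<integral>s. indicator B s * f s \<partial>lborel) = hyperbola_measure m \<alpha> f A"
      using A by (simp add: hyperbola_measure_def)
    then show "(\<integral>s. indicator B s * f s \<partial>lborel) = 0" using 0 by (simp add: zero_fun_def)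
  qed
next
  assume 0: "AE s in lborel. f s = 0"
  show "hyperbola_measure m \<alpha> f = 0"
  proof
    fix A
    have "AE s in lborel. indicator A (scaled_param m \<alpha> s) * f s = 0" using 0 by eventually_elim simp
    then show "hyperbola_measure m \<alpha> f A = 0 A" by (simp add: hyperbola_measure_def integral_eq_zero_AE)
  qed
qed

lemma hyperbola_measure_diff_scale:
  assumes f: "integrable lborel f" "integrable lborel g"
  shows "hyperbola_measure m \<alpha> (\<lambda>s. f s - c * g s) A = hyperbola_measure m \<alpha> f A - c * hyperbola_measure m \<alpha> g A"
proof (cases "A \<in> sets borel")
  case True
  have "integrable lborel (\<lambda>s. indicator A (scaled_param m \<alpha> s) * f s)" 
    if "integrable lborel f" for f :: "real \<Rightarrow> complex"
    using that True by (intro integrable_indicator_comp[where N = borel]) auto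
  with f True show ?thesis
    by (simp add: hyperbola_measure_def right_diff_distrib mult.left_commute[of _ c])
qed (simp add: hyperbola_measure_def)

section \<open>Fourier uniqueness on the circle\<close>

inductive trig_poly :: "(real \<Rightarrow> complex) \<Rightarrow> bool" where
  monom: "trig_poly (\<lambda>t. c * cis (of_int j * t))"
| add: "trig_poly p \<Longrightarrow> trig_poly q \<Longrightarrow> trig_poly (\<lambda>t. p t + q t)"

lemma trig_poly_const: "trig_poly (\<lambda>t. c)"
  using trig_poly.monom[of c 0] by simp

lemma trig_poly_mult:
  assumes "trig_poly p" "trig_poly q"
  shows "trig_poly (\<lambda>t. p t * q t)"
  using assms(1)
proof induction
  case (monom c j)
  show ?case
    using assms(2)
  proof induction
    case (monom d k)
    have "(\<lambda>t. (c * cis (of_int j * t)) * (d * cis (of_int k * t))) = (\<lambda>t. (c * d) * cis (of_int (j + k) * t))"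
      by (auto simp: fun_eq_iff cis_mult[symmetric] algebra_simps)
    then show ?case using trig_poly.monom[of "c * d" "j + k"] by simp
  next
    case (add p q)
    from trig_poly.add[OF add.IH] show ?case by (simp add: distrib_left)
  qed
next
  case (add p q)
  from trig_poly.add[OF add.IH] show ?case by (simp add: distrib_right)
qed

text \<open>Translates the polynomials in the real and imaginary part of \<open>z\<close> that
  Stone-Weierstrass provides on the unit circle into combinations of characters.\<close>

lemma trig_poly_real_polynomial_function:
  fixes p :: "complex \<Rightarrow> real"
  assumes "real_polynomial_function p"
  shows "trig_poly (\<lambda>t. complex_of_real (p (cis t)))"
  using assms
proof induction
  case (linear L)
  then interpret bounded_linear L .
  \<comment> \<open>The coefficients come from Euler's formulas for \<open>cos t\<close> and
    \<open>sin t\<close>, inserted into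
    \<open>L (cis t) = cos t * L 1 + sin t * L \<i>\<close>.\<close>
  have eq: "complex_of_real (L (cis t)) =
      (of_real (L 1) / 2 + of_real (L \<i>) / (2 * \<i>)) * cis (of_int 1 * t) +
      (of_real (L 1) / 2 - of_real (L \<i>) / (2 * \<i>)) * cis (of_int (- 1) * t)" for t
  proof -
    have "cis t = cos t *\<^sub>R 1 + sin t *\<^sub>R \<i>" by (simp add: complex_eq_iff)
    then have "L (cis t) = cos t * L 1 + sin t * L \<i>" by (simp only: add scaleR) simp
    then show ?thesis by (simp add: complex_eq_iff field_simps)
  qed
  show ?case unfolding eq by (intro trig_poly.intros)
next
  case (const c)
  show ?case by (rule trig_poly_const)
next
  case (add f g)
  then show ?case using trig_poly.add by simp
next
  case (mult f g)
  then show ?case using trig_poly_mult by simp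
qed

lemma trig_poly_props:
  assumes "trig_poly p"
  shows "continuous_on UNIV p" "\<exists>C. \<forall>t. norm (p t) \<le> C"
  using assms
proof induction
  case (monom c j)
  { case 1 show ?case by (intro continuous_intros) }
  { case 2 show ?case by (auto simp: norm_mult) }
next
  case (add p q)
  { case 1 with add show ?case by (intro continuous_intros) }
  { case 2
    from add obtain C D where "\<And>t. norm (p t) \<le> C" "\<And>t. norm (q t) \<le> D" by blast
    then have "norm (p t + q t) \<le> C + D" for t by (intro norm_triangle_le add_mono)
    then show ?case by blast }
qed

text \<open>Used for closed arcs of the circle and later for complements of open sets on the line.
  The case \<open>C = {}\<close> is excluded because \<open>infdist\<close> to the empty set is
  0.\<close>

lemma indicator_approx:
  fixes C :: "'a :: euclidean_space set"
  assumes "closed C" "C \<noteq> {}"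
  defines "\<phi> \<equiv> \<lambda>n z. max 0 (1 - real n * infdist z C)"
  shows "continuous_on UNIV (\<phi> n)" "0 \<le> \<phi> n z" "\<phi> n z \<le> 1"
    "(\<lambda>n. \<phi> n z) \<longlonglongrightarrow> indicator C z"
proof -
  show "continuous_on UNIV (\<phi> n)" unfolding \<phi>_def by (intro continuous_intros)
  show "0 \<le> \<phi> n z" "\<phi> n z \<le> 1" by (auto simp: \<phi>_def infdist_nonneg)
  show "(\<lambda>n. \<phi> n z) \<longlonglongrightarrow> indicator C z"
  proof (cases "z \<in> C")
    case True
    then show ?thesis by (simp add: \<phi>_def)
  next
    case False
    then have d: "infdist z C > 0"
      using assms in_closed_iff_infdist_zero[of C z] infdist_nonneg[of z C] by linarith
    obtain N :: nat where N: "real N * infdist z C > 1"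
      using reals_Archimedean3[OF d] by blast
    have "\<phi> n z = 0" if "n \<ge> N" for n
    proof -
      have "real N * infdist z C \<le> real n * infdist z C" using that d by (intro mult_right_mono) auto
      then show ?thesis using N by (simp add: \<phi>_def)
    qed
    then have "\<forall>\<^sub>F n in sequentially. \<phi> n z = 0" by (auto simp: eventually_sequentially)
    then show ?thesis using False by (simp add: tendsto_eventually)
  qed
qed

text \<open>The assumption says that the image of the complex measure \<open>f dM\<close> on the
  circle has only zero Fourier coefficients. The lemmas below carry the vanishing from characters to
  trigonometric polynomials, continuous functions, closed sets and finally Borel sets.\<close>

context
  fixes M :: "'a measure" and f :: "'a \<Rightarrow> complex" and X :: "'a \<Rightarrow> real"
  assumes f: "integrable M f" and X [measurable]: "X \<in> borel_measurable M"
    and coeffs: "\<And>j::int. (\<integral>s. f s * cis (2 * pi * j * X s) \<partial>M) = 0"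
begin

lemma integral_trig_poly_0:
  assumes "trig_poly p"
  shows "(\<integral>s. f s * p (2 * pi * X s) \<partial>M) = 0"
  using assms
proof induction
  case (monom c j)
  have "(\<integral>s. f s * (c * cis (of_int j * (2 * pi * X s))) \<partial>M) = (\<integral>s. c * (f s * cis (2 * pi * j * X s)) \<partial>M)"
    by (simp add: mult_ac)
  also have "\<dots> = 0" using coeffs[of j] by (cases "c = 0") simp_all
  finally show ?case .
next
  case (add p q)
  have "integrable M (\<lambda>s. f s * r (2 * pi * X s))" if r: "trig_poly r" for r
  proof -
    have [measurable]: "r \<in> borel_measurable borel"
      by (rule borel_measurable_continuous_onI[OF trig_poly_props(1)[OF r]])
    obtain C where "\<And>t. norm (r t) \<le> C" using trig_poly_props(2)[OF r] by blast
    then show ?thesis by (intro integrable_mult_bounded[OF f]) auto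
  qed
  with add show ?case by (simp add: distrib_left)
qed

text \<open>Uniform approximation on the circle by trigonometric polynomials, whose integrals
  vanish; the error is at most \<open>e\<close> times the \<open>L^1\<close> norm of
  \<open>f\<close>.\<close>

lemma integral_continuous_circle_0:
  fixes \<phi> :: "complex \<Rightarrow> real"
  assumes \<phi>: "continuous_on UNIV \<phi>" and b: "\<And>z. \<bar>\<phi> z\<bar> \<le> C"
  shows "(\<integral>s. f s * \<phi> (cis (2 * pi * X s)) \<partial>M) = 0"
proof -
  let ?Z = "\<lambda>s. cis (2 * pi * X s)"
  have [measurable]: "cis \<in> borel_measurable borel"
    by (intro borel_measurable_continuous_onI continuous_intros)
  have [measurable]: "\<phi> \<in> borel_measurable borel" using \<phi> by (rule borel_measurable_continuous_onI)
  have int\<phi>: "integrable M (\<lambda>s. f s * \<phi> (?Z s))"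
    by (rule integrable_mult_bounded[OF f, where C = C]) (use b in auto)
  have bound: "norm (\<integral>s. f s * \<phi> (?Z s) \<partial>M) \<le> e * (\<integral>s. norm (f s) \<partial>M)" if e: "e > 0" for e
  proof -
    have "continuous_on (sphere 0 1) \<phi>" using \<phi> by (rule continuous_on_subset) simp
    then obtain p where p: "real_polynomial_function p" "\<And>z. z \<in> sphere 0 1 \<Longrightarrow> \<bar>\<phi> z - p z\<bar> < e"
      by (rule Stone_Weierstrass_real_polynomial_function[OF compact_sphere _ e]) (rule that)
    have P: "trig_poly (\<lambda>t. complex_of_real (p (cis t)))"
      by (rule trig_poly_real_polynomial_function[OF p(1)])
    have [measurable]: "(\<lambda>t. complex_of_real (p (cis t))) \<in> borel_measurable borel"
      by (rule borel_measurable_continuous_onI[OF trig_poly_props(1)[OF P]])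
    obtain D where D: "\<And>t. norm (complex_of_real (p (cis t))) \<le> D" using trig_poly_props(2)[OF P] by blast
    have intp: "integrable M (\<lambda>s. f s * complex_of_real (p (?Z s)))"
    proof (rule integrable_mult_bounded[OF f])
      show "(\<lambda>s. complex_of_real (p (?Z s))) \<in> borel_measurable M"
        using measurable_compose[of "\<lambda>s. 2 * pi * X s" M borel "\<lambda>t. complex_of_real (p (cis t))" borel] by simp
    qed (rule D)
    have "(\<integral>s. f s * \<phi> (?Z s) \<partial>M) = (\<integral>s. f s * \<phi> (?Z s) - f s * p (?Z s) \<partial>M)"
      using integral_trig_poly_0[OF P] int\<phi> intp by simp
    also have "norm \<dots> \<le> (\<integral>s. norm (f s * \<phi> (?Z s) - f s * p (?Z s)) \<partial>M)"
      by (rule integral_norm_bound)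
    also have "\<dots> \<le> (\<integral>s. e * norm (f s) \<partial>M)"
    proof (rule integral_mono)
      fix s
      have "f s * \<phi> (?Z s) - f s * p (?Z s) = f s * of_real (\<phi> (?Z s) - p (?Z s))"
        by (simp add: right_diff_distrib)
      then have "norm (f s * \<phi> (?Z s) - f s * p (?Z s)) = norm (f s) * \<bar>\<phi> (?Z s) - p (?Z s)\<bar>"
        by (simp only: norm_mult norm_of_real)
      also have "\<dots> \<le> norm (f s) * e"
        using p(2)[of "?Z s"] by (intro mult_left_mono) auto
      finally show "norm (f s * \<phi> (?Z s) - f s * p (?Z s)) \<le> e * norm (f s)" by (simp add: mult.commute)
    qed (use f int\<phi> intp in auto)
    finally show ?thesis by simp
  qed
  have "norm (\<integral>s. f s * \<phi> (?Z s) \<partial>M) \<le> 0"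
  proof (rule field_le_epsilon)
    fix e :: real assume "e > 0"
    define I where "I = (\<integral>s. norm (f s) \<partial>M)"
    have I: "I \<ge> 0" by (simp add: I_def)
    \<comment> \<open>\<open>I + 1\<close> instead of \<open>I\<close> avoids a separate case for
      \<open>I = 0\<close>.\<close>
    have "norm (\<integral>s. f s * \<phi> (?Z s) \<partial>M) \<le> e / (I + 1) * I"
      unfolding I_def using \<open>e > 0\<close> I by (intro bound divide_pos_pos add_nonneg_pos) auto
    also have "\<dots> \<le> e" using \<open>e > 0\<close> I by (simp add: field_simps)
    finally show "norm (\<integral>s. f s * \<phi> (?Z s) \<partial>M) \<le> 0 + e" by simp
  qed
  then show ?thesis by simp
qed

lemma integral_closed_circle_0:
  assumes C: "closed C"
  shows "(\<integral>s. f s * indicator C (cis (2 * pi * X s)) \<partial>M) = 0"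
proof (cases "C = {}")
  case False
  let ?Z = "\<lambda>s. cis (2 * pi * X s)"
  define \<phi> where "\<phi> n z = max 0 (1 - real n * infdist z C)" for n z
  note \<phi> = indicator_approx[OF C False, folded \<phi>_def]
  have [measurable]: "cis \<in> borel_measurable borel"
    by (intro borel_measurable_continuous_onI continuous_intros)
  have [measurable]: "\<phi> n \<in> borel_measurable borel" for n using \<phi>(1) by (rule borel_measurable_continuous_onI)
  have [measurable]: "f \<in> borel_measurable M" using f by auto
  have [measurable]: "C \<in> sets borel" using C by simp
  have "(\<lambda>n. \<integral>s. f s * \<phi> n (?Z s) \<partial>M) \<longlonglongrightarrow> (\<integral>s. f s * of_real (indicator C (?Z s)) \<partial>M)"
  proof (rule integral_dominated_convergence)
    show "integrable M (\<lambda>s. norm (f s))" using f by simp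
    show "AE s in M. (\<lambda>n. f s * \<phi> n (?Z s)) \<longlonglongrightarrow> f s * of_real (indicator C (?Z s))"
      by (intro AE_I2 tendsto_intros \<phi>)
    show "AE s in M. norm (f s * \<phi> n (?Z s)) \<le> norm (f s)" for n
      using \<phi>(2,3) by (intro AE_I2) (auto simp: norm_mult abs_le_iff intro!: mult_left_le)
  qed measurable
  moreover have "(\<integral>s. f s * \<phi> n (?Z s) \<partial>M) = 0" for n
    by (rule integral_continuous_circle_0[OF \<phi>(1), where C = 1]) (use \<phi>(2,3) in \<open>auto simp: abs_le_iff intro: order_trans\<close>)
  ultimately have "(\<integral>s. f s * of_real (indicator C (?Z s)) \<partial>M) = 0"
    by (simp add: LIMSEQ_const_iff)
  then show ?thesis by (simp add: of_real_indicator)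
qed simp

text \<open>Both the trigonometric moments and the sets \<open>X \<le> a\<close> only see the image of \<open>X\<close> on the
  circle, where \<open>{0..a}\<close> becomes a closed arc.\<close>

lemma integral_vimage_0:
  assumes X01: "\<And>s. 0 \<le> X s" "\<And>s. X s < 1" and B: "B \<in> sets borel"
  shows "(\<integral>s. indicator B (X s) * f s \<partial>M) = 0"
proof -
  define I where "I B = (\<integral>s. indicator B (X s) * f s \<partial>M)" for B
  have intg: "integrable M (\<lambda>s. indicator B (X s) * f s)" if "B \<in> sets borel" for B
  proof -
    have "integrable M (\<lambda>s. indicator (X -` B \<inter> space M) s * f s)"
      using that f by (intro integrable_indicator_mult) auto
    then show ?thesis
      by (rule Bochner_Integration.integrable_cong[THEN iffD1, rotated 2]) (auto simp: indicator_def)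
  qed
  have I_UNIV: "I UNIV = 0" using coeffs[of 0] by (simp add: I_def)
  \<comment> \<open>Countable additivity is that of the complex measure with density
    \<open>f\<close>, applied to the preimages under \<open>X\<close>.\<close>
  have I_sums: "(\<lambda>i. I (A i)) sums I (\<Union>i. A i)" if A: "range A \<subseteq> sets borel" "disjoint_family A" for A :: "nat \<Rightarrow> real set"
  proof -
    let ?A = "\<lambda>i. X -` A i \<inter> space M"
    have 1: "I B = (\<integral>x. indicator (X -` B \<inter> space M) x * f x \<partial>M)" for B
      unfolding I_def by (rule Bochner_Integration.integral_cong) (auto simp: indicator_def)
    have m: "?A i \<in> sets M" for i using A(1) by (auto intro!: measurable_sets[OF X])
    have "disjoint_family ?A" using A(2) by (auto simp: disjoint_family_on_def)
    from complex_measure_sums[OF complex_measure_density[OF f refl] _ this]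
    have "(\<lambda>i. if ?A i \<in> sets M then \<integral>x. indicator (?A i) x * f x \<partial>M else 0) sums
        (if (\<Union>i. ?A i) \<in> sets M then \<integral>x. indicator (\<Union>i. ?A i) x * f x \<partial>M else 0)"
      using m by blast
    moreover have "(\<Union>i. ?A i) \<in> sets M" using m by blast
    ultimately have "(\<lambda>i. \<integral>x. indicator (?A i) x * f x \<partial>M) sums (\<integral>x. indicator (\<Union>i. ?A i) x * f x \<partial>M)"
      by (simp only: m if_True)
    moreover have "(\<Union>i. ?A i) = X -` (\<Union>i. A i) \<inter> space M" by auto
    ultimately show ?thesis by (simp only: 1)
  qed
  \<comment> \<open>Dynkin argument: half-lines generate the Borel sets and are stable under
    intersection. Borel measurability is carried along in the induction, because the steps for
    complements and unions need it.\<close>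
  have "Int_stable (range (\<lambda>a::real. {..a}))" "range (\<lambda>a::real. {..a}) \<subseteq> Pow UNIV"
    by (auto simp: Int_stable_def)
  moreover have "B \<in> sigma_sets UNIV (range (\<lambda>a::real. {..a}))"
    using B unfolding borel_eq_atMost by simp
  ultimately have "B \<in> sets borel \<and> I B = 0"
  proof (induction rule: sigma_sets_induct_disjoint)
    case (basic A)
    then obtain a where A: "A = {..a}" by auto
    consider "a < 0" | "a \<ge> 1" | "0 \<le> a" "a < 1" by linarith
    then have "I A = 0"
    proof cases
      case 1
      then have "indicator A (X s) = (0::complex)" for s using X01(1)[of s] by (auto simp: A indicator_def)
      then show ?thesis by (simp add: I_def)
    next
      case 2
      then have "indicator A (X s) = (1::complex)" for s using X01(2)[of s] by (auto simp: A indicator_def)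
      then show ?thesis using I_UNIV by (simp add: I_def)
    next
      case 3
      define C where "C = cis ` {0..2 * pi * a}"
      have "compact C" unfolding C_def by (intro compact_continuous_image continuous_intros) auto
      then have "closed C" by (rule compact_imp_closed)
      have "cis (2 * pi * X s) \<in> C \<longleftrightarrow> X s \<in> A" for s
      proof
        assume "X s \<in> A"
        then show "cis (2 * pi * X s) \<in> C" using X01(1)[of s] by (auto simp: C_def A)
      next
        assume "cis (2 * pi * X s) \<in> C"
        then obtain t where t: "0 \<le> t" "t \<le> 2 * pi * a" "cis (2 * pi * X s) = cis t" by (auto simp: C_def)
        have "2 * pi * a < 2 * pi" using 3 by simp
        moreover have "2 * pi * X s < 2 * pi" using X01(2)[of s] by simp
        moreover obtain n :: int where n: "2 * pi * X s = t + 2 * pi * n"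
          using t(3) sin_cos_eq_iff[of "2 * pi * X s" t] by (auto simp: complex_eq_iff)
        moreover have "0 \<le> 2 * pi * X s" using X01(1)[of s] by simp
        \<comment> \<open>Both angles lie in \<open>[0, 2 * pi)\<close>, so they differ by less than
          a full turn and \<open>n = 0\<close>.\<close>
        ultimately have "\<bar>2 * pi * real_of_int n\<bar> < 2 * pi * 1"
          using t(1,2) unfolding abs_less_iff by linarith
        then have "\<bar>n\<bar> < 1" unfolding abs_mult by simp
        then have "2 * pi * X s = t" using n by simp
        then have "2 * pi * X s \<le> 2 * pi * a" using t by simp
        then show "X s \<in> A" by (simp add: A)
      qed
      then have "I A = (\<integral>s. f s * indicator C (cis (2 * pi * X s)) \<partial>M)"
        by (simp add: I_def indicator_def mult.commute)
      then show ?thesis using integral_closed_circle_0[OF \<open>closed C\<close>] by simp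
    qed
    then show ?case by (simp add: A)
  next
    case empty
    show ?case by (simp add: I_def)
  next
    case (compl A)
    have "I (UNIV - A) = (\<integral>s. f s - indicator A (X s) * f s \<partial>M)"
      unfolding I_def by (rule Bochner_Integration.integral_cong) (auto simp: indicator_def)
    also have "\<dots> = I UNIV - I A" using f intg[of A] compl by (simp add: I_def)
    finally show ?case using compl I_UNIV by auto
  next
    case (union A)
    then have "(\<lambda>i. I (A i)) sums I (\<Union>i. A i)" by (intro I_sums) auto
    moreover have "(\<lambda>i. I (A i)) = (\<lambda>_. 0)" using union by auto
    ultimately have "I (\<Union>i. A i) = 0" by (simp add: sums_iff)
    then show ?case using union by auto
  qed
  then show ?thesis by (simp add: I_def)
qed

end

section \<open>Change of variables\<close>

text \<open>Substitution on compact intervals, then exhaustion. Since the inversion is decreasing,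
  the substitution is made with the increasing map \<open>- \<gamma> / v\<close> on the negative
  axis and followed by the reflection of \<open>v\<close>.\<close>

lemma inversion_distr:
  fixes \<gamma> :: real
  assumes \<gamma>: "\<gamma> > 0"
  shows "distr (density lborel (\<lambda>v. ennreal (\<gamma> / v\<^sup>2) * indicator {0<..} v)) borel (\<lambda>v. \<gamma> / v) =
    density lborel (indicator {0<..})" (is "?N1 = ?N2")
proof (rule measure_eqI)
  fix A assume "A \<in> sets ?N1"
  then have [measurable]: "A \<in> sets borel" by simp
  have N1: "emeasure ?N1 B =
      (\<integral>\<^sup>+v. ennreal (\<gamma> / v\<^sup>2) * indicator {0<..} v * indicator ((\<lambda>v. \<gamma> / v) -` B) v \<partial>lborel)"
    if "B \<in> sets borel" for B
  proof -
    have "(\<lambda>v. \<gamma> / v) \<in> borel_measurable borel" by measurable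
    from measurable_sets[OF this that] have "(\<lambda>v. \<gamma> / v) -` B \<in> sets borel" by simp
    then show ?thesis using that by (simp add: emeasure_distr emeasure_density)
  qed
  \<comment> \<open>The image of \<open>{1 / (n + 1)..n + 1}\<close> under the inversion; these
    intervals stay away from 0 and exhaust the positive axis.\<close>
  define I where "I n = {\<gamma> / (real n + 1)..\<gamma> * (real n + 1)}" for n
  have [measurable]: "I n \<in> sets borel" for n by (simp add: I_def)
  have eq: "emeasure ?N1 (A \<inter> I n) = emeasure ?N2 (A \<inter> I n)" for n
  proof -
    let ?a = "1 / (real n + 1)" and ?b = "real n + 1"
    have pos: "v > 0" if "v \<in> {?a..?b}" for v using that by (auto intro: less_le_trans[rotated])
    have iff: "\<gamma> / v \<in> I n \<longleftrightarrow> v \<in> {?a..?b}" if "v > 0" for v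
    proof -
      have le: "\<gamma> / c \<le> \<gamma> / d \<longleftrightarrow> d \<le> c" if "c > 0" "d > 0" for c d :: real
        using that \<gamma> by (simp add: divide_inverse)
      have "\<gamma> / v \<le> \<gamma> * ?b \<longleftrightarrow> ?a \<le> v" using le[of v ?a] that by simp
      then show ?thesis using le[of ?b v] that by (auto simp: I_def)
    qed
    have "emeasure ?N2 (A \<inter> I n) = (\<integral>\<^sup>+x. ennreal (indicator A x) * indicator {- \<gamma> / (- ?b)..- \<gamma> / (- ?a)} x \<partial>lborel)"
    proof -
      have "x > 0" if "x \<in> I n" for x
        using that \<gamma> by (auto simp: I_def intro: less_le_trans[rotated])
      moreover have "{- \<gamma> / (- ?b)..- \<gamma> / (- ?a)} = I n"
        unfolding I_def minus_divide_divide by simp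
      ultimately show ?thesis
        by (subst emeasure_density) (auto intro!: nn_integral_cong simp: indicator_def)
    qed
    also have "\<dots> = (\<integral>\<^sup>+v. ennreal (indicator A (- \<gamma> / v) * (\<gamma> / v\<^sup>2)) * indicator {- ?b..- ?a} v \<partial>lborel)"
    proof (rule trans[OF _ trans[OF nn_integral_substitution[where g = "\<lambda>v. - \<gamma> / v" and g' = "\<lambda>v. \<gamma> / v\<^sup>2" and a = "- ?b" and b = "- ?a" and f = "indicator A"]]])
      fix v assume v: "v \<in> {- ?b..- ?a}"
      then have "v < 0" using pos[of "- v"] by auto
      then show "((\<lambda>v. - \<gamma> / v) has_real_derivative \<gamma> / v\<^sup>2) (at v)"
        by (auto intro!: derivative_eq_intros simp: power2_eq_square)
    next
      have "0 \<notin> {- ?b..- ?a}" using pos[of 0] by auto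
      then show "continuous_on {- ?b..- ?a} (\<lambda>v. \<gamma> / v\<^sup>2)" by (auto intro!: continuous_intros)
    next
      have "?a \<le> 1" "1 \<le> ?b" by simp_all
      then show "- ?b \<le> - ?a" by linarith
    qed (use \<gamma> in \<open>auto simp: set_borel_measurable_def indicator_def intro!: nn_integral_cong\<close>)
    also have "\<dots> = (\<integral>\<^sup>+v. ennreal (indicator A (\<gamma> / v) * (\<gamma> / v\<^sup>2)) * indicator {?a..?b} v \<partial>lborel)"
      by (subst nn_integral_real_affine[where c = "-1" and t = 0])
        (auto intro!: nn_integral_cong simp: indicator_def)
    also have "\<dots> = (\<integral>\<^sup>+v. ennreal (\<gamma> / v\<^sup>2) * indicator {0<..} v * indicator ((\<lambda>v. \<gamma> / v) -` (A \<inter> I n)) v \<partial>lborel)"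
    proof (rule nn_integral_cong)
      fix v :: real
      show "ennreal (indicator A (\<gamma> / v) * (\<gamma> / v\<^sup>2)) * indicator {?a..?b} v =
          ennreal (\<gamma> / v\<^sup>2) * indicator {0<..} v * indicator ((\<lambda>v. \<gamma> / v) -` (A \<inter> I n)) v"
      proof (cases "v > 0")
        case True
        show ?thesis unfolding indicator_def vimage_eq Int_iff iff[OF True] using True by simp
      next
        case False
        then have "v \<notin> {?a..?b}" using pos by blast
        with False show ?thesis by simp
      qed
    qed
    also have "\<dots> = emeasure ?N1 (A \<inter> I n)"
      by (rule N1[symmetric]) measurable
    finally show ?thesis by simp
  qed
  have U: "(\<Union>n. A \<inter> I n) = A \<inter> {0<..}"
  proof -
    have "\<exists>n. x \<in> I n" if "x > 0" for x
    proof -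
      obtain n1 :: nat where n1: "x / \<gamma> < n1" using reals_Archimedean2 by blast
      obtain n2 :: nat where n2: "\<gamma> / x < n2" using reals_Archimedean2 by blast
      define p q where "p = \<gamma> * real n1" and "q = x * real n2"
      have pq: "x < p" "\<gamma> < q" using n1 n2 that \<gamma> by (auto simp: field_simps p_def q_def)
      have nn: "0 \<le> \<gamma> * real n2" "0 \<le> x * real n1" using that \<gamma> by auto
      have "\<gamma> \<le> x + (x * real n1 + q)" using pq nn that by linarith
      moreover have "x \<le> \<gamma> + (p + \<gamma> * real n2)" using pq nn \<gamma> by linarith
      ultimately have "\<gamma> \<le> x + (x * real n1 + x * real n2)" "x \<le> \<gamma> + (\<gamma> * real n1 + \<gamma> * real n2)"
        by (simp_all only: p_def q_def)
      then have "\<gamma> \<le> x * (real (n1 + n2) + 1)" "x \<le> \<gamma> * (real (n1 + n2) + 1)"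
        by (simp_all add: algebra_simps)
      then have "x \<in> I (n1 + n2)" by (simp add: I_def pos_divide_le_eq)
      then show ?thesis ..
    qed
    moreover have "x > 0" if "x \<in> I n" for x n
      using that \<gamma> by (auto simp: I_def intro: less_le_trans[rotated])
    ultimately show ?thesis by auto
  qed
  have inc: "incseq (\<lambda>n. A \<inter> I n)"
  proof (intro incseq_SucI)
    fix n
    have "\<gamma> / (real (Suc n) + 1) \<le> \<gamma> / (real n + 1)" "\<gamma> * (real n + 1) \<le> \<gamma> * (real (Suc n) + 1)"
      using \<gamma> by (auto intro!: divide_left_mono mult_left_mono)
    then show "A \<inter> I n \<subseteq> A \<inter> I (Suc n)" by (auto simp: I_def)
  qed
  have lim: "emeasure N (A \<inter> {0<..}) = (SUP n. emeasure N (A \<inter> I n))"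
    if "sets N = sets borel" for N :: "real measure"
    unfolding U[symmetric]
    by (rule SUP_emeasure_incseq[symmetric, OF _ inc]) (simp add: that image_subset_iff)
  have "emeasure ?N1 A = emeasure ?N1 (A \<inter> {0<..})"
    using \<gamma>
    by (subst (1 2) N1) (auto intro!: nn_integral_cong simp: indicator_def)
  also have "\<dots> = emeasure ?N2 (A \<inter> {0<..})" using lim[of ?N1] lim[of ?N2] eq by simp
  also have "\<dots> = emeasure ?N2 A"
    by (subst (1 2) emeasure_density) (auto intro!: nn_integral_cong simp: indicator_def)
  finally show "emeasure ?N1 A = emeasure ?N2 A" .
qed simp

text \<open>The assumption that \<open>F\<close> vanishes up to and including 0 also covers
  \<open>v = 0\<close>, where \<open>\<gamma> / v\<close> is 0 by convention.\<close>

lemma nn_integral_inversion: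
  fixes F :: "real \<Rightarrow> ennreal"
  assumes \<gamma>: "\<gamma> > 0" and [measurable]: "F \<in> borel_measurable borel" and F0: "\<And>x. x \<le> 0 \<Longrightarrow> F x = 0"
  shows "(\<integral>\<^sup>+x. F x \<partial>lborel) = (\<integral>\<^sup>+v. ennreal (\<gamma> / v\<^sup>2) * F (\<gamma> / v) \<partial>lborel)"
proof -
  have F0': "indicator {0<..} x * F x = F x" for x
    using F0[of x] by (cases "x > 0") (auto simp: indicator_def)
  have "(\<integral>\<^sup>+x. F x \<partial>lborel) = (\<integral>\<^sup>+x. F x \<partial>density lborel (indicator {0<..}))"
    by (subst nn_integral_density) (auto simp: F0')
  also have "\<dots> = (\<integral>\<^sup>+v. ennreal (\<gamma> / v\<^sup>2) * indicator {0<..} v * F (\<gamma> / v) \<partial>lborel)"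
    unfolding inversion_distr[OF \<gamma>, symmetric]
    by (subst nn_integral_distr, simp, simp, subst nn_integral_density) auto
  also have "\<dots> = (\<integral>\<^sup>+v. ennreal (\<gamma> / v\<^sup>2) * F (\<gamma> / v) \<partial>lborel)"
  proof (rule nn_integral_cong)
    fix v
    show "ennreal (\<gamma> / v\<^sup>2) * indicator {0<..} v * F (\<gamma> / v) = ennreal (\<gamma> / v\<^sup>2) * F (\<gamma> / v)"
      using F0[of "\<gamma> / v"] \<gamma> by (cases "v > 0") (auto simp: divide_nonneg_nonpos)
  qed
  finally show ?thesis .
qed

lemma integral_inversion:
  fixes f :: "real \<Rightarrow> complex"
  assumes \<gamma>: "\<gamma> > 0" and f: "integrable lborel f" and f0: "\<And>x. x \<le> 0 \<Longrightarrow> f x = 0"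
  shows "integrable lborel (\<lambda>v. of_real (\<gamma> / v\<^sup>2) * f (\<gamma> / v))"
    "(\<integral>v. of_real (\<gamma> / v\<^sup>2) * f (\<gamma> / v) \<partial>lborel) = (\<integral>x. f x \<partial>lborel)"
proof -
  let ?d = "\<lambda>v. (\<gamma> / v\<^sup>2) * indicator {0<..} v"
  have [measurable]: "f \<in> borel_measurable borel" using f by auto
  have N: "distr (density lborel (\<lambda>v. ennreal (?d v))) borel (\<lambda>v. \<gamma> / v) =
      density lborel (\<lambda>x. ennreal (indicator {0<..} x))"
  proof -
    have "(\<lambda>v. ennreal (?d v)) = (\<lambda>v. ennreal (\<gamma> / v\<^sup>2) * indicator {0<..} v)"
      by (auto simp: fun_eq_iff indicator_def)
    then show ?thesis using inversion_distr[OF \<gamma>] by (simp only: ennreal_indicator)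
  qed
  have f0': "indicator {0<..} x *\<^sub>R f x = f x" for x
    using f0[of x] by (cases "x > 0") (auto simp: indicator_def)
  have d: "?d v *\<^sub>R f (\<gamma> / v) = of_real (\<gamma> / v\<^sup>2) * f (\<gamma> / v)" for v
    using f0[of "\<gamma> / v"] \<gamma> by (cases "v > 0") (auto simp: divide_nonneg_nonpos scaleR_conv_of_real)
  have "integrable (density lborel (\<lambda>x. ennreal (indicator {0<..} x))) f"
    by (subst integrable_density) (use f in \<open>auto simp: f0'\<close>)
  then have "integrable (density lborel (\<lambda>v. ennreal (?d v))) (\<lambda>v. f (\<gamma> / v))"
    unfolding N[symmetric] by (subst (asm) integrable_distr_eq) auto
  then have "integrable lborel (\<lambda>v. ?d v *\<^sub>R f (\<gamma> / v))"
    using \<gamma> by (subst (asm) integrable_density) auto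
  then show "integrable lborel (\<lambda>v. of_real (\<gamma> / v\<^sup>2) * f (\<gamma> / v))"
    by (simp only: d)
  have "(\<integral>x. f x \<partial>lborel) = (\<integral>x. f x \<partial>density lborel (\<lambda>x. ennreal (indicator {0<..} x)))"
    by (subst integral_density) (auto simp: f0')
  also have "\<dots> = (\<integral>v. f (\<gamma> / v) \<partial>density lborel (\<lambda>v. ennreal (?d v)))"
    unfolding N[symmetric] by (subst integral_distr) auto
  also have "\<dots> = (\<integral>v. ?d v *\<^sub>R f (\<gamma> / v) \<partial>lborel)"
    using \<gamma> by (subst integral_density) auto
  also have "\<dots> = (\<integral>v. of_real (\<gamma> / v\<^sup>2) * f (\<gamma> / v) \<partial>lborel)"
    by (simp only: d)
  finally show "(\<integral>v. of_real (\<gamma> / v\<^sup>2) * f (\<gamma> / v) \<partial>lborel) = (\<integral>x. f x \<partial>lborel)" by simp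
qed

text \<open>The intervals \<open>[k, k + 1)\<close> partition \<open>[0, \<infinity>)\<close>, and
  each of them is translated to \<open>[0, 1)\<close>.\<close>

lemma nn_integral_unit_folding:
  fixes G :: "real \<Rightarrow> ennreal"
  assumes [measurable]: "G \<in> borel_measurable borel" and G0: "\<And>x. x < 0 \<Longrightarrow> G x = 0"
  shows "(\<integral>\<^sup>+v. G v \<partial>lborel) = (\<integral>\<^sup>+u. (\<Sum>k. G (u + real k)) * indicator {0..<1} u \<partial>lborel)"
proof -
  have split: "G v = (\<Sum>k. G v * indicator {real k..<real k + 1} v)" for v
  proof (cases "v < 0")
    case True
    then show ?thesis using G0 by simp
  next
    case False
    define n where "n = nat \<lfloor>v\<rfloor>"
    have n: "real n \<le> v" "v < real n + 1" using False by (auto simp: n_def)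
    have "(\<Sum>k. G v * indicator {real k..<real k + 1} v) = (\<Sum>k\<in>{n}. G v * indicator {real k..<real k + 1} v)"
    proof (rule suminf_finite)
      fix k assume "k \<notin> {n}"
      then have "k < n \<or> n < k" by auto
      then show "G v * indicator {real k..<real k + 1} v = 0"
        using n by (auto simp: indicator_def)
    qed simp
    then show ?thesis using n by simp
  qed
  have "(\<integral>\<^sup>+v. G v \<partial>lborel) = (\<Sum>k. \<integral>\<^sup>+v. G v * indicator {real k..<real k + 1} v \<partial>lborel)"
    by (subst split, rule nn_integral_suminf) measurable
  also have "\<dots> = (\<Sum>k. \<integral>\<^sup>+u. G (u + real k) * indicator {0..<1} u \<partial>lborel)"
  proof (rule arg_cong[where f = suminf], rule ext)
    fix k
    show "(\<integral>\<^sup>+v. G v * indicator {real k..<real k + 1} v \<partial>lborel) = (\<integral>\<^sup>+u. G (u + real k) * indicator {0..<1} u \<partial>lborel)"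
      by (subst nn_integral_real_affine[where c = 1 and t = "real k"])
        (auto intro!: nn_integral_cong simp: indicator_def add.commute)
  qed
  also have "\<dots> = (\<integral>\<^sup>+u. (\<Sum>k. G (u + real k) * indicator {0..<1} u) \<partial>lborel)"
    by (rule nn_integral_suminf[symmetric]) measurable
  finally show ?thesis by (simp only: ennreal_suminf_multc)
qed

lemma borel_measurable_frac [measurable]: "(frac :: real \<Rightarrow> real) \<in> borel_measurable borel"
  unfolding frac_def[abs_def] by measurable

lemma frac_add_nat: "0 \<le> u \<Longrightarrow> u < 1 \<Longrightarrow> frac (u + real k) = u"
  by (simp add: frac_unique_iff)

text \<open>The sum on the right is the transfer operator of \<open>x\<close> to
  \<open>\<gamma> / x mod 1\<close>: the inverse branches are \<open>\<gamma> / (u + k)\<close>,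
  with Jacobian \<open>\<gamma> / (u + k)\<^sup>2\<close>. It arises by inverting and then folding.
  The branch \<open>k = 0\<close> belongs to \<open>x > \<gamma>\<close>.\<close>

lemma nn_integral_gauss_folding:
  fixes F :: "real \<Rightarrow> ennreal"
  assumes \<gamma>: "\<gamma> > 0" and [measurable]: "F \<in> borel_measurable borel" "A \<in> sets borel"
    and F0: "\<And>x. x \<le> 0 \<Longrightarrow> F x = 0"
  shows "(\<integral>\<^sup>+x. F x * indicator A (frac (\<gamma> / x)) \<partial>lborel) =
    (\<integral>\<^sup>+u. (\<Sum>k. ennreal (\<gamma> / (u + real k)\<^sup>2) * F (\<gamma> / (u + real k))) * indicator (A \<inter> {0..<1}) u \<partial>lborel)"
proof -
  have "(\<integral>\<^sup>+x. F x * indicator A (frac (\<gamma> / x)) \<partial>lborel) =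
      (\<integral>\<^sup>+v. ennreal (\<gamma> / v\<^sup>2) * (F (\<gamma> / v) * indicator A (frac v)) \<partial>lborel)"
    using \<gamma> F0 by (subst nn_integral_inversion[OF \<gamma>]) (auto intro!: nn_integral_cong)
  also have "\<dots> = (\<integral>\<^sup>+u. (\<Sum>k. ennreal (\<gamma> / (u + real k)\<^sup>2) * (F (\<gamma> / (u + real k)) * indicator A (frac (u + real k)))) * indicator {0..<1} u \<partial>lborel)"
    using \<gamma> F0 by (intro nn_integral_unit_folding) (auto simp: divide_nonneg_neg)
  also have "\<dots> = (\<integral>\<^sup>+u. (\<Sum>k. ennreal (\<gamma> / (u + real k)\<^sup>2) * F (\<gamma> / (u + real k))) * indicator (A \<inter> {0..<1}) u \<partial>lborel)"
  proof (rule nn_integral_cong)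
    fix u :: real
    show "(\<Sum>k. ennreal (\<gamma> / (u + real k)\<^sup>2) * (F (\<gamma> / (u + real k)) * indicator A (frac (u + real k)))) * indicator {0..<1} u =
      (\<Sum>k. ennreal (\<gamma> / (u + real k)\<^sup>2) * F (\<gamma> / (u + real k))) * indicator (A \<inter> {0..<1}) u"
      by (cases "u \<in> {0..<1}"; cases "u \<in> A") (simp_all add: frac_add_nat)
  qed
  finally show ?thesis .
qed

section \<open>The subcritical case\<close>

text \<open>Functions on the line with value 0 off the positive axis stand for
  \<open>L^1(0, \<infinity>)\<close>; the two families of moments are those of
  \<open>annihilates_lattice_cross_iff\<close>.\<close>

definition annihilating :: "real \<Rightarrow> (real \<Rightarrow> complex) \<Rightarrow> bool" where
  "annihilating \<gamma> f \<longleftrightarrow> integrable lborel f \<and> (\<forall>s\<le>0. f s = 0) \<and>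
     (\<forall>j::int. (\<integral>s. f s * cis (2 * pi * j * s) \<partial>lborel) = 0) \<and>
     (\<forall>j::int. (\<integral>s. f s * cis (2 * pi * j * (\<gamma> / s)) \<partial>lborel) = 0)"

lemma cis_frac: "cis (2 * pi * of_int j * frac x) = cis (2 * pi * of_int j * x)"
proof -
  have "2 * pi * of_int j * frac x = 2 * pi * of_int j * x - 2 * pi * of_int (j * \<lfloor>x\<rfloor>)"
    by (simp add: frac_def algebra_simps)
  then show ?thesis by (simp add: cis_divide[symmetric] cis_multiple_2pi)
qed

lemma annihilating_vimage:
  assumes "annihilating \<gamma> f" "A \<in> sets borel"
  shows "(\<integral>s. indicator A (frac s) * f s \<partial>lborel) = 0"
    "(\<integral>s. indicator A (frac (\<gamma> / s)) * f s \<partial>lborel) = 0"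
  using assms unfolding annihilating_def
  by (auto intro!: integral_vimage_0 simp: cis_frac frac_ge_0 frac_lt_1)

text \<open>For \<open>\<gamma> = 1\<close> the preimage under the Gauss map. The bound
  \<open>x < \<gamma>\<close> drops the digit 0: points above \<open>\<gamma>\<close> are sent by
  \<open>\<gamma> / x\<close> itself into \<open>(0, 1)\<close> and are treated separately.\<close>

definition gauss_preimage :: "real \<Rightarrow> real set \<Rightarrow> real set" where
  "gauss_preimage \<gamma> A = {x. 0 < x \<and> x < \<gamma> \<and> frac (\<gamma> / x) \<in> A}"

lemma gauss_preimage_borel [measurable]:
  assumes "A \<in> sets borel"
  shows "gauss_preimage \<gamma> A \<in> sets borel"
proof -
  have "(\<lambda>x. frac (\<gamma> / x)) \<in> borel_measurable borel" by measurable
  from measurable_sets[OF this assms] have "(\<lambda>x. frac (\<gamma> / x)) -` A \<in> sets borel" by simp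
  moreover have "gauss_preimage \<gamma> A = {0<..<\<gamma>} \<inter> (\<lambda>x. frac (\<gamma> / x)) -` A"
    by (auto simp: gauss_preimage_def)
  ultimately show ?thesis by simp
qed

lemma gauss_preimage_mono: "A \<subseteq> B \<Longrightarrow> gauss_preimage \<gamma> A \<subseteq> gauss_preimage \<gamma> B"
  by (auto simp: gauss_preimage_def)

lemma gauss_preimage_subset: "\<gamma> \<le> 1 \<Longrightarrow> gauss_preimage \<gamma> A \<subseteq> {0<..<1}"
  by (auto simp: gauss_preimage_def)

text \<open>The two vanishing conditions are used alternately: the first moves mass from \<open>A\<close> to its
  integer translates, the second moves these to the second preimage of \<open>A\<close>.\<close>

lemma annihilating_gauss_invariant:
  assumes f: "annihilating \<gamma> f" and \<gamma>: "0 < \<gamma>" "\<gamma> \<le> 1"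
    and A: "A \<in> sets borel" "A \<subseteq> {0<..<1}"
  shows "(\<integral>s. indicator A s * f s \<partial>lborel) =
    (\<integral>s. indicator (gauss_preimage \<gamma> (gauss_preimage \<gamma> A)) s * f s \<partial>lborel)"
proof -
  let ?B = "gauss_preimage \<gamma> A" and ?T = "{s. 1 < s \<and> frac s \<in> A}"
  have f0: "f s = 0" if "s \<le> 0" for s using f that by (auto simp: annihilating_def)
  have [measurable]: "A \<in> sets borel" "?B \<in> sets borel" using A by auto
  have T[measurable]: "?T \<in> sets borel"
  proof -
    have "?T = {1<..} \<inter> frac -` A" by auto
    moreover have "frac -` A \<in> sets borel"
      using measurable_sets[OF borel_measurable_frac A(1)] by simp
    ultimately show ?thesis by simp
  qed
  have int: "integrable lborel (\<lambda>s. indicator C s * f s)" if "C \<in> sets borel" for C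
    using f that by (intro integrable_indicator_mult) (auto simp: annihilating_def)
  \<comment> \<open>\<open>A\<close> misses 0, so no integer has its fractional part in
    \<open>A\<close>; this removes the boundary point between the two pieces.\<close>
  have fracA: "frac s \<in> A \<Longrightarrow> s \<noteq> 1" for s using A(2) by auto
  have "0 = (\<integral>s. indicator A (frac s) * f s \<partial>lborel)"
    using annihilating_vimage(1)[OF f A(1)] by simp
  also have "\<dots> = (\<integral>s. indicator A s * f s + indicator ?T s * f s \<partial>lborel)"
  proof (rule Bochner_Integration.integral_cong[OF refl])
    fix s :: real
    consider "s \<le> 0" | "0 < s" "s < 1" | "s = 1" | "1 < s" by linarith
    then show "indicator A (frac s) * f s = indicator A s * f s + indicator ?T s * f s"
    proof cases
      case 2
      then have "frac s = s" by (simp add: frac_eq)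
      with 2 show ?thesis by (simp add: indicator_def)
    qed (use A(2) fracA[of s] f0 in \<open>auto simp: indicator_def\<close>)
  qed
  also have "\<dots> = (\<integral>s. indicator A s * f s \<partial>lborel) + (\<integral>s. indicator ?T s * f s \<partial>lborel)"
    by (intro Bochner_Integration.integral_add int A T)
  finally have 1: "(\<integral>s. indicator A s * f s \<partial>lborel) = - (\<integral>s. indicator ?T s * f s \<partial>lborel)"
    by (simp add: eq_neg_iff_add_eq_0)
  have "0 = (\<integral>s. indicator ?B (frac (\<gamma> / s)) * f s \<partial>lborel)"
    using annihilating_vimage(2)[OF f, of ?B] by simp
  also have "\<dots> = (\<integral>s. indicator (gauss_preimage \<gamma> ?B) s * f s + indicator ?T s * f s \<partial>lborel)"
  proof (rule Bochner_Integration.integral_cong[OF refl])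
    fix s :: real
    consider "s \<le> 0" | "0 < s" "s < \<gamma>" | "s = \<gamma>" | "\<gamma> < s" by linarith
    then show "indicator ?B (frac (\<gamma> / s)) * f s = indicator (gauss_preimage \<gamma> ?B) s * f s + indicator ?T s * f s"
    proof cases
      case 2
      then show ?thesis using \<gamma> by (simp add: gauss_preimage_def indicator_def)
    next
      case 3
      then show ?thesis using \<gamma> by (auto simp: gauss_preimage_def indicator_def)
    next
      case 4
      \<comment> \<open>Here \<open>u = \<gamma> / s\<close> is its own fractional part. It lies in
        \<open>?B\<close> iff \<open>u < \<gamma>\<close>, that is \<open>s > 1\<close>, and the
        fractional part of \<open>\<gamma> / u = s\<close> is in \<open>A\<close>; these are the
        conditions defining \<open>?T\<close>.\<close>
      then have s: "0 < \<gamma> / s" "\<gamma> / s < 1" using \<gamma> by auto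
      then have "frac (\<gamma> / s) = \<gamma> / s" by (simp add: frac_eq)
      moreover have "\<gamma> / s < \<gamma> \<longleftrightarrow> 1 < s" using \<gamma> 4 by (simp add: divide_less_eq)
      moreover have "\<gamma> / (\<gamma> / s) = s" using \<gamma> by simp
      ultimately have "frac (\<gamma> / s) \<in> ?B \<longleftrightarrow> s \<in> ?T" using s by (simp add: gauss_preimage_def)
      with 4 show ?thesis by (simp add: indicator_def gauss_preimage_def)
    qed (use f0 in auto)
  qed
  also have "\<dots> = (\<integral>s. indicator (gauss_preimage \<gamma> ?B) s * f s \<partial>lborel) + (\<integral>s. indicator ?T s * f s \<partial>lborel)"
    by (intro Bochner_Integration.integral_add int T) measurable
  finally have "(\<integral>s. indicator (gauss_preimage \<gamma> ?B) s * f s \<partial>lborel) = - (\<integral>s. indicator ?T s * f s \<partial>lborel)"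
    by (simp add: eq_neg_iff_add_eq_0)
  with 1 show ?thesis by simp
qed

lemma gauss_preimage_iterate:
  assumes \<gamma>: "\<gamma> \<le> 1" and A: "A \<in> sets borel" "A \<subseteq> {0<..<1}"
  shows "(gauss_preimage \<gamma> ^^ n) A \<in> sets borel" "(gauss_preimage \<gamma> ^^ n) A \<subseteq> {0<..<1}"
  by (induction n) (use A gauss_preimage_subset[OF \<gamma>] in auto)

lemma annihilating_gauss_invariant_iterate:
  assumes f: "annihilating \<gamma> f" and \<gamma>: "0 < \<gamma>" "\<gamma> \<le> 1"
    and A: "A \<in> sets borel" "A \<subseteq> {0<..<1}"
  shows "(\<integral>s. indicator A s * f s \<partial>lborel) = (\<integral>s. indicator ((gauss_preimage \<gamma> ^^ (2 * n)) A) s * f s \<partial>lborel)"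
proof (induction n)
  case (Suc n)
  have "(gauss_preimage \<gamma> ^^ (2 * Suc n)) A = gauss_preimage \<gamma> (gauss_preimage \<gamma> ((gauss_preimage \<gamma> ^^ (2 * n)) A))"
    by simp
  then show ?case
    using Suc annihilating_gauss_invariant[OF f \<gamma> gauss_preimage_iterate[OF \<gamma>(2) A]] by metis
qed simp

text \<open>The inversion maps \<open>(\<gamma>, \<infinity>)\<close> bijectively onto
  \<open>(0, 1)\<close>, without reduction mod 1. Once \<open>f\<close> vanishes on
  \<open>(0, 1)\<close>, the second vanishing condition therefore determines \<open>f\<close> on
  \<open>(\<gamma>, \<infinity>)\<close>; for \<open>\<gamma> \<le> 1\<close> the two sets cover the
  positive axis up to one point.\<close>

lemma annihilating_eq_0_if_eq_0_on_unit:
  assumes f: "annihilating \<gamma> f" and \<gamma>: "0 < \<gamma>" "\<gamma> \<le> 1"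
    and f01: "AE s in lborel. s \<in> {0<..<1} \<longrightarrow> f s = 0"
  shows "AE s in lborel. f s = 0"
proof -
  have f0: "f s = 0" if "s \<le> 0" for s using f that by (auto simp: annihilating_def)
  have fint: "integrable lborel f" using f by (simp add: annihilating_def)
  have "AE s in lborel. indicator {\<gamma><..} s * f s = 0"
  proof (rule AE_eq_0_if_set_integrals_0)
    show "integrable lborel (\<lambda>s. indicator {\<gamma><..} s * f s)"
      using fint by (rule integrable_indicator_mult) simp
    fix B :: "real set" assume "B \<in> sets lborel"
    then have B: "B \<in> sets borel" by simp
    define A where "A = {0<..<1} \<inter> (\<lambda>u. \<gamma> / u) -` B"
    have "(\<lambda>u. \<gamma> / u) \<in> borel_measurable borel" by measurable
    from measurable_sets[OF this B] have A: "A \<in> sets borel" by (simp add: A_def)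
    have [measurable]: "A \<in> sets borel" "B \<in> sets borel" "f \<in> borel_measurable borel" using A B fint by auto
    have "(\<integral>s. indicator B s * (indicator {\<gamma><..} s * f s) \<partial>lborel) = (\<integral>s. indicator A (frac (\<gamma> / s)) * f s \<partial>lborel)"
    proof (rule integral_cong_AE)
      have "AE s in lborel. s \<noteq> \<gamma>" by (rule AE_lborel_singleton)
      with f01 show "AE s in lborel. indicator B s * (indicator {\<gamma><..} s * f s) = indicator A (frac (\<gamma> / s)) * f s"
      proof eventually_elim
        case (elim s)
        consider "s \<le> 0" | "0 < s" "s < \<gamma>" | "\<gamma> < s" using elim by linarith
        then show ?case
        proof cases
          case 2
          then show ?thesis using elim \<gamma> by simp
        next
          case 3
          then have s: "0 < \<gamma> / s" "\<gamma> / s < 1" using \<gamma> by auto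
          then have "frac (\<gamma> / s) = \<gamma> / s" by (simp add: frac_eq)
          with 3 s \<gamma> show ?thesis by (simp add: A_def indicator_def)
        qed (use f0 in auto)
      qed
    qed measurable
    then show "(\<integral>s. indicator B s * (indicator {\<gamma><..} s * f s) \<partial>lborel) = 0"
      using annihilating_vimage(2)[OF f A] by simp
  qed
  moreover have "AE s in lborel. s \<noteq> (1::real)" by (rule AE_lborel_singleton)
  ultimately show ?thesis
    using f01
  proof eventually_elim
    case (elim s)
    consider "s \<le> 0" | "s \<in> {0<..<1}" | "\<gamma> < s" using elim \<gamma> by force
    then show ?case using elim f0 by cases auto
  qed
qed

text \<open>At \<open>x = \<gamma> / w\<close> the weight \<open>1 / (1 + x)\<close> combines with
  the Jacobian \<open>\<gamma> / w\<^sup>2\<close> to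
  \<open>\<gamma> / (w * (w + \<gamma>))\<close>, which telescopes over \<open>w = u + k\<close>
  when \<open>\<gamma> = 1\<close>.\<close>

lemma nn_integral_gauss_preimage:
  fixes v :: "real \<Rightarrow> ennreal"
  assumes \<gamma>: "0 < \<gamma>" "\<gamma> \<le> 1" and [measurable]: "v \<in> borel_measurable borel" "A \<in> sets borel"
    and A: "A \<subseteq> {0<..<1}"
  shows "(\<integral>\<^sup>+x. ennreal (1 / (1 + x)) * v x * indicator (gauss_preimage \<gamma> A) x \<partial>lborel) =
    (\<integral>\<^sup>+u. (\<Sum>k. ennreal (\<gamma> / ((u + real (Suc k)) * (u + real (Suc k) + \<gamma>))) * v (\<gamma> / (u + real (Suc k))))
       * indicator A u \<partial>lborel)"
proof -
  define F where "F x = ennreal (1 / (1 + x)) * v x * indicator {0<..<\<gamma>} x" for x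
  have [measurable]: "F \<in> borel_measurable borel" unfolding F_def by measurable
  have "(\<integral>\<^sup>+x. ennreal (1 / (1 + x)) * v x * indicator (gauss_preimage \<gamma> A) x \<partial>lborel) =
      (\<integral>\<^sup>+x. F x * indicator A (frac (\<gamma> / x)) \<partial>lborel)"
    by (rule nn_integral_cong) (auto simp: F_def gauss_preimage_def indicator_def)
  also have "\<dots> = (\<integral>\<^sup>+u. (\<Sum>k. ennreal (\<gamma> / (u + real k)\<^sup>2) * F (\<gamma> / (u + real k))) * indicator (A \<inter> {0..<1}) u \<partial>lborel)"
    by (rule nn_integral_gauss_folding[OF \<gamma>(1)]) (auto simp: F_def)
  also have "\<dots> = (\<integral>\<^sup>+u. (\<Sum>k. ennreal (\<gamma> / ((u + real (Suc k)) * (u + real (Suc k) + \<gamma>))) * v (\<gamma> / (u + real (Suc k))))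
       * indicator A u \<partial>lborel)"
  proof (rule nn_integral_cong)
    fix u :: real
    show "(\<Sum>k. ennreal (\<gamma> / (u + real k)\<^sup>2) * F (\<gamma> / (u + real k))) * indicator (A \<inter> {0..<1}) u =
      (\<Sum>k. ennreal (\<gamma> / ((u + real (Suc k)) * (u + real (Suc k) + \<gamma>))) * v (\<gamma> / (u + real (Suc k)))) * indicator A u"
    proof (cases "u \<in> A")
      case True
      then have u: "0 < u" "u < 1" using A by auto
      \<comment> \<open>The digit 0 would need a point \<open>\<gamma> / u \<ge> \<gamma>\<close>,
        outside the support of \<open>F\<close>; this shifts the summation index by one.\<close>
      have 0: "F (\<gamma> / (u + real 0)) = 0"
      proof -
        have "\<gamma> \<le> \<gamma> / u" using u \<gamma> by (simp add: le_divide_eq mult_left_le)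
        then show ?thesis by (simp add: F_def)
      qed
      have Suc: "ennreal (\<gamma> / (u + real (Suc k))\<^sup>2) * F (\<gamma> / (u + real (Suc k))) =
          ennreal (\<gamma> / ((u + real (Suc k)) * (u + real (Suc k) + \<gamma>))) * v (\<gamma> / (u + real (Suc k)))" for k
      proof -
        define w where "w = u + real (Suc k)"
        have w: "w > 1" using u by (simp add: w_def)
        have "\<gamma> / w \<in> {0<..<\<gamma>}" using w \<gamma> by (simp add: divide_less_eq)
        moreover have "\<gamma> / w\<^sup>2 * (1 / (1 + \<gamma> / w)) = \<gamma> / (w * (w + \<gamma>))"
          using w \<gamma> by (simp add: field_simps power2_eq_square)
        ultimately show ?thesis
          unfolding w_def[symmetric] F_def using w \<gamma>
          by (simp add: ennreal_mult[symmetric] mult.assoc[symmetric])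
      qed
      have "(\<lambda>k. ennreal (\<gamma> / (u + real (Suc k))\<^sup>2) * F (\<gamma> / (u + real (Suc k)))) sums
          (\<Sum>k. ennreal (\<gamma> / ((u + real (Suc k)) * (u + real (Suc k) + \<gamma>))) * v (\<gamma> / (u + real (Suc k))))"
        unfolding Suc by (rule summable_sums) simp
      from sums_Suc[OF this] show ?thesis
        using True u 0 by (simp add: sums_iff del: of_nat_Suc)
    qed simp
  qed
  finally show ?thesis .
qed

text \<open>Partial fractions. Read as a statement on transfer operators, this is the invariance of
  the Gauss density \<open>1 / (1 + u)\<close>.\<close>

lemma telescoping_gauss_weights:
  fixes u :: real
  assumes "u \<ge> 0"
  shows "(\<lambda>k. 1 / ((u + real (Suc k)) * (u + real (Suc k) + 1))) sums (1 / (u + 1))"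
proof -
  have "(\<lambda>k. 1 / (u + 1 + real k)) \<longlonglongrightarrow> 0" by real_asymp
  from telescope_sums'[OF this]
  have "(\<lambda>k. 1 / (u + 1 + real k) - 1 / (u + 1 + real (Suc k))) sums (1 / (u + 1))" by simp
  also have "(\<lambda>k. 1 / (u + 1 + real k) - 1 / (u + 1 + real (Suc k))) = (\<lambda>k. 1 / ((u + real (Suc k)) * (u + real (Suc k) + 1)))"
  proof
    fix k
    have "u + 1 + real k > 0" "u + 2 + real k > 0" using assms by auto
    then show "1 / (u + 1 + real k) - 1 / (u + 1 + real (Suc k)) = 1 / ((u + real (Suc k)) * (u + real (Suc k) + 1))"
      by (simp add: field_simps)
  qed
  finally show ?thesis .
qed

definition gauss_weight :: "real set \<Rightarrow> ennreal" where
  "gauss_weight A = (\<integral>\<^sup>+x. ennreal (1 / (1 + x)) * indicator A x \<partial>lborel)"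

text \<open>Compared with the critical weight \<open>1 / (w * (w + 1))\<close>, the weight
  \<open>\<gamma> / (w * (w + \<gamma>))\<close> carries the factor
  \<open>\<gamma> * (w + 1) / (w + \<gamma>)\<close>. It decreases in \<open>w\<close>, and its
  value at \<open>w = 1\<close> is the stated constant, which is below 1 for
  \<open>\<gamma> < 1\<close>.\<close>

lemma gauss_weight_preimage_le:
  assumes \<gamma>: "0 < \<gamma>" "\<gamma> \<le> 1" and A: "A \<in> sets borel" "A \<subseteq> {0<..<1}"
  shows "gauss_weight (gauss_preimage \<gamma> A) \<le> ennreal (2 * \<gamma> / (1 + \<gamma>)) * gauss_weight A"
proof -
  let ?\<rho> = "2 * \<gamma> / (1 + \<gamma>)"
  have [measurable]: "A \<in> sets borel" by fact
  have "gauss_weight (gauss_preimage \<gamma> A) =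
      (\<integral>\<^sup>+u. (\<Sum>k. ennreal (\<gamma> / ((u + real (Suc k)) * (u + real (Suc k) + \<gamma>)))) * indicator A u \<partial>lborel)"
    using nn_integral_gauss_preimage[OF \<gamma> _ A, of "\<lambda>_. 1"] by (simp add: gauss_weight_def)
  also have "\<dots> \<le> (\<integral>\<^sup>+u. ennreal ?\<rho> * (ennreal (1 / (1 + u)) * indicator A u) \<partial>lborel)"
  proof (rule nn_integral_mono)
    fix u :: real
    show "(\<Sum>k. ennreal (\<gamma> / ((u + real (Suc k)) * (u + real (Suc k) + \<gamma>)))) * indicator A u
        \<le> ennreal ?\<rho> * (ennreal (1 / (1 + u)) * indicator A u)"
    proof (cases "u \<in> A")
      case True
      then have u: "0 < u" "u < 1" using A by auto
      have "(\<Sum>k. ennreal (\<gamma> / ((u + real (Suc k)) * (u + real (Suc k) + \<gamma>)))) \<le>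
          (\<Sum>k. ennreal (?\<rho> * (1 / ((u + real (Suc k)) * (u + real (Suc k) + 1)))))"
      proof (intro suminf_le ennreal_leI)
        fix k
        define w where "w = u + real (Suc k)"
        have w: "w > 1" using u by (simp add: w_def)
        \<comment> \<open>The difference of the two sides is
          \<open>(1 - \<gamma>) * (w - 1)\<close>.\<close>
        have "(1 + \<gamma>) * (w + 1) \<le> 2 * (w + \<gamma>)"
          using mult_nonneg_nonneg[of "1 - \<gamma>" "w - 1"] w \<gamma> by (simp add: algebra_simps)
        then have "\<gamma> * ((1 + \<gamma>) * (w * (w + 1))) \<le> \<gamma> * (2 * (w * (w + \<gamma>)))"
          using \<gamma> w by (intro mult_left_mono) (auto simp: mult.left_commute[of _ w])
        then have "\<gamma> / (w * (w + \<gamma>)) \<le> ?\<rho> * (1 / (w * (w + 1)))"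
          using w \<gamma> by (simp add: divide_simps)
        then show "\<gamma> / ((u + real (Suc k)) * (u + real (Suc k) + \<gamma>)) \<le> ?\<rho> * (1 / ((u + real (Suc k)) * (u + real (Suc k) + 1)))"
          by (simp add: w_def)
      qed auto
      also have "\<dots> = ennreal (?\<rho> * (1 / (u + 1)))"
        using u \<gamma> by (intro suminf_ennreal_eq sums_mult telescoping_gauss_weights) auto
      also have "\<dots> = ennreal ?\<rho> * ennreal (1 / (1 + u))"
        using u \<gamma> by (subst ennreal_mult[symmetric]) (auto simp: add.commute)
      finally show ?thesis using True by simp
    qed simp
  qed
  also have "\<dots> = ennreal ?\<rho> * gauss_weight A"
    unfolding gauss_weight_def by (rule nn_integral_cmult) measurable
  finally show ?thesis .
qed

text \<open>For \<open>\<gamma> < 1\<close> the points of \<open>{\<gamma><..<1}\<close> lie in no \<^const>\<open>gauss_preimage\<close>, and almost every orbit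
  falls into this hole.\<close>

lemma annihilating_eq_0_subcritical:
  assumes f: "annihilating \<gamma> f" and \<gamma>: "0 < \<gamma>" "\<gamma> < 1"
  shows "AE s in lborel. f s = 0"
proof (rule annihilating_eq_0_if_eq_0_on_unit[OF f])
  \<comment> \<open>The points whose orbit survives \<open>n\<close> steps. Their Gauss weight
    decays geometrically, so almost no point survives forever.\<close>
  define S where "S n = (gauss_preimage \<gamma> ^^ n) {0<..<1}" for n
  have S_Suc: "S (Suc n) = gauss_preimage \<gamma> (S n)" for n by (simp add: S_def)
  have S_borel[measurable]: "S n \<in> sets borel" for n
    unfolding S_def by (rule gauss_preimage_iterate) (use \<gamma> in auto)
  have S_sub: "S n \<subseteq> {0<..<1}" for n
    unfolding S_def by (rule gauss_preimage_iterate) (use \<gamma> in auto)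
  have fint: "integrable lborel f" using f by (simp add: annihilating_def)
  have [measurable]: "f \<in> borel_measurable borel" using fint by auto
  let ?\<rho> = "2 * \<gamma> / (1 + \<gamma>)"
  have \<rho>: "0 \<le> ?\<rho>" "?\<rho> < 1" using \<gamma> by auto
  have W: "gauss_weight (S n) \<le> ennreal (?\<rho> ^ n)" for n
  proof (induction n)
    case 0
    have "gauss_weight (S 0) \<le> (\<integral>\<^sup>+x. indicator {0<..<1::real} x \<partial>lborel)"
      unfolding gauss_weight_def S_def
      by (intro nn_integral_mono) (auto simp: indicator_def ennreal_le_1)
    then show ?case by simp
  next
    case (Suc n)
    have "gauss_weight (S (Suc n)) \<le> ennreal ?\<rho> * gauss_weight (S n)"
      unfolding S_Suc using \<gamma> S_sub by (intro gauss_weight_preimage_le) auto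
    also have "\<dots> \<le> ennreal ?\<rho> * ennreal (?\<rho> ^ n)" by (intro mult_left_mono Suc) auto
    also have "\<dots> = ennreal (?\<rho> ^ Suc n)" using \<rho> by (simp only: ennreal_mult[symmetric] power_Suc zero_le_power)
    finally show ?case .
  qed
  define S' where "S' = (\<Inter>n. S n)"
  have [measurable]: "S' \<in> sets borel" unfolding S'_def by measurable
  have "gauss_weight S' \<le> ennreal (?\<rho> ^ n)" for n
  proof -
    have "gauss_weight S' \<le> gauss_weight (S n)"
      unfolding gauss_weight_def by (intro nn_integral_mono mult_left_mono) (auto simp: S'_def indicator_def)
    then show ?thesis by (rule order_trans[OF _ W])
  qed
  moreover have "(\<lambda>n. ennreal (?\<rho> ^ n)) \<longlonglongrightarrow> ennreal 0"
    using \<rho> by (intro tendsto_ennrealI LIMSEQ_realpow_zero)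
  ultimately have "gauss_weight S' \<le> 0"
    by (intro LIMSEQ_le_const[of _ _ "gauss_weight S'"]) auto
  then have "AE x in lborel. ennreal (1 / (1 + x)) * indicator S' x = 0"
    unfolding gauss_weight_def by (subst (asm) le_zero_eq, subst (asm) nn_integral_0_iff_AE) auto
  then have AE_S': "AE x in lborel. x \<notin> S'"
  proof eventually_elim
    case (elim x)
    show ?case
    proof
      assume "x \<in> S'"
      then have "x \<in> {0<..<1}" using S_sub[of 0] by (auto simp: S'_def)
      with elim \<open>x \<in> S'\<close> show False by (auto simp: ennreal_eq_0_iff)
    qed
  qed
  have dec: "S (Suc n) \<subseteq> S n" for n
  proof (induction n)
    case 0
    show ?case using S_sub[of "Suc 0"] by (simp add: S_def)
  next
    case (Suc n)
    show ?case using gauss_preimage_mono[OF Suc] by (simp only: S_Suc)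
  qed
  then have dec': "m \<le> n \<Longrightarrow> S n \<subseteq> S m" for m n by (rule lift_Suc_antimono_le[of S])
  have lim: "(\<lambda>n. \<integral>s. indicator (S n) s * norm (f s) \<partial>lborel) \<longlonglongrightarrow> (\<integral>s. 0 \<partial>(lborel :: real measure))"
  proof (rule integral_dominated_convergence)
    show "integrable lborel (\<lambda>s. norm (f s))" using fint by simp
    show "AE s in lborel. (\<lambda>n. indicator (S n) s * norm (f s)) \<longlonglongrightarrow> 0"
      using AE_S'
    proof eventually_elim
      case (elim s)
      then obtain N where "s \<notin> S N" by (auto simp: S'_def)
      then have "\<forall>n\<ge>N. indicator (S n) s * norm (f s) = 0" using dec'[of N] by (auto simp: indicator_def)
      then show ?case by (intro tendsto_eventually) (auto simp: eventually_sequentially)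
    qed
  qed (auto simp: indicator_def)
  \<comment> \<open>By invariance the integral over \<open>A\<close> equals the one over its
    preimage of order \<open>2 * n\<close>. That set lies in \<open>S (2 * n)\<close>, where the
    \<open>L^1\<close> mass of \<open>f\<close> tends to 0.\<close>
  have I0: "(\<integral>s. indicator A s * f s \<partial>lborel) = 0" if A: "A \<in> sets borel" "A \<subseteq> {0<..<1}" for A
  proof -
    define P where "P n = (gauss_preimage \<gamma> ^^ (2 * n)) A" for n
    have P_borel[measurable]: "P n \<in> sets borel" for n
      unfolding P_def using \<gamma> A by (intro gauss_preimage_iterate) auto
    have "(gauss_preimage \<gamma> ^^ n) A \<subseteq> S n" for n
    proof (induction n)
      case (Suc n)
      then show ?case by (auto simp: S_Suc dest: gauss_preimage_mono[THEN subsetD])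
    qed (use A in \<open>simp add: S_def\<close>)
    then have P_S: "P n \<subseteq> S (2 * n)" for n by (simp add: P_def)
    have eq: "(\<integral>s. indicator A s * f s \<partial>lborel) = (\<integral>s. indicator (P n) s * f s \<partial>lborel)" for n
      unfolding P_def using \<gamma> A by (intro annihilating_gauss_invariant_iterate[OF f]) auto
    have "norm (\<integral>s. indicator A s * f s \<partial>lborel) \<le> (\<integral>s. indicator (S (2 * n)) s * norm (f s) \<partial>lborel)" for n
    proof -
      have "norm (\<integral>s. indicator A s * f s \<partial>lborel) \<le> (\<integral>s. norm (indicator (P n) s * f s) \<partial>lborel)"
        unfolding eq[of n] by (rule integral_norm_bound)
      also have "\<dots> \<le> (\<integral>s. indicator (S (2 * n)) s * norm (f s) \<partial>lborel)"
      proof (rule integral_mono)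
        show "integrable lborel (\<lambda>s. norm (indicator (P n) s * f s))"
          using fint by (intro integrable_norm integrable_indicator_mult) auto
        show "integrable lborel (\<lambda>s. indicator (S (2 * n)) s * norm (f s))"
          using fint by (intro integrable_indicator_mult) auto
      qed (use P_S in \<open>auto simp: indicator_def\<close>)
      finally show ?thesis .
    qed
    moreover have "(\<lambda>n. \<integral>s. indicator (S (2 * n)) s * norm (f s) \<partial>lborel) \<longlonglongrightarrow> 0"
      using LIMSEQ_subseq_LIMSEQ[OF lim, of "\<lambda>n. 2 * n"] by (simp add: strict_mono_def comp_def)
    ultimately have "norm (\<integral>s. indicator A s * f s \<partial>lborel) \<le> 0"
      by (intro LIMSEQ_le_const) auto
    then show ?thesis by simp
  qed
  have "AE s in lborel. indicator {0<..<1} s * f s = 0"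
  proof (rule AE_eq_0_if_set_integrals_0)
    show "integrable lborel (\<lambda>s. indicator {0<..<1} s * f s)"
      using fint by (rule integrable_indicator_mult) simp
    fix A :: "real set" assume "A \<in> sets lborel"
    then have "(\<integral>s. indicator (A \<inter> {0<..<1}) s * f s \<partial>lborel) = 0" by (intro I0) auto
    then show "(\<integral>s. indicator A s * (indicator {0<..<1} s * f s) \<partial>lborel) = 0"
      by (simp add: indicator_inter_arith mult.assoc)
  qed
  then show "AE s in lborel. s \<in> {0<..<1} \<longrightarrow> f s = 0" by eventually_elim auto
qed (use \<gamma> in auto)

section \<open>The critical case: mixing of the Gauss map\<close>

text \<open>The transfer operator of the Gauss map conjugated by the Gauss density, so that the
  weights sum to 1 and constants are fixed. Clamping \<open>u\<close> to \<open>[0, 1]\<close> makes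
  monotonicity a statement on the whole line.\<close>

definition gauss_operator :: "(real \<Rightarrow> real) \<Rightarrow> real \<Rightarrow> real" where
  "gauss_operator v u = (let c = max 0 (min 1 u) in
     \<Sum>k. (1 + c) / ((c + real (Suc k)) * (c + real (Suc k) + 1)) * v (1 / (c + real (Suc k))))"

lemma gauss_weights_sums:
  assumes "c \<ge> 0"
  shows "(\<lambda>k. (1 + c) / ((c + real (Suc k)) * (c + real (Suc k) + 1))) sums 1"
  using sums_mult[OF telescoping_gauss_weights[OF assms], of "1 + c"] assms by (simp add: add.commute)

context
  fixes v :: "real \<Rightarrow> real"
  assumes v01: "\<And>x. 0 \<le> v x" "\<And>x. v x \<le> 1"
begin

lemma gauss_operator_summable:
  fixes c :: real
  assumes "c \<ge> 0"
  shows "summable (\<lambda>k. (1 + c) / ((c + real (Suc k)) * (c + real (Suc k) + 1)) * v (y k))"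
proof (rule summable_comparison_test'[OF sums_summable[OF gauss_weights_sums[OF assms]]])
  fix k
  define w where "w = (1 + c) / ((c + real (Suc k)) * (c + real (Suc k) + 1))"
  have "0 \<le> w" unfolding w_def using assms by (intro divide_nonneg_nonneg) auto
  then have "norm (w * v (y k)) \<le> w" using v01[of "y k"] by (simp add: mult_left_le)
  then show "norm ((1 + c) / ((c + real (Suc k)) * (c + real (Suc k) + 1)) * v (y k))
      \<le> (1 + c) / ((c + real (Suc k)) * (c + real (Suc k) + 1))"
    by (simp only: w_def)
qed

lemma gauss_operator_bounds: "0 \<le> gauss_operator v u" "gauss_operator v u \<le> 1"
proof -
  define c where "c = max 0 (min 1 u)"
  have c: "0 \<le> c" unfolding c_def by (rule max.cobounded1)
  have w: "0 \<le> (1 + c) / ((c + real (Suc k)) * (c + real (Suc k) + 1))" for k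
    using c by (intro divide_nonneg_nonneg) auto
  show "0 \<le> gauss_operator v u"
    unfolding gauss_operator_def Let_def c_def[symmetric]
    by (intro suminf_nonneg gauss_operator_summable mult_nonneg_nonneg c w v01)
  have "gauss_operator v u \<le> (\<Sum>k. (1 + c) / ((c + real (Suc k)) * (c + real (Suc k) + 1)))"
    unfolding gauss_operator_def Let_def c_def[symmetric]
    by (intro suminf_le gauss_operator_summable c sums_summable[OF gauss_weights_sums] mult_left_le v01 w)
  also have "\<dots> = 1" using gauss_weights_sums[OF c] by (simp add: sums_iff)
  finally show "gauss_operator v u \<le> 1" .
qed

text \<open>Transfers results on increasing functions to decreasing ones.\<close>

lemma gauss_operator_complement: "gauss_operator (\<lambda>x. 1 - v x) = (\<lambda>u. 1 - gauss_operator v u)"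
proof
  fix u :: real
  define c where "c = max 0 (min 1 u)"
  have c: "0 \<le> c" unfolding c_def by (rule max.cobounded1)
  show "gauss_operator (\<lambda>x. 1 - v x) u = 1 - gauss_operator v u"
    using suminf_diff[OF sums_summable[OF gauss_weights_sums[OF c]] gauss_operator_summable[OF c, of "\<lambda>k. 1 / (c + real (Suc k))"]]
      gauss_weights_sums[OF c]
    unfolding gauss_operator_def Let_def c_def[symmetric]
    by (simp add: right_diff_distrib sums_iff)
qed

text \<open>As \<open>u\<close> grows, the weights move to larger \<open>k\<close> (by Abel summation, since the tail sums of the
  weights are \<open>(1 + u) / (u + k)\<close>) and the points \<open>1 / (u + k)\<close> move to the left.\<close>

lemma gauss_operator_antimono:
  assumes v: "mono v"
  shows "antimono (gauss_operator v)"
proof (rule antimonoI)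
  fix x x' :: real assume "x \<le> x'"
  define c c' where "c = max 0 (min 1 x)" and "c' = max 0 (min 1 x')"
  have c: "0 \<le> c" "c \<le> c'" using \<open>x \<le> x'\<close> by (auto simp: c_def c'_def)
  define w where "w c k = (1 + c) / ((c + real (Suc k)) * (c + real (Suc k) + 1))" for c :: real and k
  define y where "y k = v (1 / (c + real (Suc k)))" for k
  have y0: "0 \<le> y k" for k by (simp add: y_def v01)
  have y_anti: "y (Suc k) \<le> y k" for k
    unfolding y_def using c by (intro monoD[OF v] divide_left_mono) auto
  define W where "W c k = (1 + c) / (c + real (Suc k))" for c :: real and k
  have w_W: "w c k = W c k - W c (Suc k)" if "c \<ge> 0" for c k
  proof -
    have "c + 1 + real k > 0" "c + 2 + real k > 0" using that by auto
    then show ?thesis by (simp add: w_def W_def field_simps)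
  qed
  \<comment> \<open>\<open>W c k = 1 - k / (c + k + 1)\<close> increases with
    \<open>c\<close>.\<close>
  have D_nonneg: "W c k \<le> W c' k" for k
  proof -
    have "(1 + c) * (c' + real (Suc k)) \<le> (1 + c') * (c + real (Suc k))"
      using mult_right_mono[OF c(2), of "real k"] by (simp add: algebra_simps)
    then show ?thesis using c by (simp add: W_def frac_le_eq divide_le_eq le_divide_eq)
  qed
  \<comment> \<open>Keeping the boundary term on the right closes the induction: replacing
    \<open>y (Suc N)\<close> by the larger \<open>y N\<close> in it costs nothing, as the tail
    difference is nonnegative.\<close>
  have abel: "(\<Sum>k<N. (w c' k - w c k) * y k) \<le> - ((W c' N - W c N) * y N)" for N
  proof (induction N)
    case 0
    have "W c 0 = 1" "W c' 0 = 1" using c by (simp_all add: W_def add.commute)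
    then show ?case by simp
  next
    case (Suc N)
    have "(W c' (Suc N) - W c (Suc N)) * y (Suc N) \<le> (W c' (Suc N) - W c (Suc N)) * y N"
      using D_nonneg[of "Suc N"] y_anti by (intro mult_left_mono) auto
    with Suc show ?case using c by (simp add: w_W algebra_simps)
  qed
  have "gauss_operator v x' = (\<Sum>k. w c' k * v (1 / (c' + real (Suc k))))"
    by (simp add: gauss_operator_def Let_def c'_def w_def)
  also have "\<dots> \<le> (\<Sum>k. w c' k * y k)"
    unfolding w_def y_def using c
    by (intro suminf_le gauss_operator_summable mult_left_mono monoD[OF v] divide_left_mono) auto
  also have "\<dots> \<le> (\<Sum>k. w c k * y k)"
  proof -
    have s: "summable (\<lambda>k. w c k * y k)" "summable (\<lambda>k. w c' k * y k)"
      unfolding w_def y_def by (rule gauss_operator_summable, use c in linarith)+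
    have "(\<Sum>k. w c' k * y k) - (\<Sum>k. w c k * y k) = (\<Sum>k. (w c' k - w c k) * y k)"
      using suminf_diff[OF s(2,1)] by (simp add: left_diff_distrib)
    also have "\<dots> \<le> 0"
    proof (rule suminf_le_const)
      show "summable (\<lambda>k. (w c' k - w c k) * y k)"
        using summable_diff[OF s(2,1)] by (simp add: left_diff_distrib)
      fix N
      have "0 \<le> (W c' N - W c N) * y N" using D_nonneg y0 by simp
      with abel[of N] show "(\<Sum>k<N. (w c' k - w c k) * y k) \<le> 0" by linarith
    qed
    finally show ?thesis by simp
  qed
  also have "\<dots> = gauss_operator v x"
    by (simp add: gauss_operator_def Let_def c_def w_def y_def)
  finally show "gauss_operator v x' \<le> gauss_operator v x" .
qed

text \<open>By antitonicity the extreme values are those at 0 and 1. With the common part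
  \<open>S\<close> they are \<open>v 1 / 2 + S\<close> and \<open>2 * S\<close>, so they differ by
  \<open>v 1 / 2 - S\<close>. The weights in \<open>S\<close> sum to \<open>1 / 2\<close>, hence
  \<open>S \<ge> v 0 / 2\<close>.\<close>

lemma gauss_operator_oscillation:
  assumes d: "\<And>x y. v x - v y \<le> d"  and v: "mono v"
  shows "gauss_operator v x - gauss_operator v y \<le> d / 2"
proof -
  define S where "S = (\<Sum>k. 1 / ((real (Suc k) + 1) * (real (Suc k) + 2)) * v (1 / (1 + real (Suc k))))"
  have w: "(\<lambda>k. 1 / ((real (Suc k) + 1) * (real (Suc k) + 2))) sums (1 / 2)"
    using telescoping_gauss_weights[of 1] by (simp add: add_ac)
  have sm: "summable (\<lambda>k. 1 / ((real (Suc k) + 1) * (real (Suc k) + 2)) * v (1 / (1 + real (Suc k))))"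
    using summable_mult[OF gauss_operator_summable[of 1 "\<lambda>k. 1 / (1 + real (Suc k))"], of "1 / 2"]
    by (simp add: add_ac)
  have P1: "gauss_operator v 1 = 2 * S"
    unfolding S_def by (subst suminf_mult[symmetric, OF sm]) (simp add: gauss_operator_def add_ac)
  have P0: "gauss_operator v 0 = v 1 / 2 + S"
  proof -
    have "summable (\<lambda>k. 1 / (real (Suc k) * (real (Suc k) + 1)) * v (1 / real (Suc k)))"
      using gauss_operator_summable[of 0 "\<lambda>k. 1 / real (Suc k)"] by simp
    from suminf_split_head[OF this] show ?thesis
      by (simp add: gauss_operator_def S_def add_ac)
  qed
  have "v 0 / 2 = (\<Sum>k. 1 / ((real (Suc k) + 1) * (real (Suc k) + 2)) * v 0)"
    using sums_mult2[OF w, of "v 0"] by (simp add: sums_iff)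
  also have "\<dots> \<le> S"
    unfolding S_def
    by (intro suminf_le sm mult_left_mono monoD[OF v] sums_summable[OF sums_mult2[OF w]]) auto
  finally have "gauss_operator v 0 - gauss_operator v 1 \<le> d / 2"
    using P0 P1 d[of 1 0] by simp
  moreover have "gauss_operator v x \<le> gauss_operator v 0"
  proof -
    have "gauss_operator v x = gauss_operator v (max 0 (min 1 x))" by (simp add: gauss_operator_def)
    also have "\<dots> \<le> gauss_operator v 0" by (intro antimonoD[OF gauss_operator_antimono[OF v]]) simp
    finally show ?thesis .
  qed
  moreover have "gauss_operator v 1 \<le> gauss_operator v y"
  proof -
    have "gauss_operator v 1 \<le> gauss_operator v (max 0 (min 1 y))"
      by (intro antimonoD[OF gauss_operator_antimono[OF v]]) simp
    also have "\<dots> = gauss_operator v y" by (simp add: gauss_operator_def)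
    finally show ?thesis .
  qed
  ultimately show ?thesis by linarith
qed

end

section \<open>Mixing for the Gauss measure\<close>

definition monotone_unit :: "real \<Rightarrow> (real \<Rightarrow> real) \<Rightarrow> bool" where
  "monotone_unit d v \<longleftrightarrow> (mono v \<or> antimono v) \<and> (\<forall>x. 0 \<le> v x \<and> v x \<le> 1) \<and> (\<forall>x y. v x - v y \<le> d)"

lemma monotone_unit_gauss_operator:
  assumes "monotone_unit d v"
  shows "monotone_unit (d / 2) (gauss_operator v)"
proof -
  have v01: "\<And>x. 0 \<le> v x" "\<And>x. v x \<le> 1" and d: "\<And>x y. v x - v y \<le> d"
    using assms by (auto simp: monotone_unit_def)
  note bounds = gauss_operator_bounds[of v, OF v01]
  show ?thesis
  proof (cases "mono v")
    case True
    then show ?thesis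
      using bounds gauss_operator_antimono[of v, OF v01] gauss_operator_oscillation[of v d, OF v01 d]
      by (auto simp: monotone_unit_def)
  next
    case False
    let ?v = "\<lambda>x. 1 - v x"
    from False assms have "mono ?v" by (auto simp: monotone_unit_def mono_def antimono_def)
    moreover have v01': "\<And>x. 0 \<le> ?v x" "\<And>x. ?v x \<le> 1" using v01 by auto
    moreover have "?v x - ?v y \<le> d" for x y using d[of y x] by simp
    ultimately have "antimono (gauss_operator ?v)" "\<And>x y. gauss_operator ?v x - gauss_operator ?v y \<le> d / 2"
      using gauss_operator_antimono[of ?v, OF v01'] gauss_operator_oscillation[of ?v d, OF v01'] by blast+
    then have "mono (gauss_operator v)" "gauss_operator v y - gauss_operator v x \<le> d / 2" for x y
      unfolding gauss_operator_complement[of v, OF v01] by (auto simp: mono_def antimono_def)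
    with bounds show ?thesis by (auto simp: monotone_unit_def)
  qed
qed

lemma monotone_unit_measurable:
  assumes "monotone_unit d v"
  shows "v \<in> borel_measurable borel"
proof (cases "mono v")
  case True
  then show ?thesis by (rule borel_measurable_mono)
next
  case False
  with assms have "mono (\<lambda>x. - v x)" by (auto simp: monotone_unit_def mono_def antimono_def)
  then have "(\<lambda>x. - v x) \<in> borel_measurable borel" by (rule borel_measurable_mono)
  then show ?thesis using borel_measurable_uminus_eq by blast
qed

text \<open>Not normalised; the total mass therefore appears as a factor in the mixing
  statements.\<close>

definition gauss_measure :: "real measure" where
  "gauss_measure = density lborel (\<lambda>x. ennreal (indicator {0<..<1} x * (1 / (1 + x))))"

lemma sets_gauss_measure [simp, measurable_cong]: "sets gauss_measure = sets borel"
  and space_gauss_measure [simp]: "space gauss_measure = UNIV"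
  by (simp_all add: gauss_measure_def)

lemma finite_measure_gauss_measure: "finite_measure gauss_measure"
proof (rule finite_measureI)
  have "emeasure gauss_measure (space gauss_measure) = (\<integral>\<^sup>+x. ennreal (indicator {0<..<1} x * (1 / (1 + x))) \<partial>lborel)"
    by (simp add: gauss_measure_def emeasure_density)
  also have "\<dots> \<le> (\<integral>\<^sup>+x. indicator {0<..<1::real} x \<partial>lborel)"
    by (intro nn_integral_mono) (auto simp: indicator_def ennreal_le_1)
  also have "\<dots> < \<infinity>" by simp
  finally show "emeasure gauss_measure (space gauss_measure) \<noteq> \<infinity>" by simp
qed

interpretation gauss: finite_measure gauss_measure
  by (rule finite_measure_gauss_measure)

lemma AE_gauss_measure: "AE x in gauss_measure. x \<in> {0<..<1}"
  unfolding gauss_measure_def by (subst AE_density) (auto simp: indicator_def)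

lemma nn_integral_gauss_measure:
  assumes [measurable]: "v \<in> borel_measurable borel" "A \<in> sets borel" and A: "A \<subseteq> {0<..<1}"
  shows "(\<integral>\<^sup>+x. ennreal (indicator A x * v x) \<partial>gauss_measure) = (\<integral>\<^sup>+x. ennreal (1 / (1 + x)) * ennreal (v x) * indicator A x \<partial>lborel)"
  unfolding gauss_measure_def
  by (subst nn_integral_density) (use A in \<open>auto intro!: nn_integral_cong simp: indicator_def\<close>)

lemma integrable_gauss_measure:
  fixes v :: "real \<Rightarrow> real"
  assumes "monotone_unit d v" "A \<in> sets borel"
  shows "integrable gauss_measure (\<lambda>x. indicator A x * v x)"
  by (rule gauss.integrable_const_bound[where B = 1])
    (use assms monotone_unit_measurable[OF assms(1)] in \<open>auto simp: monotone_unit_def indicator_def\<close>)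

text \<open>Duality of preimage and transfer operator. Folding gives the unnormalised weights, and
  the factor \<open>1 + u\<close> in \<open>gauss_operator\<close> is undone by the Gauss density in
  \<open>u\<close>.\<close>

lemma gauss_operator_transfer:
  assumes v: "monotone_unit d v" and A: "A \<in> sets borel" "A \<subseteq> {0<..<1}"
  shows "(\<integral>x. indicator (gauss_preimage 1 A) x * v x \<partial>gauss_measure) =
    (\<integral>x. indicator A x * gauss_operator v x \<partial>gauss_measure)"
proof -
  note v' = monotone_unit_gauss_operator[OF v]
  have v01: "\<And>x. 0 \<le> v x" "\<And>x. v x \<le> 1" using v by (auto simp: monotone_unit_def)
  have [measurable]: "v \<in> borel_measurable borel" "gauss_operator v \<in> borel_measurable borel" "A \<in> sets borel"
    using monotone_unit_measurable[OF v] monotone_unit_measurable[OF v'] A by auto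
  have "(\<integral>\<^sup>+x. ennreal (indicator (gauss_preimage 1 A) x * v x) \<partial>gauss_measure) =
      (\<integral>\<^sup>+u. (\<Sum>k. ennreal (1 / ((u + real (Suc k)) * (u + real (Suc k) + 1))) * ennreal (v (1 / (u + real (Suc k))))) * indicator A u \<partial>lborel)"
    by (subst nn_integral_gauss_measure, measurable)
      (use gauss_preimage_subset[of 1] nn_integral_gauss_preimage[of 1 "\<lambda>x. ennreal (v x)" A] A in simp_all)
  also have "\<dots> = (\<integral>\<^sup>+u. ennreal (1 / (1 + u)) * ennreal (gauss_operator v u) * indicator A u \<partial>lborel)"
  proof (rule nn_integral_cong)
    fix u :: real
    show "(\<Sum>k. ennreal (1 / ((u + real (Suc k)) * (u + real (Suc k) + 1))) * ennreal (v (1 / (u + real (Suc k))))) * indicator A u =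
      ennreal (1 / (1 + u)) * ennreal (gauss_operator v u) * indicator A u"
    proof (cases "u \<in> A")
      case True
      then have u: "0 < u" "u < 1" using A by auto
      have "(\<lambda>k. (1 + u) / ((u + real (Suc k)) * (u + real (Suc k) + 1)) * v (1 / (u + real (Suc k)))) sums gauss_operator v u"
        using gauss_operator_summable[of v u "\<lambda>k. 1 / (u + real (Suc k))", OF v01] u
        by (simp add: gauss_operator_def summable_sums)
      from sums_mult[OF this, of "1 / (1 + u)"]
      have "(\<lambda>k. 1 / ((u + real (Suc k)) * (u + real (Suc k) + 1)) * v (1 / (u + real (Suc k)))) sums (1 / (1 + u) * gauss_operator v u)"
        using u by (simp add: mult.assoc[symmetric] del: of_nat_Suc)
      then have "(\<Sum>k. ennreal (1 / ((u + real (Suc k)) * (u + real (Suc k) + 1)) * v (1 / (u + real (Suc k))))) =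
          ennreal (1 / (1 + u) * gauss_operator v u)"
        using u v01 by (intro suminf_ennreal_eq) (auto intro!: divide_nonneg_nonneg mult_nonneg_nonneg)
      then show ?thesis
        using True u v01 gauss_operator_bounds[of v u, OF v01]
        by (simp add: ennreal_mult'[symmetric] del: of_nat_Suc)
    qed simp
  qed
  also have "\<dots> = (\<integral>\<^sup>+x. ennreal (indicator A x * gauss_operator v x) \<partial>gauss_measure)"
    by (rule nn_integral_gauss_measure[symmetric]) (use A in auto)
  finally show ?thesis
    using v01 gauss_operator_bounds[of v, OF v01] by (subst (1 2) integral_eq_nn_integral) auto
qed

lemma gauss_operator_transfer_iterate:
  assumes v: "monotone_unit d v" and A: "A \<in> sets borel" "A \<subseteq> {0<..<1}"
  shows "(\<integral>x. indicator ((gauss_preimage 1 ^^ n) A) x * v x \<partial>gauss_measure) =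
      (\<integral>x. indicator A x * (gauss_operator ^^ n) v x \<partial>gauss_measure)"
    "monotone_unit (d / 2 ^ n) ((gauss_operator ^^ n) v)"
proof -
  have B: "(gauss_preimage 1 ^^ n) A \<in> sets borel" "(gauss_preimage 1 ^^ n) A \<subseteq> {0<..<1}" for n
    by (induction n) (use A gauss_preimage_subset[of 1] in auto)
  show "monotone_unit (d / 2 ^ n) ((gauss_operator ^^ n) v)"
  proof (induction n)
    case (Suc n)
    show ?case using monotone_unit_gauss_operator[OF Suc] by (simp add: mult.commute)
  qed (use v in simp)
  show "(\<integral>x. indicator ((gauss_preimage 1 ^^ n) A) x * v x \<partial>gauss_measure) =
      (\<integral>x. indicator A x * (gauss_operator ^^ n) v x \<partial>gauss_measure)"
    using v
  proof (induction n arbitrary: d v)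
    case (Suc n)
    have "(\<integral>x. indicator ((gauss_preimage 1 ^^ Suc n) A) x * v x \<partial>gauss_measure) =
        (\<integral>x. indicator ((gauss_preimage 1 ^^ n) A) x * gauss_operator v x \<partial>gauss_measure)"
      using gauss_operator_transfer[OF Suc.prems B] by simp
    also have "\<dots> = (\<integral>x. indicator A x * (gauss_operator ^^ n) (gauss_operator v) x \<partial>gauss_measure)"
      by (rule Suc.IH[OF monotone_unit_gauss_operator[OF Suc.prems]])
    finally show ?case by (simp add: funpow_swap1)
  qed simp
qed

lemma integrable_gauss_measure_indicator:
  "B \<in> sets borel \<Longrightarrow> integrable gauss_measure (indicator B :: real \<Rightarrow> real)"
  by (rule gauss.integrable_const_bound[where B = 1]) auto

text \<open>The case of the constant function 1, which \<open>gauss_operator\<close> fixes.\<close>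

lemma gauss_measure_preimage_iterate:
  assumes A: "A \<in> sets borel" "A \<subseteq> {0<..<1}"
  shows "measure gauss_measure ((gauss_preimage 1 ^^ n) A) = measure gauss_measure A"
proof -
  have "monotone_unit 0 (\<lambda>_. 1)" by (auto simp: monotone_unit_def mono_def)
  note * = gauss_operator_transfer_iterate(1)[OF this A, of n]
  have "gauss_operator (\<lambda>_. 1) = (\<lambda>_. 1)"
  proof
    fix u :: real
    have "0 \<le> max 0 (min 1 u)" by (rule max.cobounded1)
    from gauss_weights_sums[OF this] show "gauss_operator (\<lambda>_. 1) u = 1"
      by (simp add: gauss_operator_def Let_def sums_iff)
  qed
  then have "(gauss_operator ^^ n) (\<lambda>_. 1) = (\<lambda>_. 1)" by (induction n) auto
  with * show ?thesis
    using A gauss_preimage_iterate[OF order_refl A] by simp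
qed

text \<open>The \<open>n\<close>-th image \<open>w\<close> of \<open>v\<close> is within
  \<open>1 / 2 ^ n\<close> of a constant \<open>c\<close>. Hence the integral over the preimage of
  \<open>A\<close> is close to \<open>c\<close> times the mass of \<open>A\<close>, and the integral
  of \<open>v\<close> is close to \<open>c\<close> times the total mass; eliminating
  \<open>c\<close> gives the limit.\<close>

lemma gauss_mixing_monotone:
  assumes v: "monotone_unit 1 v" and A: "A \<in> sets borel" "A \<subseteq> {0<..<1}"
  shows "(\<lambda>n. measure gauss_measure UNIV * (\<integral>x. indicator ((gauss_preimage 1 ^^ n) A) x * v x \<partial>gauss_measure))
    \<longlonglongrightarrow> (\<integral>x. v x \<partial>gauss_measure) * measure gauss_measure A"
proof -
  let ?W = "measure gauss_measure UNIV" and ?a = "measure gauss_measure A" and ?m = "\<integral>x. v x \<partial>gauss_measure"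
  define I where "I n = (\<integral>x. indicator ((gauss_preimage 1 ^^ n) A) x * v x \<partial>gauss_measure)" for n
  have U: "{0<..<1::real} \<in> sets borel" "{0<..<1::real} \<subseteq> {0<..<1}" by auto
  have WU: "measure gauss_measure {0<..<1} = ?W"
    using AE_gauss_measure by (intro gauss.finite_measure_eq_AE) auto
  have close: "\<bar>?W * I n - ?m * ?a\<bar> \<le> 2 * ?W * ?a * (1 / 2) ^ n" for n
  proof -
    define w where "w = (gauss_operator ^^ n) v"
    define c where "c = w 0"
    have w: "monotone_unit (1 / 2 ^ n) w"
      unfolding w_def by (rule gauss_operator_transfer_iterate(2)[OF v U])
    have wc: "\<bar>w x - c\<bar> \<le> 1 / 2 ^ n" for x
      using w unfolding monotone_unit_def c_def abs_le_iff by (metis minus_diff_eq)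
    have est: "\<bar>(\<integral>x. indicator B x * w x \<partial>gauss_measure) - c * measure gauss_measure B\<bar> \<le> 1 / 2 ^ n * measure gauss_measure B"
      if B: "B \<in> sets borel" for B
    proof -
      have "(\<integral>x. indicator B x * w x \<partial>gauss_measure) - c * measure gauss_measure B =
          (\<integral>x. indicator B x * w x - c * indicator B x \<partial>gauss_measure)"
        using integrable_gauss_measure[OF w B] integrable_gauss_measure_indicator[OF B] B by simp
      also have "\<bar>\<dots>\<bar> \<le> (\<integral>x. \<bar>indicator B x * w x - c * indicator B x\<bar> \<partial>gauss_measure)"
        by (rule integral_abs_bound)
      also have "\<dots> \<le> (\<integral>x. 1 / 2 ^ n * indicator B x \<partial>gauss_measure)"
      proof (rule integral_mono)
        show "integrable gauss_measure (\<lambda>x. \<bar>indicator B x * w x - c * indicator B x\<bar>)"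
          "integrable gauss_measure (\<lambda>x. 1 / 2 ^ n * indicator B x :: real)"
          using integrable_gauss_measure[OF w B] integrable_gauss_measure_indicator[OF B]
          by (intro integrable_abs Bochner_Integration.integrable_diff integrable_mult_right; simp)+
      qed (use wc in \<open>auto simp: indicator_def\<close>)
      also have "\<dots> = 1 / 2 ^ n * measure gauss_measure B" using B by simp
      finally show ?thesis .
    qed
    have "I n = (\<integral>x. indicator A x * w x \<partial>gauss_measure)"
      unfolding I_def w_def by (rule gauss_operator_transfer_iterate(1)[OF v A])
    then have 1: "\<bar>I n - c * ?a\<bar> \<le> 1 / 2 ^ n * ?a" using est[OF A(1)] by simp
    \<comment> \<open>By invariance the preimages of \<open>(0, 1)\<close> have full measure, so the
      indicator may be inserted.\<close>
    have "?m = (\<integral>x. indicator ((gauss_preimage 1 ^^ n) {0<..<1}) x * v x \<partial>gauss_measure)"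
    proof (rule integral_cong_AE)
      let ?U = "(gauss_preimage 1 ^^ n) {0<..<1}"
      have Um[measurable]: "?U \<in> sets borel" by (rule gauss_preimage_iterate) auto
      show "v \<in> borel_measurable gauss_measure"
        using monotone_unit_measurable[OF v] by simp
      then show "(\<lambda>x. indicator ?U x * v x) \<in> borel_measurable gauss_measure" by measurable
      have "measure gauss_measure (UNIV - ?U) = 0"
        using gauss.finite_measure_Diff[of UNIV ?U] gauss_measure_preimage_iterate[OF U, of n] WU Um by simp
      then have "UNIV - ?U \<in> null_sets gauss_measure"
        using Um by (simp add: null_sets_def gauss.emeasure_eq_measure)
      then have "AE x in gauss_measure. x \<notin> UNIV - ?U" by (rule AE_not_in)
      then show "AE x in gauss_measure. v x = indicator ?U x * v x" by eventually_elim simp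
    qed
    also have "\<dots> = (\<integral>x. indicator {0<..<1} x * w x \<partial>gauss_measure)"
      unfolding w_def by (rule gauss_operator_transfer_iterate(1)[OF v U])
    finally have 2: "\<bar>?m - c * ?W\<bar> \<le> 1 / 2 ^ n * ?W" using est[OF U(1)] WU by simp
    \<comment> \<open>This combination cancels \<open>c\<close>, which depends on \<open>n\<close>
      and need not be known.\<close>
    have "\<bar>?W * I n - ?m * ?a\<bar> = \<bar>?W * (I n - c * ?a) - (?m - c * ?W) * ?a\<bar>" by (simp add: algebra_simps)
    also have "\<dots> \<le> ?W * \<bar>I n - c * ?a\<bar> + \<bar>?m - c * ?W\<bar> * ?a"
      by (rule order_trans[OF abs_triangle_ineq4]) (simp add: abs_mult)
    also have "\<dots> \<le> ?W * (1 / 2 ^ n * ?a) + (1 / 2 ^ n * ?W) * ?a"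
      by (intro add_mono mult_left_mono mult_right_mono 1 2) auto
    also have "\<dots> = 2 * ?W * ?a * (1 / 2) ^ n" by (simp add: power_one_over)
    finally show ?thesis .
  qed
  have "(\<lambda>n. 2 * ?W * ?a * (1 / 2) ^ n) \<longlonglongrightarrow> 2 * ?W * ?a * 0"
    by (intro tendsto_mult_left LIMSEQ_realpow_zero) auto
  then have "(\<lambda>n. 2 * ?W * ?a * (1 / 2) ^ n) \<longlonglongrightarrow> 0" by simp
  then have "(\<lambda>n. ?W * I n - ?m * ?a) \<longlonglongrightarrow> 0"
    by (rule Lim_null_comparison[rotated]) (use close in auto)
  then show ?thesis unfolding I_def by (simp add: LIM_zero_cancel)
qed

text \<open>Indicators of half-lines are monotone, and half-lines generate the Borel sets. For
  disjoint unions the limit in \<open>n\<close> and the sum are exchanged by Tannery's theorem, with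
  the masses of the \<open>E i\<close> as dominating series.\<close>

lemma gauss_mixing_sets:
  assumes E: "E \<in> sets borel" and A: "A \<in> sets borel" "A \<subseteq> {0<..<1}"
  shows "(\<lambda>n. measure gauss_measure UNIV * measure gauss_measure ((gauss_preimage 1 ^^ n) A \<inter> E))
    \<longlonglongrightarrow> measure gauss_measure E * measure gauss_measure A"
proof -
  let ?W = "measure gauss_measure UNIV" and ?a = "measure gauss_measure A"
  let ?A = "\<lambda>n. (gauss_preimage 1 ^^ n) A"
  have Am[measurable]: "?A n \<in> sets borel" for n by (rule gauss_preimage_iterate) (use A in auto)
  have "Int_stable (range (\<lambda>a::real. {..a}))" "range (\<lambda>a::real. {..a}) \<subseteq> Pow UNIV"
    by (auto simp: Int_stable_def)
  moreover have "E \<in> sigma_sets UNIV (range (\<lambda>a::real. {..a}))"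
    using E unfolding borel_eq_atMost by simp
  ultimately have "E \<in> sets borel \<and>
    (\<lambda>n. ?W * measure gauss_measure (?A n \<inter> E)) \<longlonglongrightarrow> measure gauss_measure E * ?a"
  proof (induction rule: sigma_sets_induct_disjoint)
    case (basic E)
    then obtain t where E: "E = {..t}" by auto
    have "monotone_unit 1 (indicator E)"
      by (auto simp: monotone_unit_def E antimono_def indicator_def)
    from gauss_mixing_monotone[OF this A]
    show ?case by (simp add: E indicator_inter_arith[symmetric])
  next
    case (compl E)
    have 1: "measure gauss_measure (?A n \<inter> (UNIV - E)) = ?a - measure gauss_measure (?A n \<inter> E)" for n
    proof -
      have "?A n \<inter> (UNIV - E) = ?A n - ?A n \<inter> E" by auto
      moreover have "?A n \<inter> E \<in> sets borel" using compl Am by auto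
      ultimately show ?thesis
        using gauss.finite_measure_Diff[of "?A n" "?A n \<inter> E"] Am
          gauss_measure_preimage_iterate[OF A, of n] by simp
    qed
    have 2: "measure gauss_measure (UNIV - E) = ?W - measure gauss_measure E"
      using compl by (intro gauss.finite_measure_Diff) auto
    have "(\<lambda>n. ?W * ?a - ?W * measure gauss_measure (?A n \<inter> E)) \<longlonglongrightarrow> ?W * ?a - measure gauss_measure E * ?a"
      using compl by (intro tendsto_diff tendsto_const) auto
    moreover have "UNIV - E \<in> sets borel" using compl by auto
    ultimately show ?case by (simp add: 1 2 right_diff_distrib left_diff_distrib)
  next
    case (union E)
    have E: "E i \<in> sets borel" for i using union by auto
    have sums: "(\<lambda>i. measure gauss_measure (B \<inter> E i)) sums measure gauss_measure (B \<inter> (\<Union>i. E i))"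
      if "B \<in> sets borel" for B
    proof -
      have "(\<lambda>i. measure gauss_measure (B \<inter> E i)) sums measure gauss_measure (\<Union>i. B \<inter> E i)"
        using that E union(1) by (intro gauss.finite_measure_UNION) (auto simp: disjoint_family_on_def)
      then show ?thesis by simp
    qed
    have sumE: "(\<lambda>i. measure gauss_measure (E i)) sums measure gauss_measure (\<Union>i. E i)"
      using sums[of UNIV] by simp
    have "((\<lambda>n. \<Sum>i. ?W * measure gauss_measure (?A n \<inter> E i)) \<longlongrightarrow> (\<Sum>i. measure gauss_measure (E i) * ?a)) sequentially"
    proof (rule tannerys_theorem[THEN conjunct2, THEN conjunct2])
      show "\<forall>\<^sub>F (i, n) in sequentially \<times>\<^sub>F sequentially.
          norm (?W * measure gauss_measure (?A n \<inter> E i)) \<le> ?W * measure gauss_measure (E i)"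
        using E by (intro always_eventually) (auto intro!: mult_left_mono gauss.finite_measure_mono)
      show "summable (\<lambda>i. ?W * measure gauss_measure (E i))"
        by (intro summable_mult sums_summable[OF sumE])
    qed (use union in auto)
    also have "(\<lambda>n. \<Sum>i. ?W * measure gauss_measure (?A n \<inter> E i)) = (\<lambda>n. ?W * measure gauss_measure (?A n \<inter> (\<Union>i. E i)))"
      using sums_mult[OF sums[OF Am], of ?W] by (simp add: sums_iff)
    also have "(\<Sum>i. measure gauss_measure (E i) * ?a) = measure gauss_measure (\<Union>i. E i) * ?a"
      using sums_mult2[OF sumE, of ?a] by (simp add: sums_iff)
    finally show ?case using E by auto
  qed simp
  then show ?thesis by simp
qed

text \<open>Extension from indicators to sums and to \<open>L^1\<close> limits by induction over
  integrable functions.\<close>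

lemma gauss_mixing:
  fixes k :: "real \<Rightarrow> complex"
  assumes k: "integrable gauss_measure k" and A: "A \<in> sets borel" "A \<subseteq> {0<..<1}"
  shows "(\<lambda>n. of_real (measure gauss_measure UNIV) * (\<integral>x. indicator ((gauss_preimage 1 ^^ n) A) x * k x \<partial>gauss_measure))
    \<longlonglongrightarrow> (\<integral>x. k x \<partial>gauss_measure) * of_real (measure gauss_measure A)"
  using k
proof induction
  case (base E c)
  let ?A = "\<lambda>n. (gauss_preimage 1 ^^ n) A"
  have Am[measurable]: "?A n \<in> sets borel" for n by (rule gauss_preimage_iterate) (use A in auto)
  have [measurable]: "E \<in> sets borel" using base by simp
  have e: "(\<integral>x. indicator B x *\<^sub>R c \<partial>gauss_measure) = of_real (measure gauss_measure B) * c" if "B \<in> sets borel" for B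
    using integrable_gauss_measure_indicator[OF that] that
    by (subst integral_scaleR_left) (auto simp: scaleR_conv_of_real)
  have e': "(\<integral>x. indicator (?A n) x * (indicator E x *\<^sub>R c) \<partial>gauss_measure) = of_real (measure gauss_measure (?A n \<inter> E)) * c" for n
  proof -
    have "(\<integral>x. indicator (?A n) x * (indicator E x *\<^sub>R c) \<partial>gauss_measure) = (\<integral>x. indicator (?A n \<inter> E) x *\<^sub>R c \<partial>gauss_measure)"
      by (rule Bochner_Integration.integral_cong) (auto simp: indicator_def)
    also have "\<dots> = of_real (measure gauss_measure (?A n \<inter> E)) * c"
      by (rule e) measurable
    finally show ?thesis .
  qed
  have "(\<lambda>n. of_real (measure gauss_measure UNIV * measure gauss_measure (?A n \<inter> E)) * c)
      \<longlonglongrightarrow> of_real (measure gauss_measure E * measure gauss_measure A) * c"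
    using base A by (intro tendsto_intros gauss_mixing_sets) auto
  then show ?case unfolding e' e[OF \<open>E \<in> sets borel\<close>] by (simp only: of_real_mult mult_ac)
next
  case (add f g)
  have m: "(gauss_preimage 1 ^^ n) A \<in> sets gauss_measure" for n
    using gauss_preimage_iterate[OF order_refl A] by simp
  have "integrable gauss_measure (\<lambda>x. indicator ((gauss_preimage 1 ^^ n) A) x * f x)"
    "integrable gauss_measure (\<lambda>x. indicator ((gauss_preimage 1 ^^ n) A) x * g x)" for n
    using add m by (auto intro!: integrable_indicator_mult)
  with tendsto_add[OF add.IH] add.hyps show ?case by (simp add: distrib_left distrib_right)
next
  case (lim k s)
  let ?A = "\<lambda>n. (gauss_preimage 1 ^^ n) A"
  define W a where "W = measure gauss_measure UNIV" and "a = measure gauss_measure A"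
  define D where "D n k = of_real W * (\<integral>x. indicator (?A n) x * k x \<partial>gauss_measure) - (\<integral>x. k x \<partial>gauss_measure) * of_real a"
    for n and k :: "real \<Rightarrow> complex"
  have m: "?A n \<in> sets gauss_measure" for n
    using gauss_preimage_iterate[OF order_refl A] by simp
  have aW: "0 \<le> a" "a \<le> W" unfolding a_def W_def using A by (auto intro!: gauss.finite_measure_mono)
  \<comment> \<open>The mixing error is Lipschitz in the \<open>L^1\<close> norm with a constant
    independent of \<open>n\<close>, so convergence passes to limits.\<close>
  have diff: "norm (D n k - D n (s i)) \<le> 2 * W * (\<integral>x. norm (k x - s i x) \<partial>gauss_measure)" for n i
  proof -
    have int: "integrable gauss_measure (\<lambda>x. k x - s i x)" using lim by simp
    have D: "D n k - D n (s i) = D n (\<lambda>x. k x - s i x)"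
      using lim m by (simp add: D_def right_diff_distrib left_diff_distrib integrable_indicator_mult)
    have 1: "norm (\<integral>x. indicator (?A n) x * (k x - s i x) \<partial>gauss_measure) \<le> (\<integral>x. norm (k x - s i x) \<partial>gauss_measure)"
    proof (rule order_trans[OF integral_norm_bound])
      show "(\<integral>x. norm (indicator (?A n) x * (k x - s i x)) \<partial>gauss_measure) \<le> (\<integral>x. norm (k x - s i x) \<partial>gauss_measure)"
        using int m by (intro integral_mono integrable_norm integrable_indicator_mult) (auto simp: indicator_def)
    qed
    have 2: "norm (\<integral>x. k x - s i x \<partial>gauss_measure) \<le> (\<integral>x. norm (k x - s i x) \<partial>gauss_measure)"
      by (rule integral_norm_bound)
    have "norm (D n (\<lambda>x. k x - s i x)) \<le> W * norm (\<integral>x. indicator (?A n) x * (k x - s i x) \<partial>gauss_measure)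
        + norm (\<integral>x. k x - s i x \<partial>gauss_measure) * a"
      unfolding D_def using aW by (intro order_trans[OF norm_triangle_ineq4]) (simp add: norm_mult)
    also have "\<dots> \<le> W * (\<integral>x. norm (k x - s i x) \<partial>gauss_measure) + (\<integral>x. norm (k x - s i x) \<partial>gauss_measure) * W"
      using aW 1 2 by (intro add_mono mult_left_mono mult_mono) auto
    finally show ?thesis unfolding D by (simp add: mult_ac)
  qed
  have "(\<lambda>i. \<integral>x. norm (k x - s i x) \<partial>gauss_measure) \<longlonglongrightarrow> (\<integral>x. 0 \<partial>gauss_measure)"
  proof (rule integral_dominated_convergence)
    show "integrable gauss_measure (\<lambda>x. 3 * norm (k x))" using lim by simp
    show "AE x in gauss_measure. norm (norm (k x - s i x)) \<le> 3 * norm (k x)" for i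
    proof (rule AE_I2)
      fix x
      have "norm (k x - s i x) \<le> norm (k x) + norm (s i x)" by (rule norm_triangle_ineq4)
      also have "norm (s i x) \<le> 2 * norm (k x)" by (rule lim) simp
      finally show "norm (norm (k x - s i x)) \<le> 3 * norm (k x)" by simp
    qed
    show "AE x in gauss_measure. (\<lambda>i. norm (k x - s i x)) \<longlonglongrightarrow> 0"
    proof (rule AE_I2)
      fix x assume "x \<in> space gauss_measure"
      then have "(\<lambda>i. k x - s i x) \<longlonglongrightarrow> k x - k x" by (intro tendsto_diff tendsto_const lim)
      then show "(\<lambda>i. norm (k x - s i x)) \<longlonglongrightarrow> 0" using tendsto_norm_zero by force
    qed
  qed (use lim in auto)
  then have "(\<lambda>i. 2 * W * (\<integral>x. norm (k x - s i x) \<partial>gauss_measure)) \<longlonglongrightarrow> 2 * W * 0"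
    by (intro tendsto_mult_left) simp
  then have small: "(\<lambda>i. 2 * W * (\<integral>x. norm (k x - s i x) \<partial>gauss_measure)) \<longlonglongrightarrow> 0" by simp
  have Ds: "(\<lambda>n. D n (s i)) \<longlonglongrightarrow> 0" for i
    using lim.IH[of i] unfolding D_def W_def a_def by (rule LIM_zero)
  have "(\<lambda>n. D n k) \<longlonglongrightarrow> 0"
  proof (rule LIMSEQ_I)
    fix e :: real assume "e > 0"
    then obtain i where "norm (2 * W * (\<integral>x. norm (k x - s i x) \<partial>gauss_measure)) < e / 2"
      using LIMSEQ_D[OF small, of "e / 2"] by auto
    then have i: "2 * W * (\<integral>x. norm (k x - s i x) \<partial>gauss_measure) < e / 2" by simp
    obtain N where N: "\<And>n. n \<ge> N \<Longrightarrow> norm (D n (s i)) < e / 2"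
      using LIMSEQ_D[OF Ds[of i], of "e / 2"] \<open>e > 0\<close> by auto
    have "norm (D n k - 0) < e" if "n \<ge> N" for n
      using norm_triangle_sub[of "D n k" "D n (s i)"] diff[of n i] i N[OF that] by simp
    then show "\<exists>N. \<forall>n\<ge>N. norm (D n k - 0) < e" by blast
  qed
  then show ?case unfolding D_def W_def a_def by (simp add: LIM_zero_cancel)
qed

lemma gauss_measure_UNIV_pos: "measure gauss_measure UNIV > 0"
proof -
  have "emeasure gauss_measure UNIV \<noteq> 0"
  proof
    assume "emeasure gauss_measure UNIV = 0"
    then have "AE x in gauss_measure. False"
      by (intro AE_I[of _ _ UNIV]) auto
    then have "AE x in lborel. x \<notin> {0<..<1::real}"
      unfolding gauss_measure_def by (subst (asm) AE_density) (auto simp: indicator_def elim!: eventually_mono split: if_splits)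
    then have "emeasure lborel {0<..<1::real} = 0"
      by (subst (asm) AE_iff_measurable[of "{0<..<1}"]) auto
    then show False by simp
  qed
  then show ?thesis by (simp add: gauss.emeasure_eq_measure zero_less_measure_iff)
qed

section \<open>Annihilating densities at the critical value\<close>

text \<open>Let \<open>k\<close> be the density of \<open>f\<close> with respect to the Gauss
  measure. Invariance makes the integrals of \<open>k\<close> over the even preimages of
  \<open>A\<close> constant, while mixing sends them to a multiple of the total integral of
  \<open>k\<close>, which is 0. So the integral over \<open>(0, 1)\<close> is the only free
  parameter, whence defect at most 1.\<close>

lemma annihilating_critical_eq_0:
  assumes f: "annihilating 1 f" and 0: "(\<integral>s. indicator {0<..<1} s * f s \<partial>lborel) = 0"
  shows "AE s in lborel. f s = 0"
proof (rule annihilating_eq_0_if_eq_0_on_unit[OF f])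
  have fint: "integrable lborel f" using f by (simp add: annihilating_def)
  have [measurable]: "f \<in> borel_measurable borel" using fint by auto
  define k where "k x = of_real (1 + x) * f x" for x
  have [measurable]: "k \<in> borel_measurable borel" unfolding k_def by measurable
  have hk: "(indicator {0<..<1} x * (1 / (1 + x))) *\<^sub>R (indicator B x * k x) = indicator B x * (indicator {0<..<1} x * f x)" for x B
  proof (cases "x \<in> {0<..<1}")
    case True
    then have "complex_of_real (1 + x) \<noteq> 0" by (simp add: of_real_eq_0_iff del: of_real_add)
    with True show ?thesis by (simp add: k_def scaleR_conv_of_real indicator_def)
  qed simp
  have kint: "integrable gauss_measure k"
    unfolding gauss_measure_def
    by (subst integrable_density)
      (use hk[of _ UNIV] integrable_indicator_mult[OF fint, of "{0<..<1}"] in \<open>auto simp: indicator_def\<close>)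
  have eq: "(\<integral>x. indicator B x * k x \<partial>gauss_measure) = (\<integral>s. indicator B s * (indicator {0<..<1} s * f s) \<partial>lborel)"
    if [measurable]: "B \<in> sets borel" for B
    unfolding gauss_measure_def
    by (subst integral_density) (simp_all only: hk, simp_all add: indicator_def)
  have k0: "(\<integral>x. k x \<partial>gauss_measure) = 0" using eq[of UNIV] 0 by simp
  have I0: "(\<integral>s. indicator A s * f s \<partial>lborel) = 0" if A: "A \<in> sets borel" "A \<subseteq> {0<..<1}" for A
  proof -
    let ?A = "\<lambda>n. (gauss_preimage 1 ^^ n) A"
    have A': "?A n \<in> sets borel" "?A n \<subseteq> {0<..<1}" for n
      using gauss_preimage_iterate[OF order_refl A] by auto
    have "(\<integral>s. indicator (?A (2 * n)) s * (indicator {0<..<1} s * f s) \<partial>lborel) = (\<integral>s. indicator (?A (2 * n)) s * f s \<partial>lborel)" for n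
      using A'(2)[of "2 * n"] by (intro Bochner_Integration.integral_cong) (auto simp: indicator_def)
    then have const: "(\<integral>x. indicator (?A (2 * n)) x * k x \<partial>gauss_measure) = (\<integral>s. indicator A s * f s \<partial>lborel)" for n
      using annihilating_gauss_invariant_iterate[OF f _ _ A, of n] eq[OF A'(1)] by simp
    have "(\<lambda>n. of_real (measure gauss_measure UNIV) * (\<integral>x. indicator (?A (2 * n)) x * k x \<partial>gauss_measure)) \<longlonglongrightarrow> 0"
      using LIMSEQ_subseq_LIMSEQ[OF gauss_mixing[OF kint A], of "\<lambda>n. 2 * n"] k0
      by (simp add: strict_mono_def comp_def)
    then have "of_real (measure gauss_measure UNIV) * (\<integral>s. indicator A s * f s \<partial>lborel) = 0"
      unfolding const by (simp add: LIMSEQ_const_iff)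
    then show ?thesis using gauss_measure_UNIV_pos by simp
  qed
  have "AE s in lborel. indicator {0<..<1} s * f s = 0"
  proof (rule AE_eq_0_if_set_integrals_0)
    show "integrable lborel (\<lambda>s. indicator {0<..<1} s * f s)"
      using fint by (rule integrable_indicator_mult) simp
    fix A :: "real set" assume "A \<in> sets lborel"
    then have "(\<integral>s. indicator (A \<inter> {0<..<1}) s * f s \<partial>lborel) = 0" by (intro I0) auto
    then show "(\<integral>s. indicator A s * (indicator {0<..<1} s * f s) \<partial>lborel) = 0"
      by (simp add: indicator_inter_arith mult.assoc)
  qed
  then show "AE s in lborel. s \<in> {0<..<1} \<longrightarrow> f s = 0" by eventually_elim auto
qed auto

text \<open>The change of variables by inversion exchanges the coordinates \<open>x\<close> and
  \<open>\<gamma> / x\<close>. If \<open>p\<close> has equal moments in both, the moments of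
  \<open>p\<close> and of its inverted copy agree in either coordinate and cancel in the
  difference.\<close>

lemma annihilating_inversion_diff:
  fixes p :: "real \<Rightarrow> complex"
  assumes \<gamma>: "\<gamma> > 0" and p: "integrable lborel p" and p0: "\<And>x. x \<le> 0 \<Longrightarrow> p x = 0"
    and eq: "\<And>j::int. (\<integral>x. p x * cis (2 * pi * j * x) \<partial>lborel) = (\<integral>x. p x * cis (2 * pi * j * (\<gamma> / x)) \<partial>lborel)"
  shows "annihilating \<gamma> (\<lambda>x. p x - of_real (\<gamma> / x\<^sup>2) * p (\<gamma> / x))"
proof -
  define q where "q x = of_real (\<gamma> / x\<^sup>2) * p (\<gamma> / x)" for x
  have q0: "q x = 0" if "x \<le> 0" for x
    using p0[of "\<gamma> / x"] that \<gamma> by (simp add: q_def divide_nonneg_nonpos)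
  have q: "integrable lborel q" unfolding q_def by (rule integral_inversion[OF \<gamma> p p0])
  have [measurable]: "cis \<in> borel_measurable borel"
    by (intro borel_measurable_continuous_onI continuous_intros)
  have int: "integrable lborel (\<lambda>x. r x * cis (X x))" if "integrable lborel r" "X \<in> borel_measurable borel"
    for r :: "real \<Rightarrow> complex" and X :: "real \<Rightarrow> real"
    using that(2) by (intro integrable_mult_bounded[OF that(1), where C = 1]) auto
  have 1: "(\<integral>v. q v * cis (2 * pi * j * v) \<partial>lborel) = (\<integral>x. p x * cis (2 * pi * j * (\<gamma> / x)) \<partial>lborel)" for j :: int
  proof -
    have "(\<integral>x. p x * cis (2 * pi * j * (\<gamma> / x)) \<partial>lborel) =
        (\<integral>v. of_real (\<gamma> / v\<^sup>2) * (p (\<gamma> / v) * cis (2 * pi * j * (\<gamma> / (\<gamma> / v)))) \<partial>lborel)"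
      by (rule integral_inversion(2)[symmetric, OF \<gamma>]) (use p0 in \<open>auto intro!: int p\<close>)
    also have "\<dots> = (\<integral>v. q v * cis (2 * pi * j * v) \<partial>lborel)"
      using \<gamma> by (intro Bochner_Integration.integral_cong) (auto simp: q_def mult_ac)
    finally show ?thesis by simp
  qed
  have 2: "(\<integral>v. q v * cis (2 * pi * j * (\<gamma> / v)) \<partial>lborel) = (\<integral>x. p x * cis (2 * pi * j * x) \<partial>lborel)" for j :: int
  proof -
    have "(\<integral>x. p x * cis (2 * pi * j * x) \<partial>lborel) =
        (\<integral>v. of_real (\<gamma> / v\<^sup>2) * (p (\<gamma> / v) * cis (2 * pi * j * (\<gamma> / v))) \<partial>lborel)"
      by (rule integral_inversion(2)[symmetric, OF \<gamma>]) (use p0 in \<open>auto intro!: int p\<close>)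
    then show ?thesis by (simp add: q_def mult_ac)
  qed
  have "(\<integral>x. (p x - q x) * cis (X x) \<partial>lborel) = (\<integral>x. p x * cis (X x) \<partial>lborel) - (\<integral>x. q x * cis (X x) \<partial>lborel)"
    if "X \<in> borel_measurable borel" for X :: "real \<Rightarrow> real"
    unfolding left_diff_distrib using int[OF p that] int[OF q that] by (rule Bochner_Integration.integral_diff)
  then have "annihilating \<gamma> (\<lambda>x. p x - q x)"
    unfolding annihilating_def using p q p0 q0 eq 1 2 by simp
  then show ?thesis unfolding q_def .
qed

text \<open>Invariance for the map without restriction of its domain. By invariance of
  \<open>(0, 1)\<close> under preimages, the points where \<open>gauss_preimage\<close> does not see
  this map form a null set.\<close>

lemma distr_gauss_measure: "distr gauss_measure borel (\<lambda>x. frac (1 / x)) = gauss_measure"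
proof (rule measure_eqI)
  interpret gauss: finite_measure gauss_measure by (rule finite_measure_gauss_measure)
  fix A assume "A \<in> sets (distr gauss_measure borel (\<lambda>x. frac (1 / x)))"
  then have A[measurable]: "A \<in> sets borel" by simp
  define A' where "A' = A \<inter> {0<..<1}"
  have A': "A' \<in> sets borel" "A' \<subseteq> {0<..<1}" by (auto simp: A'_def)
  define T where "T = (\<lambda>x::real. frac (1 / x)) -` A"
  have "(\<lambda>x::real. frac (1 / x)) \<in> borel_measurable borel" by measurable
  from measurable_sets[OF this A] have T: "T \<in> sets borel" by (simp add: T_def)
  have inv: "measure gauss_measure (gauss_preimage 1 B) = measure gauss_measure B"
    if "B \<in> sets borel" "B \<subseteq> {0<..<1}" for B
    using gauss_measure_preimage_iterate[OF that, of 1] by simp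
  have U: "AE x in gauss_measure. x \<in> gauss_preimage 1 {0<..<1}"
  proof -
    have m: "gauss_preimage 1 {0<..<1} \<in> sets gauss_measure" by (simp add: gauss_preimage_borel)
    have "measure gauss_measure {0<..<1} = measure gauss_measure UNIV"
      using AE_gauss_measure by (intro gauss.finite_measure_eq_AE) auto
    then have "measure gauss_measure (UNIV - gauss_preimage 1 {0<..<1}) = 0"
      using gauss.finite_measure_Diff[of UNIV "gauss_preimage 1 {0<..<1}"] inv[of "{0<..<1}"] m by simp
    then have "UNIV - gauss_preimage 1 {0<..<1} \<in> null_sets gauss_measure"
      using m by (auto simp: null_sets_def gauss.emeasure_eq_measure)
    from AE_not_in[OF this] show ?thesis by eventually_elim simp
  qed
  have "measure gauss_measure T = measure gauss_measure (gauss_preimage 1 A')"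
  proof (rule gauss.finite_measure_eq_AE)
    show "AE x in gauss_measure. (x \<in> T) = (x \<in> gauss_preimage 1 A')"
      using U by eventually_elim (auto simp: T_def A'_def gauss_preimage_def)
  qed (use T A' in \<open>auto simp: gauss_preimage_borel\<close>)
  also have "\<dots> = measure gauss_measure A'" by (rule inv[OF A'])
  also have "\<dots> = measure gauss_measure A"
  proof (rule gauss.finite_measure_eq_AE)
    show "AE x in gauss_measure. (x \<in> A') = (x \<in> A)"
      using AE_gauss_measure by eventually_elim (simp add: A'_def)
  qed (use A' in auto)
  finally show "emeasure (distr gauss_measure borel (\<lambda>x. frac (1 / x))) A = emeasure gauss_measure A"
    by (simp add: emeasure_distr gauss.emeasure_eq_measure T_def)
qed simp

text \<open>Invariance of the Gauss measure says that its density has equal moments in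
  \<open>x\<close> and \<open>1 / x\<close>. Explicitly, \<open>f\<close> is
  \<open>1 / (1 + x)\<close> on \<open>(0, 1)\<close> and \<open>- 1 / (x * (1 + x))\<close> on
  \<open>(1, \<infinity>)\<close>.\<close>

lemma ex_annihilating_critical: "\<exists>f. annihilating 1 f \<and> (\<integral>s. indicator {0<..<1} s * f s \<partial>lborel) \<noteq> 0"
proof -
  interpret gauss: finite_measure gauss_measure by (rule finite_measure_gauss_measure)
  define h :: "real \<Rightarrow> real" where "h x = indicator {0<..<1} x * (1 / (1 + x))" for x
  have h: "gauss_measure = density lborel (\<lambda>x. ennreal (h x))" "\<And>x. 0 \<le> h x"
    by (auto simp: gauss_measure_def h_def indicator_def)
  have [measurable]: "h \<in> borel_measurable borel" unfolding h_def by measurable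
  have [measurable]: "cis \<in> borel_measurable borel"
    by (intro borel_measurable_continuous_onI continuous_intros)
  define p where "p x = complex_of_real (h x)" for x
  have int_h: "(\<integral>x. p x * \<phi> x \<partial>lborel) = (\<integral>x. \<phi> x \<partial>gauss_measure)"
    if "\<phi> \<in> borel_measurable borel" for \<phi> :: "real \<Rightarrow> complex"
    unfolding h(1) using that h(2) by (subst integral_density) (auto simp: p_def scaleR_conv_of_real)
  have "integrable gauss_measure (\<lambda>_. 1 :: real)" by simp
  then have "integrable lborel h"
    unfolding h(1) using h(2) by (subst (asm) integrable_density) auto
  then have p: "integrable lborel p" unfolding p_def by simp
  define f where "f x = p x - of_real (1 / x\<^sup>2) * p (1 / x)" for x
  have "annihilating 1 f"
    unfolding f_def
  proof (rule annihilating_inversion_diff[OF _ p])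
    show "p x = 0" if "x \<le> 0" for x using that by (simp add: p_def h_def)
    fix j :: int
    have "(\<integral>x. p x * cis (2 * pi * j * x) \<partial>lborel) = (\<integral>x. cis (2 * pi * j * x) \<partial>gauss_measure)"
      by (rule int_h) measurable
    also have "\<dots> = (\<integral>x. cis (2 * pi * j * frac (1 / x)) \<partial>gauss_measure)"
      by (subst (1) distr_gauss_measure[symmetric], subst integral_distr) (auto cong: measurable_cong_sets)
    also have "\<dots> = (\<integral>x. cis (2 * pi * j * (1 / x)) \<partial>gauss_measure)"
      by (simp only: cis_frac)
    also have "\<dots> = (\<integral>x. p x * cis (2 * pi * j * (1 / x)) \<partial>lborel)"
      by (rule int_h[symmetric]) measurable
    finally show "(\<integral>x. p x * cis (2 * pi * j * x) \<partial>lborel) = (\<integral>x. p x * cis (2 * pi * j * (1 / x)) \<partial>lborel)" .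
  qed simp
  \<comment> \<open>On \<open>(0, 1)\<close> the inverted copy of \<open>p\<close> vanishes because
    \<open>1 / x > 1\<close>.\<close>
  moreover have "(\<integral>s. indicator {0<..<1} s * f s \<partial>lborel) = (\<integral>x. p x * 1 \<partial>lborel)"
    by (rule Bochner_Integration.integral_cong)
      (auto simp: f_def p_def h_def indicator_def divide_less_eq)
  moreover have "\<dots> = of_real (measure gauss_measure UNIV)"
    by (subst int_h) (simp_all add: scaleR_conv_of_real)
  ultimately show ?thesis using gauss_measure_UNIV_pos by (intro exI[of _ f]) simp
qed

section \<open>The supercritical case: a random digit chain\<close>

definition digit_prob :: "real \<Rightarrow> real" where
  "digit_prob s = (1 - s)\<^sup>2"

text \<open>The Markov operator of the chain on functions of period 1, for which the reduction mod 1
  can be omitted. At \<open>s = 0\<close> the conventional value \<open>\<gamma> / 0 = 0\<close>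
  gets weight 0.\<close>

definition digit_operator :: "real \<Rightarrow> (real \<Rightarrow> real) \<Rightarrow> real \<Rightarrow> real" where
  "digit_operator \<gamma> \<phi> s = (1 - digit_prob s) * \<phi> (\<gamma> / s) + digit_prob s * \<phi> (\<gamma> / (1 + s))"

abbreviation unit_uniform :: "real measure" where
  "unit_uniform \<equiv> density lborel (\<lambda>x. ennreal (indicator {0..<1} x))"

definition digit_step :: "real \<Rightarrow> real \<times> real \<Rightarrow> real" where
  "digit_step \<gamma> = (\<lambda>(s, r). frac (\<gamma> / (if r < digit_prob s then 1 + s else s)))"

text \<open>Laws of the chain started from the uniform distribution; the second factor supplies the
  random number that decides between the two branches.\<close>

primrec digit_chain :: "real \<Rightarrow> nat \<Rightarrow> real measure" where
  "digit_chain \<gamma> 0 = unit_uniform"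
| "digit_chain \<gamma> (Suc n) = distr (digit_chain \<gamma> n \<Otimes>\<^sub>M unit_uniform) borel (digit_step \<gamma>)"

lemma prob_space_unit_uniform: "prob_space unit_uniform"
  by (rule prob_spaceI) (simp add: emeasure_density ennreal_indicator)

lemma digit_prob_bounds: "0 \<le> s \<Longrightarrow> s \<le> 1 \<Longrightarrow> 0 \<le> digit_prob s \<and> digit_prob s \<le> 1"
  by (auto simp: digit_prob_def power_le_one)

lemma borel_measurable_digit_prob [measurable]: "digit_prob \<in> borel_measurable borel"
  unfolding digit_prob_def[abs_def] by measurable

lemma borel_measurable_digit_operator [measurable]:
  assumes [measurable]: "\<phi> \<in> borel_measurable borel"
  shows "digit_operator \<gamma> \<phi> \<in> borel_measurable borel"
  unfolding digit_operator_def[abs_def] by measurable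

lemma sets_digit_chain [simp, measurable_cong]: "sets (digit_chain \<gamma> n) = sets borel"
  by (cases n) auto

lemma space_digit_chain [simp]: "space (digit_chain \<gamma> n) = UNIV"
  using sets_eq_imp_space_eq[OF sets_digit_chain] by simp

lemma borel_measurable_digit_step [measurable]:
  "digit_step \<gamma> \<in> borel_measurable (borel \<Otimes>\<^sub>M borel)"
  unfolding digit_step_def case_prod_beta' by measurable

lemma measurable_digit_step [measurable]:
  "digit_step \<gamma> \<in> borel_measurable (digit_chain \<gamma> n \<Otimes>\<^sub>M unit_uniform)"
  by (subst measurable_cong_sets[OF sets_pair_measure_cong[of _ borel _ borel] refl]) auto

lemma prob_space_digit_chain: "prob_space (digit_chain \<gamma> n)"
proof (induction n)
  case 0
  show ?case by (simp add: prob_space_unit_uniform)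
next
  case (Suc n)
  interpret pair_prob_space "digit_chain \<gamma> n" unit_uniform
    using Suc prob_space_unit_uniform by (simp add: pair_prob_space_def pair_sigma_finite_def prob_space_imp_sigma_finite)
  show ?case unfolding digit_chain.simps by (rule prob_space_distr) measurable
qed

lemma AE_digit_chain: "AE s in digit_chain \<gamma> n. s \<in> {0..<1}"
proof (cases n)
  case 0
  show ?thesis unfolding 0 digit_chain.simps by (subst AE_density) (auto simp: indicator_def)
next
  case (Suc m)
  have "digit_step \<gamma> z \<in> {0..<1}" for z
    by (cases z) (simp add: digit_step_def frac_lt_1)
  then show ?thesis unfolding Suc digit_chain.simps by (subst AE_distr_iff) auto
qed

lemma integrable_digit_chain:
  fixes \<phi> :: "real \<Rightarrow> real"
  assumes "\<phi> \<in> borel_measurable borel" "\<And>x. x \<in> {0..<1} \<Longrightarrow> \<bar>\<phi> x\<bar> \<le> B"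
  shows "integrable (digit_chain \<gamma> n) \<phi>"
proof -
  interpret prob_space "digit_chain \<gamma> n" by (rule prob_space_digit_chain)
  show ?thesis
  proof (rule integrable_const_bound[where B = B])
    show "AE x in digit_chain \<gamma> n. norm (\<phi> x) \<le> B"
      using AE_digit_chain by eventually_elim (simp add: assms(2))
  qed (use assms in simp)
qed

lemma digit_operator_bounded:
  assumes "\<And>x. \<bar>\<phi> x\<bar> \<le> B" "0 \<le> s" "s \<le> 1"
  shows "\<bar>digit_operator \<gamma> \<phi> s\<bar> \<le> B"
proof -
  have b: "0 \<le> digit_prob s" "0 \<le> 1 - digit_prob s" using digit_prob_bounds[OF assms(2,3)] by auto
  have "\<bar>digit_operator \<gamma> \<phi> s\<bar> \<le> (1 - digit_prob s) * \<bar>\<phi> (\<gamma> / s)\<bar> + digit_prob s * \<bar>\<phi> (\<gamma> / (1 + s))\<bar>"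
    unfolding digit_operator_def using b by (intro order_trans[OF abs_triangle_ineq]) (simp add: abs_mult)
  also have "\<dots> \<le> (1 - digit_prob s) * B + digit_prob s * B"
    using b assms(1) by (intro add_mono mult_left_mono) auto
  finally show ?thesis by (simp add: algebra_simps)
qed

lemma integral_digit_chain_Suc:
  fixes \<phi> :: "real \<Rightarrow> real"
  assumes [measurable]: "\<phi> \<in> borel_measurable borel" and B: "\<And>x. \<bar>\<phi> x\<bar> \<le> B" and per: "\<And>x. \<phi> (frac x) = \<phi> x"
  shows "(\<integral>x. \<phi> x \<partial>digit_chain \<gamma> (Suc n)) = (\<integral>s. digit_operator \<gamma> \<phi> s \<partial>digit_chain \<gamma> n)"
proof -
  interpret U: prob_space unit_uniform by (rule prob_space_unit_uniform)
  interpret P: pair_prob_space "digit_chain \<gamma> n" unit_uniform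
    using prob_space_digit_chain prob_space_unit_uniform
    by (simp add: pair_prob_space_def pair_sigma_finite_def prob_space_imp_sigma_finite)
  have int: "integrable (digit_chain \<gamma> n \<Otimes>\<^sub>M unit_uniform) (\<lambda>z. \<phi> (digit_step \<gamma> z))"
    by (rule P.integrable_const_bound[where B = B]) (use B in auto)
  have "(\<integral>x. \<phi> x \<partial>digit_chain \<gamma> (Suc n)) = (\<integral>z. \<phi> (digit_step \<gamma> z) \<partial>(digit_chain \<gamma> n \<Otimes>\<^sub>M unit_uniform))"
    unfolding digit_chain.simps by (rule integral_distr) auto
  also have "\<dots> = (\<integral>s. (\<integral>r. \<phi> (digit_step \<gamma> (s, r)) \<partial>unit_uniform) \<partial>digit_chain \<gamma> n)"
    by (rule P.integral_fst'[symmetric, OF int])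
  also have "\<dots> = (\<integral>s. digit_operator \<gamma> \<phi> s \<partial>digit_chain \<gamma> n)"
  proof (rule integral_cong_AE)
    show "AE s in digit_chain \<gamma> n. (\<integral>r. \<phi> (digit_step \<gamma> (s, r)) \<partial>unit_uniform) = digit_operator \<gamma> \<phi> s"
      using AE_digit_chain
    proof eventually_elim
      case (elim s)
      define b where "b = digit_prob s"
      have b: "0 \<le> b" "b \<le> 1" using digit_prob_bounds[of s] elim by (auto simp: b_def)
      have mb: "measure unit_uniform {..<b} = b"
      proof -
        have "emeasure unit_uniform {..<b} = (\<integral>\<^sup>+x. ennreal (indicator {0..<1} x) * indicator {..<b} x \<partial>lborel)"
          by (subst emeasure_density) auto
        also have "\<dots> = (\<integral>\<^sup>+x. indicator {0..<b} x \<partial>lborel)"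
          by (rule nn_integral_cong) (use b in \<open>auto simp: indicator_def\<close>)
        also have "\<dots> = ennreal b" using b by simp
        finally show ?thesis using b by (simp add: measure_def)
      qed
      \<comment> \<open>As a function of \<open>r\<close> the integrand takes two values, separated
        at \<open>r = b\<close>.\<close>
      have "(\<integral>r. \<phi> (digit_step \<gamma> (s, r)) \<partial>unit_uniform) =
          (\<integral>r. \<phi> (\<gamma> / s) + (\<phi> (\<gamma> / (1 + s)) - \<phi> (\<gamma> / s)) * indicator {..<b} r \<partial>unit_uniform)"
        by (rule Bochner_Integration.integral_cong)
          (auto simp: digit_step_def b_def[symmetric] per indicator_def)
      also have "\<dots> = \<phi> (\<gamma> / s) + (\<phi> (\<gamma> / (1 + s)) - \<phi> (\<gamma> / s)) * measure unit_uniform {..<b}"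
      proof -
        have "integrable unit_uniform (indicator {..<b} :: real \<Rightarrow> real)"
          by (rule U.integrable_const_bound[where B = 1]) auto
        then show ?thesis using U.prob_space by simp
      qed
      also have "\<dots> = digit_operator \<gamma> \<phi> s"
        unfolding mb by (simp add: digit_operator_def b_def algebra_simps)
      finally show ?case .
    qed
    have "(\<lambda>z. \<phi> (digit_step \<gamma> z)) \<in> borel_measurable (digit_chain \<gamma> n \<Otimes>\<^sub>M unit_uniform)" by measurable
    from U.borel_measurable_lebesgue_integral[of "\<lambda>s r. \<phi> (digit_step \<gamma> (s, r))" "digit_chain \<gamma> n"] this
    show "(\<lambda>s. \<integral>r. \<phi> (digit_step \<gamma> (s, r)) \<partial>unit_uniform) \<in> borel_measurable (digit_chain \<gamma> n)"
      by (simp add: case_prod_beta')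
  qed measurable
  finally show ?thesis .
qed

section \<open>Lasota-Yorke estimate in dual form\<close>

text \<open>If an integer lies between \<open>x\<close> and \<open>y\<close>, the path is led
  through it, where the values \<open>f 1\<close> and \<open>f 0\<close> coincide.\<close>

lemma lipschitz_frac:
  fixes f :: "real \<Rightarrow> real"
  assumes L: "\<And>x y. 0 \<le> x \<Longrightarrow> x \<le> y \<Longrightarrow> y \<le> 1 \<Longrightarrow> \<bar>f x - f y\<bar> \<le> L * (y - x)" and f01: "f 0 = f 1"
  shows "\<bar>f (frac x) - f (frac y)\<bar> \<le> L * \<bar>x - y\<bar>"
proof -
  have L0: "0 \<le> L" using L[of 0 1] f01 by simp
  have *: "\<bar>f (frac x) - f (frac y)\<bar> \<le> L * \<bar>x - y\<bar>" if "x \<le> y" for x y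
  proof (cases "\<lfloor>x\<rfloor> = \<lfloor>y\<rfloor>")
    case True
    then have "frac y - frac x = y - x" by (simp add: frac_def)
    then show ?thesis using L[of "frac x" "frac y"] that by (simp add: less_imp_le[OF frac_lt_1])
  next
    case False
    then have "\<lfloor>x\<rfloor> + 1 \<le> \<lfloor>y\<rfloor>" using floor_mono[OF that] by linarith
    then have "real_of_int \<lfloor>x\<rfloor> + 1 \<le> real_of_int \<lfloor>y\<rfloor>" by linarith
    then have d: "(1 - frac x) + frac y \<le> y - x" by (simp add: frac_def)
    have "\<bar>f (frac x) - f (frac y)\<bar> \<le> \<bar>f (frac x) - f 1\<bar> + \<bar>f 0 - f (frac y)\<bar>" using f01 by linarith
    also have "\<dots> \<le> L * (1 - frac x) + L * (frac y - 0)"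
      using frac_lt_1[of x] frac_lt_1[of y] by (intro add_mono L) auto
    also have "\<dots> \<le> L * (y - x)" using mult_left_mono[OF d L0] by (simp add: algebra_simps)
    finally show ?thesis using that by simp
  qed
  show ?thesis
  proof (cases "x \<le> y")
    case False
    then show ?thesis using *[of y x] by (simp add: abs_minus_commute)
  qed (use * in blast)
qed

text \<open>The pairs of test function and derivative against which the Lasota--Yorke estimate is
  stated. The class is closed under passing from \<open>\<psi>'\<close> to its image under the operator.\<close>

definition test_pair :: "real \<Rightarrow> (real \<Rightarrow> real) \<Rightarrow> (real \<Rightarrow> real) \<Rightarrow> bool" where
  "test_pair M \<psi> d \<longleftrightarrow> (\<forall>x. \<psi> (frac x) = \<psi> x) \<and> (\<forall>x. d (frac x) = d x) \<and> (\<forall>x. \<bar>\<psi> x\<bar> \<le> M) \<and>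
     (\<exists>L. \<forall>x y. \<bar>\<psi> x - \<psi> y\<bar> \<le> L * \<bar>x - y\<bar>) \<and> (\<exists>B. \<forall>x. \<bar>d x\<bar> \<le> B) \<and> d \<in> borel_measurable borel \<and>
     (\<exists>S. countable S \<and> (\<forall>x. x \<notin> S \<longrightarrow> (\<psi> has_real_derivative d x) (at x)))"

lemma test_pair_continuous:
  assumes "test_pair M \<psi> d"
  shows "isCont \<psi> x"
proof -
  obtain L where L: "\<And>x y. \<bar>\<psi> x - \<psi> y\<bar> \<le> L * \<bar>x - y\<bar>" using assms by (auto simp: test_pair_def)
  have "((\<lambda>y. \<psi> y - \<psi> x) \<longlongrightarrow> 0) (at x)"
  proof (rule Lim_null_comparison)
    show "\<forall>\<^sub>F y in at x. norm (\<psi> y - \<psi> x) \<le> L * \<bar>y - x\<bar>" using L by simp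
    show "((\<lambda>y. L * \<bar>y - x\<bar>) \<longlongrightarrow> 0) (at x)" by (auto intro!: tendsto_eq_intros)
  qed
  then show ?thesis unfolding isCont_def by (simp add: LIM_zero_iff)
qed

text \<open>Difference quotients of a periodic function have integral 0. They are bounded by the
  Lipschitz constant and converge to \<open>d\<close> off a countable set, so dominated convergence
  applies.\<close>

lemma test_pair_integral_0:
  assumes \<psi>: "test_pair M \<psi> d"
  shows "(\<integral>x. d x \<partial>unit_uniform) = 0"
proof -
  obtain L where L: "\<And>x y. \<bar>\<psi> x - \<psi> y\<bar> \<le> L * \<bar>x - y\<bar>" using \<psi> by (auto simp: test_pair_def)
  obtain S where S: "countable S" "\<And>x. x \<notin> S \<Longrightarrow> (\<psi> has_real_derivative d x) (at x)"
    using \<psi> by (auto simp: test_pair_def)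
  have per: "\<psi> (frac x) = \<psi> x" and M: "\<bar>\<psi> x\<bar> \<le> M" for x using \<psi> by (auto simp: test_pair_def)
  have [measurable]: "\<psi> \<in> borel_measurable borel" "d \<in> borel_measurable borel"
    using test_pair_continuous[OF \<psi>] \<psi>
    by (auto intro!: borel_measurable_continuous_onI continuous_at_imp_continuous_on simp: test_pair_def)
  interpret U: prob_space unit_uniform by (rule prob_space_unit_uniform)
  have shift: "(\<integral>x. \<psi> (x + h) \<partial>unit_uniform) = (\<integral>x. \<psi> x \<partial>unit_uniform)" if h: "0 < h" "h \<le> 1" for h
  proof -
    have int: "integrable lborel (\<lambda>x. indicator {a..<b} x * \<psi> x)" for a b
    proof (rule Bochner_Integration.integrable_bound)
      have "emeasure lborel {a..<b} \<le> emeasure lborel {a..b}" by (intro emeasure_mono) auto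
      also have "\<dots> < \<infinity>" by (simp add: emeasure_lborel_Icc_eq)
      finally have "emeasure lborel {a..<b} < \<infinity>" .
      then have "integrable lborel (indicator {a..<b} :: real \<Rightarrow> real)" by (intro integrable_real_indicator) auto
      then show "integrable lborel (\<lambda>x. M * indicator {a..<b} x)" by simp
      show "AE x in lborel. norm (indicator {a..<b} x * \<psi> x) \<le> norm (M * indicator {a..<b} x)"
        using M by (auto simp: indicator_def intro: order_trans[OF _ abs_ge_self])
    qed measurable
    have e: "(\<integral>x. \<phi> x \<partial>unit_uniform) = (\<integral>x. indicator {0..<1} x * \<phi> x \<partial>lborel)"
      if "\<phi> \<in> borel_measurable borel" for \<phi> :: "real \<Rightarrow> real"
      using that by (subst integral_density) auto
    have per1: "\<psi> (x + 1) = \<psi> x" for x using per[of "x + 1"] per[of x] by (simp add: frac_1_eq)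
    have "(\<integral>x. \<psi> (x + h) \<partial>unit_uniform) = (\<integral>x. indicator {0..<1} x * \<psi> (x + h) \<partial>lborel)" by (rule e) measurable
    also have "\<dots> = (\<integral>x. indicator {h..<1 + h} x * \<psi> x \<partial>lborel)"
      by (subst (2) lborel_integral_real_affine[where c = 1 and t = h])
        (auto intro!: Bochner_Integration.integral_cong simp: indicator_def add.commute)
    also have "\<dots> = (\<integral>x. indicator {h..<1} x * \<psi> x + indicator {1..<1 + h} x * \<psi> x \<partial>lborel)"
      using h by (intro Bochner_Integration.integral_cong) (auto simp: indicator_def)
    also have "\<dots> = (\<integral>x. indicator {h..<1} x * \<psi> x \<partial>lborel) + (\<integral>x. indicator {1..<1 + h} x * \<psi> x \<partial>lborel)"
      by (intro Bochner_Integration.integral_add int)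
    also have "(\<integral>x. indicator {1..<1 + h} x * \<psi> x \<partial>lborel) = (\<integral>x. indicator {0..<h} x * \<psi> x \<partial>lborel)"
      by (subst lborel_integral_real_affine[where c = 1 and t = 1])
        (auto intro!: Bochner_Integration.integral_cong simp: indicator_def per1 add.commute)
    also have "(\<integral>x. indicator {h..<1} x * \<psi> x \<partial>lborel) + \<dots> = (\<integral>x. indicator {h..<1} x * \<psi> x + indicator {0..<h} x * \<psi> x \<partial>lborel)"
      by (intro Bochner_Integration.integral_add[symmetric] int)
    also have "\<dots> = (\<integral>x. indicator {0..<1} x * \<psi> x \<partial>lborel)"
      using h by (intro Bochner_Integration.integral_cong) (auto simp: indicator_def)
    also have "\<dots> = (\<integral>x. \<psi> x \<partial>unit_uniform)" by (rule e[symmetric]) measurable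
    finally show ?thesis .
  qed
  define g where "g n x = (\<psi> (x + 1 / real (Suc n)) - \<psi> x) / (1 / real (Suc n))" for n x
  have [measurable]: "g n \<in> borel_measurable borel" for n unfolding g_def by measurable
  have "(\<lambda>n. \<integral>x. g n x \<partial>unit_uniform) \<longlonglongrightarrow> (\<integral>x. d x \<partial>unit_uniform)"
  proof (rule integral_dominated_convergence)
    show "integrable unit_uniform (\<lambda>_. L)" by simp
    show "AE x in unit_uniform. norm (g n x) \<le> L" for n
    proof (rule AE_I2)
      fix x
      have "norm (g n x) = \<bar>\<psi> (x + 1 / real (Suc n)) - \<psi> x\<bar> * real (Suc n)" by (simp add: g_def abs_mult)
      also have "\<dots> \<le> L * \<bar>x + 1 / real (Suc n) - x\<bar> * real (Suc n)" by (intro mult_right_mono L) simp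
      finally show "norm (g n x) \<le> L" by simp
    qed
    have lim: "(\<lambda>n. g n x) \<longlonglongrightarrow> d x" if "x \<notin> S" for x
    proof -
      have "((\<lambda>h. (\<psi> (x + h) - \<psi> x) / h) \<longlongrightarrow> d x) (at 0)"
        using S(2)[OF that] by (simp add: DERIV_def)
      moreover have "filterlim (\<lambda>n. 1 / real (Suc n)) (at 0) sequentially"
        unfolding filterlim_at using LIMSEQ_inverse_real_of_nat by (auto simp: inverse_eq_divide)
      ultimately show ?thesis unfolding g_def by (rule filterlim_compose)
    qed
    have "S \<in> null_sets lborel" using countable_imp_null_set_lborel[OF S(1)] .
    then have "AE x in lborel. x \<notin> S" by (rule AE_not_in)
    then show "AE x in unit_uniform. (\<lambda>n. g n x) \<longlonglongrightarrow> d x"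
      by (subst AE_density) (auto elim!: eventually_mono intro: lim)
  qed measurable
  moreover have "(\<integral>x. g n x \<partial>unit_uniform) = 0" for n
  proof -
    have int: "integrable unit_uniform (\<lambda>x. \<psi> (x + h))" for h
      by (rule U.integrable_const_bound[where B = M]) (use M in auto)
    have "(\<integral>x. g n x \<partial>unit_uniform) = ((\<integral>x. \<psi> (x + 1 / real (Suc n)) \<partial>unit_uniform) - (\<integral>x. \<psi> x \<partial>unit_uniform)) / (1 / real (Suc n))"
      unfolding g_def using int[of "1 / real (Suc n)"] int[of 0] by (simp del: of_nat_Suc)
    then show ?thesis using shift[of "1 / real (Suc n)"] by simp
  qed
  ultimately show ?thesis by (simp add: LIMSEQ_const_iff)
qed

text \<open>The sum over \<open>x = s\<close> and \<open>x = 1 + s\<close> of the probability of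
  \<open>x\<close>, times the inverse slope \<open>x\<^sup>2 / \<gamma>\<close>, times
  \<open>\<psi> (\<gamma> / x)\<close>.\<close>

definition transfer_test :: "real \<Rightarrow> (real \<Rightarrow> real) \<Rightarrow> real \<Rightarrow> real" where
  "transfer_test \<gamma> \<psi> s = ((2 * s ^ 3 - s ^ 4) * \<psi> (\<gamma> / s) + (1 - s\<^sup>2)\<^sup>2 * \<psi> (\<gamma> / (1 + s))) / \<gamma>"

text \<open>The part of the derivative of \<open>transfer_test\<close> in which the polynomial
  weights are differentiated; no derivative of \<open>\<psi>\<close> occurs.\<close>

definition transfer_rest :: "real \<Rightarrow> (real \<Rightarrow> real) \<Rightarrow> real \<Rightarrow> real" where
  "transfer_rest \<gamma> \<psi> s = ((6 * s\<^sup>2 - 4 * s ^ 3) * \<psi> (\<gamma> / s) - 4 * s * (1 - s\<^sup>2) * \<psi> (\<gamma> / (1 + s))) / \<gamma>"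

text \<open>The weights are nonnegative and sum to \<open>1 - 2 * s\<^sup>2 * (1 - s)\<close>, so
  only the contraction factor \<open>1 / \<gamma>\<close> remains.\<close>

lemma transfer_test_bound:
  assumes \<gamma>: "\<gamma> > 0" and s: "0 \<le> s" "s \<le> 1" and M: "\<And>x. \<bar>\<psi> x\<bar> \<le> M"
  shows "\<bar>transfer_test \<gamma> \<psi> s\<bar> \<le> M / \<gamma>"
proof -
  have M0: "0 \<le> M" using M[of 0] by linarith
  have m1: "0 \<le> 2 * s ^ 3 - s ^ 4"
  proof -
    have "2 * s ^ 3 - s ^ 4 = s ^ 3 * (2 - s)" by (simp add: algebra_simps power_numeral_reduce)
    then show ?thesis using s by simp
  qed
  have m12: "(2 * s ^ 3 - s ^ 4) + (1 - s\<^sup>2)\<^sup>2 \<le> 1"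
  proof -
    have "(2 * s ^ 3 - s ^ 4) + (1 - s\<^sup>2)\<^sup>2 = 1 - 2 * s\<^sup>2 * (1 - s)"
      by (simp add: algebra_simps power_numeral_reduce)
    then show ?thesis using s by simp
  qed
  have "\<bar>transfer_test \<gamma> \<psi> s\<bar> = \<bar>(2 * s ^ 3 - s ^ 4) * \<psi> (\<gamma> / s) + (1 - s\<^sup>2)\<^sup>2 * \<psi> (\<gamma> / (1 + s))\<bar> / \<gamma>"
    using \<gamma> by (simp add: transfer_test_def)
  also have "\<dots> \<le> ((2 * s ^ 3 - s ^ 4) * M + (1 - s\<^sup>2)\<^sup>2 * M) / \<gamma>"
  proof (intro divide_right_mono order_trans[OF abs_triangle_ineq] add_mono)
    show "\<bar>(2 * s ^ 3 - s ^ 4) * \<psi> (\<gamma> / s)\<bar> \<le> (2 * s ^ 3 - s ^ 4) * M"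
      using m1 M by (simp add: abs_mult mult_left_mono)
    show "\<bar>(1 - s\<^sup>2)\<^sup>2 * \<psi> (\<gamma> / (1 + s))\<bar> \<le> (1 - s\<^sup>2)\<^sup>2 * M"
      using M by (simp add: abs_mult mult_left_mono)
  qed (use \<gamma> in simp)
  also have "\<dots> \<le> M / \<gamma>"
    using mult_right_mono[OF m12 M0] \<gamma> by (intro divide_right_mono) (auto simp: distrib_right)
  finally show ?thesis .
qed

text \<open>The coefficients are bounded by 2 and 4 in absolute value, and
  \<open>1 / \<gamma>\<close> is estimated by 1.\<close>

lemma transfer_rest_bound:
  assumes \<gamma>: "\<gamma> \<ge> 1" and s: "0 \<le> s" "s \<le> 1" and M: "\<And>x. \<bar>\<psi> x\<bar> \<le> M"
  shows "\<bar>transfer_rest \<gamma> \<psi> s\<bar> \<le> 6 * M"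
proof -
  have M0: "0 \<le> M" using M[of 0] by linarith
  have c1: "0 \<le> 6 * s\<^sup>2 - 4 * s ^ 3" "6 * s\<^sup>2 - 4 * s ^ 3 \<le> 2"
  proof -
    have "6 * s\<^sup>2 - 4 * s ^ 3 = s\<^sup>2 * (6 - 4 * s)" by (simp add: algebra_simps power_numeral_reduce)
    then show "0 \<le> 6 * s\<^sup>2 - 4 * s ^ 3" using s by simp
    have "2 - (6 * s\<^sup>2 - 4 * s ^ 3) = 2 * ((1 - s)\<^sup>2 * (1 + 2 * s))"
      by (simp add: algebra_simps power_numeral_reduce)
    moreover have "0 \<le> (1 - s)\<^sup>2 * (1 + 2 * s)" using s by simp
    ultimately show "6 * s\<^sup>2 - 4 * s ^ 3 \<le> 2" by linarith
  qed
  have s2: "0 \<le> 1 - s\<^sup>2" using s by (simp add: power_le_one)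
  have c2: "0 \<le> 4 * s * (1 - s\<^sup>2)" "4 * s * (1 - s\<^sup>2) \<le> 4"
    using s s2 mult_mono[of s 1 "1 - s\<^sup>2" 1] by auto
  have "\<bar>transfer_rest \<gamma> \<psi> s\<bar> = \<bar>(6 * s\<^sup>2 - 4 * s ^ 3) * \<psi> (\<gamma> / s) - 4 * s * (1 - s\<^sup>2) * \<psi> (\<gamma> / (1 + s))\<bar> / \<gamma>"
    using \<gamma> by (simp add: transfer_rest_def)
  also have "\<dots> \<le> \<bar>(6 * s\<^sup>2 - 4 * s ^ 3) * \<psi> (\<gamma> / s) - 4 * s * (1 - s\<^sup>2) * \<psi> (\<gamma> / (1 + s))\<bar>"
    using \<gamma> by (simp add: divide_le_eq mult_left_le mult_le_cancel_left1)
  also have "\<dots> \<le> \<bar>(6 * s\<^sup>2 - 4 * s ^ 3) * \<psi> (\<gamma> / s)\<bar> + \<bar>4 * s * (1 - s\<^sup>2) * \<psi> (\<gamma> / (1 + s))\<bar>"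
    by (rule abs_triangle_ineq4)
  also have "\<dots> \<le> 2 * M + 4 * M"
    unfolding abs_mult[of _ "\<psi> _"] using c1 c2 M M0 by (intro add_mono mult_mono) auto
  finally show ?thesis by simp
qed

lemma transfer_test_lipschitz:
  assumes \<gamma>: "\<gamma> > 0" and M: "\<And>x. \<bar>\<psi> x\<bar> \<le> M" and L: "\<And>x y. \<bar>\<psi> x - \<psi> y\<bar> \<le> L * \<bar>x - y\<bar>"
    and x: "0 \<le> x" and xy: "x \<le> y" and y: "y \<le> 1"
  shows "\<bar>transfer_test \<gamma> \<psi> x - transfer_test \<gamma> \<psi> y\<bar> \<le> (18 * M + 3 * L * \<gamma>) / \<gamma> * (y - x)"
proof -
  have M0: "0 \<le> M" using M[of 0] by linarith
  have L0: "0 \<le> L" using L[of 0 1] by simp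
  define m1 m2 where "m1 s = 2 * s ^ 3 - s ^ 4" and "m2 s = (1 - s\<^sup>2)\<^sup>2" for s :: real
  have p: "x * y \<le> 1" "x\<^sup>2 \<le> 1" "y\<^sup>2 \<le> 1" "x ^ 3 \<le> 1" "y ^ 3 \<le> 1" "0 \<le> x * y"
    "x * y\<^sup>2 \<le> 1" "x\<^sup>2 * y \<le> 1" "0 \<le> x * y\<^sup>2" "0 \<le> x\<^sup>2 * y" "0 \<le> x ^ 3" "0 \<le> y ^ 3" "x + y \<le> 2"
    using x xy y by (auto intro!: mult_le_one power_le_one)
  have d2: "0 \<le> y\<^sup>2 - x\<^sup>2" "y\<^sup>2 - x\<^sup>2 \<le> 2 * (y - x)"
  proof -
    have e: "y\<^sup>2 - x\<^sup>2 = (x + y) * (y - x)" by (simp add: algebra_simps power2_eq_square)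
    show "0 \<le> y\<^sup>2 - x\<^sup>2" unfolding e using p x xy by (intro mult_nonneg_nonneg) auto
    show "y\<^sup>2 - x\<^sup>2 \<le> 2 * (y - x)" unfolding e using p xy by (intro mult_right_mono) auto
  qed
  have d3: "0 \<le> y ^ 3 - x ^ 3" "y ^ 3 - x ^ 3 \<le> 3 * (y - x)"
  proof -
    have e: "y ^ 3 - x ^ 3 = (x\<^sup>2 + x * y + y\<^sup>2) * (y - x)" by (simp add: algebra_simps power_numeral_reduce)
    show "0 \<le> y ^ 3 - x ^ 3" unfolding e using p x xy by (intro mult_nonneg_nonneg) auto
    show "y ^ 3 - x ^ 3 \<le> 3 * (y - x)" unfolding e using p xy by (intro mult_right_mono) auto
  qed
  have d4: "0 \<le> y ^ 4 - x ^ 4" "y ^ 4 - x ^ 4 \<le> 4 * (y - x)"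
  proof -
    have e: "y ^ 4 - x ^ 4 = (x ^ 3 + x\<^sup>2 * y + x * y\<^sup>2 + y ^ 3) * (y - x)" by (simp add: algebra_simps power_numeral_reduce)
    show "0 \<le> y ^ 4 - x ^ 4" unfolding e using p x xy by (intro mult_nonneg_nonneg) auto
    show "y ^ 4 - x ^ 4 \<le> 4 * (y - x)" unfolding e using p xy by (intro mult_right_mono) auto
  qed
  have m1: "\<bar>m1 x - m1 y\<bar> \<le> 10 * (y - x)"
    unfolding m1_def using d3 d4 by linarith
  have m2: "\<bar>m2 x - m2 y\<bar> \<le> 8 * (y - x)"
  proof -
    have "m2 s = 1 - 2 * s\<^sup>2 + s ^ 4" for s by (simp add: m2_def algebra_simps power_numeral_reduce)
    then show ?thesis using d2 d4 by simp
  qed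
  have 1: "\<bar>m1 x * \<psi> (\<gamma> / x) - m1 y * \<psi> (\<gamma> / y)\<bar> \<le> 10 * (y - x) * M + 2 * L * \<gamma> * (y - x)"
  proof -
    \<comment> \<open>Near 0 the argument \<open>\<gamma> / x\<close> changes arbitrarily fast, by
      \<open>\<gamma> * (y - x) / (x * y)\<close>. The weight \<open>m1 x \<le> 2 * (x * y)\<close>
      cancels this denominator.\<close>
    have "\<bar>m1 x * (\<psi> (\<gamma> / x) - \<psi> (\<gamma> / y))\<bar> \<le> 2 * L * \<gamma> * (y - x)"
    proof (cases "x = 0")
      case True
      then show ?thesis using L0 \<gamma> xy by (simp add: m1_def)
    next
      case False
      then have x0: "x > 0" "y > 0" using x xy by auto
      have e: "\<gamma> / x - \<gamma> / y = \<gamma> * (y - x) / (x * y)" using x0 by (simp add: field_simps)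
      have "\<bar>\<psi> (\<gamma> / x) - \<psi> (\<gamma> / y)\<bar> \<le> L * (\<gamma> * (y - x) / (x * y))"
        using L[of "\<gamma> / x" "\<gamma> / y"] x0 xy \<gamma> unfolding e by simp
      moreover have "0 \<le> m1 x" "m1 x \<le> 2 * (x * y)"
      proof -
        have f: "m1 x = x ^ 3 * (2 - x)" by (simp add: m1_def algebra_simps power_numeral_reduce)
        show "0 \<le> m1 x" unfolding f using x0 xy y by simp
        have "x ^ 3 \<le> x * y"
        proof -
          have "x\<^sup>2 \<le> x * 1" using x0 xy y by (simp add: power2_eq_square mult_left_le)
          also have "\<dots> \<le> y" using xy by simp
          finally have "x * x\<^sup>2 \<le> x * y" using x0 by (intro mult_left_mono) auto
          then show ?thesis by (simp add: power_numeral_reduce)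
        qed
        moreover have "0 \<le> x ^ 4" by simp
        ultimately show "m1 x \<le> 2 * (x * y)" unfolding m1_def by linarith
      qed
      ultimately have "\<bar>m1 x * (\<psi> (\<gamma> / x) - \<psi> (\<gamma> / y))\<bar> \<le> 2 * (x * y) * (L * (\<gamma> * (y - x) / (x * y)))"
        unfolding abs_mult using x0 by (intro mult_mono) auto
      also have "\<dots> = 2 * L * \<gamma> * (y - x)" using x0 by simp
      finally show ?thesis .
    qed
    moreover have "\<bar>(m1 x - m1 y) * \<psi> (\<gamma> / y)\<bar> \<le> 10 * (y - x) * M"
      unfolding abs_mult using m1 M M0 xy by (intro mult_mono) auto
    moreover have "m1 x * \<psi> (\<gamma> / x) - m1 y * \<psi> (\<gamma> / y) = m1 x * (\<psi> (\<gamma> / x) - \<psi> (\<gamma> / y)) + (m1 x - m1 y) * \<psi> (\<gamma> / y)"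
      by (simp add: algebra_simps)
    ultimately show ?thesis by linarith
  qed
  have 2: "\<bar>m2 x * \<psi> (\<gamma> / (1 + x)) - m2 y * \<psi> (\<gamma> / (1 + y))\<bar> \<le> 8 * (y - x) * M + L * \<gamma> * (y - x)"
  proof -
    have "\<bar>m2 x * (\<psi> (\<gamma> / (1 + x)) - \<psi> (\<gamma> / (1 + y)))\<bar> \<le> 1 * (L * \<gamma> * (y - x))"
      unfolding abs_mult
    proof (intro mult_mono)
      have e: "\<gamma> / (1 + x) - \<gamma> / (1 + y) = \<gamma> * (y - x) / ((1 + x) * (1 + y))" using x xy by (simp add: field_simps)
      have "1 * 1 \<le> (1 + x) * (1 + y)" using x xy by (intro mult_mono) auto
      then have "\<gamma> * (y - x) / ((1 + x) * (1 + y)) \<le> \<gamma> * (y - x) / 1"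
        using \<gamma> xy by (intro divide_left_mono) auto
      moreover have "0 \<le> \<gamma> * (y - x) / ((1 + x) * (1 + y))" using x xy \<gamma> by simp
      ultimately have "\<bar>\<gamma> / (1 + x) - \<gamma> / (1 + y)\<bar> \<le> \<gamma> * (y - x)"
        by (simp only: e abs_of_nonneg div_by_1)
      then show "\<bar>\<psi> (\<gamma> / (1 + x)) - \<psi> (\<gamma> / (1 + y))\<bar> \<le> L * \<gamma> * (y - x)"
        using L[of "\<gamma> / (1 + x)" "\<gamma> / (1 + y)"] L0 mult_left_mono by (fastforce simp: mult.assoc)
      show "\<bar>m2 x\<bar> \<le> 1" using p by (simp add: m2_def power_le_one)
    qed auto
    moreover have "\<bar>(m2 x - m2 y) * \<psi> (\<gamma> / (1 + y))\<bar> \<le> 8 * (y - x) * M"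
      unfolding abs_mult using m2 M M0 xy by (intro mult_mono) auto
    moreover have "m2 x * \<psi> (\<gamma> / (1 + x)) - m2 y * \<psi> (\<gamma> / (1 + y)) =
        m2 x * (\<psi> (\<gamma> / (1 + x)) - \<psi> (\<gamma> / (1 + y))) + (m2 x - m2 y) * \<psi> (\<gamma> / (1 + y))"
      by (simp add: algebra_simps)
    ultimately show ?thesis by linarith
  qed
  have "transfer_test \<gamma> \<psi> x - transfer_test \<gamma> \<psi> y =
      ((m1 x * \<psi> (\<gamma> / x) - m1 y * \<psi> (\<gamma> / y)) + (m2 x * \<psi> (\<gamma> / (1 + x)) - m2 y * \<psi> (\<gamma> / (1 + y)))) / \<gamma>"
    by (simp add: transfer_test_def m1_def m2_def diff_divide_distrib add_divide_distrib)
  also have "\<bar>\<dots>\<bar> = \<bar>(m1 x * \<psi> (\<gamma> / x) - m1 y * \<psi> (\<gamma> / y)) + (m2 x * \<psi> (\<gamma> / (1 + x)) - m2 y * \<psi> (\<gamma> / (1 + y)))\<bar> / \<gamma>"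
    using \<gamma> by simp
  also have "\<dots> \<le> ((10 * (y - x) * M + 2 * L * \<gamma> * (y - x)) + (8 * (y - x) * M + L * \<gamma> * (y - x))) / \<gamma>"
    using \<gamma> 1 2 by (intro divide_right_mono order_trans[OF abs_triangle_ineq] add_mono) auto
  also have "\<dots> = (18 * M + 3 * L * \<gamma>) / \<gamma> * (y - x)" by (simp add: algebra_simps)
  finally show ?thesis .
qed

text \<open>The chain rule factor \<open>- \<gamma> / x\<^sup>2\<close> cancels the inverse slope in
  the weights, so that exactly the Markov operator applied to \<open>d\<close> is left, with a minus
  sign.\<close>

lemma transfer_test_derivative:
  assumes \<gamma>: "\<gamma> > 0" and s: "0 < s"
    and d: "(\<psi> has_real_derivative d (\<gamma> / s)) (at (\<gamma> / s))"
      "(\<psi> has_real_derivative d (\<gamma> / (1 + s))) (at (\<gamma> / (1 + s)))"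
  shows "(transfer_test \<gamma> \<psi> has_real_derivative transfer_rest \<gamma> \<psi> s - digit_operator \<gamma> d s) (at s)"
proof -
  have 1: "((\<lambda>s. \<psi> (\<gamma> / s)) has_real_derivative d (\<gamma> / s) * (- \<gamma> / s\<^sup>2)) (at s)"
    by (rule DERIV_chain2[where f = \<psi> and g = "\<lambda>s. \<gamma> / s", OF d(1)]) (use s in \<open>auto intro!: derivative_eq_intros simp: power2_eq_square\<close>)
  have 2: "((\<lambda>s. \<psi> (\<gamma> / (1 + s))) has_real_derivative d (\<gamma> / (1 + s)) * (- \<gamma> / (1 + s)\<^sup>2)) (at s)"
    by (rule DERIV_chain2[where f = \<psi> and g = "\<lambda>s. \<gamma> / (1 + s)", OF d(2)]) (use s in \<open>auto intro!: derivative_eq_intros simp: power2_eq_square\<close>)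
  have "(transfer_test \<gamma> \<psi> has_real_derivative
      ((6 * s\<^sup>2 - 4 * s ^ 3) * \<psi> (\<gamma> / s) + (2 * s ^ 3 - s ^ 4) * (d (\<gamma> / s) * (- \<gamma> / s\<^sup>2)) +
       (- 4 * s * (1 - s\<^sup>2) * \<psi> (\<gamma> / (1 + s)) + (1 - s\<^sup>2)\<^sup>2 * (d (\<gamma> / (1 + s)) * (- \<gamma> / (1 + s)\<^sup>2)))) / \<gamma>) (at s)"
  proof -
    have 3: "((\<lambda>s. 2 * s ^ 3 - s ^ 4) has_real_derivative 6 * s\<^sup>2 - 4 * s ^ 3) (at s)"
      by (auto intro!: derivative_eq_intros)
    have 4: "((\<lambda>s. (1 - s\<^sup>2)\<^sup>2) has_real_derivative - 4 * s * (1 - s\<^sup>2)) (at s)"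
      by (auto intro!: derivative_eq_intros)
    from DERIV_cdivide[OF DERIV_add[OF DERIV_mult[OF 3 1] DERIV_mult[OF 4 2]], of \<gamma>]
    show ?thesis
      unfolding transfer_test_def[abs_def] by (simp only: mult.commute[of "d _ * _"])
  qed
  moreover have "(2 * s ^ 3 - s ^ 4) * (d (\<gamma> / s) * (- \<gamma> / s\<^sup>2)) = - \<gamma> * ((1 - digit_prob s) * d (\<gamma> / s))"
  proof -
    have "2 * s ^ 3 - s ^ 4 = s\<^sup>2 * (1 - digit_prob s)" by (simp add: digit_prob_def algebra_simps power_numeral_reduce)
    then show ?thesis using s by simp
  qed
  moreover have "(1 - s\<^sup>2)\<^sup>2 * (d (\<gamma> / (1 + s)) * (- \<gamma> / (1 + s)\<^sup>2)) = - \<gamma> * (digit_prob s * d (\<gamma> / (1 + s)))"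
  proof -
    have "(1 - s\<^sup>2)\<^sup>2 = (1 + s)\<^sup>2 * digit_prob s" by (simp add: digit_prob_def algebra_simps power_numeral_reduce)
    then show ?thesis using s by simp
  qed
  moreover have "(a * x + - \<gamma> * b + (- 4 * s * (1 - s\<^sup>2) * y + - \<gamma> * c)) / \<gamma> = (a * x - 4 * s * (1 - s\<^sup>2) * y) / \<gamma> - (b + c)"
    for a b c x y :: real using \<gamma> by (simp add: field_simps)
  ultimately show ?thesis
    by (simp only: transfer_rest_def digit_operator_def)
qed

text \<open>Passing to a new test function preserves all regularity and divides the bound
  \<open>M\<close> by \<open>\<gamma>\<close>.\<close>

lemma test_pair_transfer:
  assumes \<gamma>: "\<gamma> \<ge> 1" and \<psi>: "test_pair M \<psi> d"
  shows "test_pair (M / \<gamma>) (\<lambda>x. transfer_test \<gamma> \<psi> (frac x))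
    (\<lambda>x. transfer_rest \<gamma> \<psi> (frac x) - digit_operator \<gamma> d (frac x))"
proof -
  have \<gamma>0: "\<gamma> > 0" using \<gamma> by simp
  have per: "\<psi> (frac x) = \<psi> x" and M: "\<bar>\<psi> x\<bar> \<le> M" for x using \<psi> by (auto simp: test_pair_def)
  obtain L where L: "\<And>x y. \<bar>\<psi> x - \<psi> y\<bar> \<le> L * \<bar>x - y\<bar>" using \<psi> by (auto simp: test_pair_def)
  obtain B where B: "\<And>x. \<bar>d x\<bar> \<le> B" using \<psi> by (auto simp: test_pair_def)
  obtain S where S: "countable S" "\<And>x. x \<notin> S \<Longrightarrow> (\<psi> has_real_derivative d x) (at x)"
    using \<psi> by (auto simp: test_pair_def)
  have [measurable]: "\<psi> \<in> borel_measurable borel" "d \<in> borel_measurable borel"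
    using test_pair_continuous[OF \<psi>] \<psi>
    by (auto intro!: borel_measurable_continuous_onI continuous_at_imp_continuous_on simp: test_pair_def)
  have fr: "0 \<le> frac x" "frac x \<le> 1" for x :: real using frac_lt_1[of x] by auto
  have lip: "\<exists>L. \<forall>x y. \<bar>transfer_test \<gamma> \<psi> (frac x) - transfer_test \<gamma> \<psi> (frac y)\<bar> \<le> L * \<bar>x - y\<bar>"
  proof -
    have "\<bar>transfer_test \<gamma> \<psi> (frac x) - transfer_test \<gamma> \<psi> (frac y)\<bar> \<le> (18 * M + 3 * L * \<gamma>) / \<gamma> * \<bar>x - y\<bar>" for x y
    proof (rule lipschitz_frac)
      \<comment> \<open>Both values are \<open>\<psi> \<gamma> / \<gamma>\<close>: only
        \<open>x = 1\<close> has weight at either end. This makes the new test function continuous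
        on the circle and avoids boundary terms.\<close>
      show "transfer_test \<gamma> \<psi> 0 = transfer_test \<gamma> \<psi> 1" by (simp add: transfer_test_def)
    qed (rule transfer_test_lipschitz[OF \<gamma>0 M L])
    then show ?thesis by (intro exI allI)
  qed
  have bdd: "\<bar>transfer_rest \<gamma> \<psi> (frac x) - digit_operator \<gamma> d (frac x)\<bar> \<le> 6 * M + B" for x
    using transfer_rest_bound[where \<psi> = \<psi>, OF \<gamma> fr M, of x] digit_operator_bounded[of d, OF B fr, of \<gamma> x] by linarith
  have meas: "(\<lambda>x. transfer_rest \<gamma> \<psi> (frac x) - digit_operator \<gamma> d (frac x)) \<in> borel_measurable borel"
  proof -
    have "transfer_rest \<gamma> \<psi> \<in> borel_measurable borel" unfolding transfer_rest_def[abs_def] by measurable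
    then show ?thesis by measurable
  qed
  \<comment> \<open>Preimages of the exceptional set under the two branches; \<open>S'\<close> adds
    the point 0, where the circle is glued, and all integer translates.\<close>
  define E where "E = (\<lambda>t. \<gamma> / t) ` S \<union> (\<lambda>t. \<gamma> / t - 1) ` S"
  define S' where "S' = (\<lambda>(e, k). e + real_of_int k) ` ((insert 0 E) \<times> UNIV)"
  have S': "countable S'" 
    unfolding S'_def E_def
    by (intro countable_image countable_SIGMA countable_insert countable_Un S(1)) auto
  have deriv: "((\<lambda>x. transfer_test \<gamma> \<psi> (frac x)) has_real_derivative
      transfer_rest \<gamma> \<psi> (frac x) - digit_operator \<gamma> d (frac x)) (at x)" if x: "x \<notin> S'" for x
  proof -
    have "frac x \<notin> insert 0 E"
    proof
      assume "frac x \<in> insert 0 E"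
      then have "x \<in> S'"
        unfolding S'_def by (intro image_eqI[where x = "(frac x, \<lfloor>x\<rfloor>)"]) (simp_all add: frac_def)
      with x show False by simp
    qed
    then have s: "0 < frac x" "frac x < 1" "frac x \<notin> E" using fr[of x] frac_lt_1[of x] by (auto simp: less_le)
    have "\<gamma> / frac x \<notin> S"
    proof
      assume "\<gamma> / frac x \<in> S"
      then have "\<gamma> / (\<gamma> / frac x) \<in> E" unfolding E_def by blast
      with s \<gamma>0 show False by simp
    qed
    moreover have "\<gamma> / (1 + frac x) \<notin> S"
    proof
      assume "\<gamma> / (1 + frac x) \<in> S"
      then have "\<gamma> / (\<gamma> / (1 + frac x)) - 1 \<in> E" unfolding E_def by blast
      with s \<gamma>0 show False by simp
    qed
    ultimately have D: "(transfer_test \<gamma> \<psi> has_real_derivative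
        transfer_rest \<gamma> \<psi> (frac x) - digit_operator \<gamma> d (frac x)) (at (frac x))"
      using s by (intro transfer_test_derivative \<gamma>0 S(2)) auto
    define k where "k = real_of_int \<lfloor>x\<rfloor>"
    have "((\<lambda>y. transfer_test \<gamma> \<psi> (y - k)) has_real_derivative
        (transfer_rest \<gamma> \<psi> (frac x) - digit_operator \<gamma> d (frac x)) * 1) (at x)"
    proof (rule DERIV_chain2[where f = "transfer_test \<gamma> \<psi>" and g = "\<lambda>y. y - k"])
      show "(transfer_test \<gamma> \<psi> has_real_derivative
          transfer_rest \<gamma> \<psi> (frac x) - digit_operator \<gamma> d (frac x)) (at (x - k))"
        using D by (simp add: frac_def k_def)
      show "((\<lambda>y. y - k) has_real_derivative 1) (at x)" by (auto intro!: derivative_eq_intros)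
    qed
    then show ?thesis
      unfolding mult_1_right
    proof (rule has_field_derivative_transform_within_open)
      show "open {k<..<k + 1}" by simp
      show "x \<in> {k<..<k + 1}" using s by (auto simp: k_def frac_def)
      fix y assume "y \<in> {k<..<k + 1}"
      then have "\<lfloor>y\<rfloor> = \<lfloor>x\<rfloor>" by (auto simp: k_def floor_eq_iff)
      then show "transfer_test \<gamma> \<psi> (y - k) = transfer_test \<gamma> \<psi> (frac y)" by (simp add: frac_def k_def)
    qed
  qed
  show ?thesis
    unfolding test_pair_def
  proof (intro conjI allI)
    show "\<bar>transfer_test \<gamma> \<psi> (frac x)\<bar> \<le> M / \<gamma>" for x
      by (rule transfer_test_bound[OF \<gamma>0 fr M])
    show "\<exists>B. \<forall>x. \<bar>transfer_rest \<gamma> \<psi> (frac x) - digit_operator \<gamma> d (frac x)\<bar> \<le> B"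
      using bdd by (intro exI allI)
    show "\<exists>S. countable S \<and> (\<forall>x. x \<notin> S \<longrightarrow> ((\<lambda>x. transfer_test \<gamma> \<psi> (frac x)) has_real_derivative
        transfer_rest \<gamma> \<psi> (frac x) - digit_operator \<gamma> d (frac x)) (at x))"
      using S' deriv by (intro exI[of _ S'] conjI allI impI)
  qed (use lip meas in auto)
qed

text \<open>In dual form, the densities of the chain have uniformly bounded variation. One step
  replaces the integral of \<open>d\<close> by that of \<open>transfer_rest\<close>, at most
  \<open>6 * M\<close>, minus that of the derivative of the transferred test function, whose bound
  is \<open>M / \<gamma>\<close>. The constant solves \<open>C = 6 + C / \<gamma>\<close>.\<close>

lemma digit_chain_lasota_yorke:
  assumes \<gamma>: "\<gamma> > 1" and \<psi>: "test_pair M \<psi> d"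
  shows "\<bar>\<integral>x. d x \<partial>digit_chain \<gamma> n\<bar> \<le> 6 * \<gamma> / (\<gamma> - 1) * M"
  using \<psi>
proof (induction n arbitrary: M \<psi> d)
  case 0
  then have "0 \<le> M" by (auto simp: test_pair_def dest: spec[of _ 0])
  then show ?case using \<gamma> test_pair_integral_0[OF 0] by simp
next
  case (Suc n)
  have per: "d (frac x) = d x" and M: "\<bar>\<psi> x\<bar> \<le> M" for x using Suc.prems by (auto simp: test_pair_def)
  obtain B where B: "\<And>x. \<bar>d x\<bar> \<le> B" using Suc.prems by (auto simp: test_pair_def)
  have [measurable]: "\<psi> \<in> borel_measurable borel" "d \<in> borel_measurable borel"
    using test_pair_continuous[OF Suc.prems] Suc.prems
    by (auto intro!: borel_measurable_continuous_onI continuous_at_imp_continuous_on simp: test_pair_def)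
  have mR[measurable]: "transfer_rest \<gamma> \<psi> \<in> borel_measurable borel" unfolding transfer_rest_def[abs_def] by measurable
  interpret prob_space "digit_chain \<gamma> n" by (rule prob_space_digit_chain)
  define d' where "d' x = transfer_rest \<gamma> \<psi> (frac x) - digit_operator \<gamma> d (frac x)" for x
  have T: "test_pair (M / \<gamma>) (\<lambda>x. transfer_test \<gamma> \<psi> (frac x)) d'"
    unfolding d'_def by (rule test_pair_transfer[OF _ Suc.prems]) (use \<gamma> in simp)
  have R: "\<bar>transfer_rest \<gamma> \<psi> x\<bar> \<le> 6 * M" if "x \<in> {0..<1}" for x
    using that \<gamma> M by (intro transfer_rest_bound) auto
  have intR: "integrable (digit_chain \<gamma> n) (transfer_rest \<gamma> \<psi>)"
    by (rule integrable_digit_chain[OF mR R])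
  have md'[measurable]: "d' \<in> borel_measurable borel" using T by (simp add: test_pair_def)
  obtain B' where B': "\<And>x. \<bar>d' x\<bar> \<le> B'" using T by (auto simp: test_pair_def)
  have intd': "integrable (digit_chain \<gamma> n) d'" by (rule integrable_digit_chain[OF md' B'])
  have "(\<integral>x. d x \<partial>digit_chain \<gamma> (Suc n)) = (\<integral>s. digit_operator \<gamma> d s \<partial>digit_chain \<gamma> n)"
    by (rule integral_digit_chain_Suc[where B = B]) (use B per in auto)
  also have "\<dots> = (\<integral>s. transfer_rest \<gamma> \<psi> s - d' s \<partial>digit_chain \<gamma> n)"
  proof (rule integral_cong_AE)
    show "AE s in digit_chain \<gamma> n. digit_operator \<gamma> d s = transfer_rest \<gamma> \<psi> s - d' s"
      using AE_digit_chain by eventually_elim (simp add: d'_def)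
  qed measurable
  also have "\<dots> = (\<integral>s. transfer_rest \<gamma> \<psi> s \<partial>digit_chain \<gamma> n) - (\<integral>s. d' s \<partial>digit_chain \<gamma> n)"
    by (rule Bochner_Integration.integral_diff[OF intR intd'])
  finally have "\<bar>\<integral>x. d x \<partial>digit_chain \<gamma> (Suc n)\<bar> \<le> \<bar>\<integral>s. transfer_rest \<gamma> \<psi> s \<partial>digit_chain \<gamma> n\<bar> + \<bar>\<integral>s. d' s \<partial>digit_chain \<gamma> n\<bar>"
    by linarith
  also have "\<dots> \<le> 6 * M + 6 * \<gamma> / (\<gamma> - 1) * (M / \<gamma>)"
  proof (rule add_mono)
    have "\<bar>\<integral>s. transfer_rest \<gamma> \<psi> s \<partial>digit_chain \<gamma> n\<bar> \<le> (\<integral>s. \<bar>transfer_rest \<gamma> \<psi> s\<bar> \<partial>digit_chain \<gamma> n)"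
      by (rule integral_abs_bound)
    also have "\<dots> \<le> (\<integral>s. 6 * M \<partial>digit_chain \<gamma> n)"
    proof (rule integral_mono_AE)
      show "AE s in digit_chain \<gamma> n. \<bar>transfer_rest \<gamma> \<psi> s\<bar> \<le> 6 * M"
        using AE_digit_chain by eventually_elim (rule R)
    qed (use intR in auto)
    also have "\<dots> = 6 * M" using prob_space by simp
    finally show "\<bar>\<integral>s. transfer_rest \<gamma> \<psi> s \<partial>digit_chain \<gamma> n\<bar> \<le> 6 * M" .
  qed (rule Suc.IH[OF T])
  also have "\<dots> = 6 * \<gamma> / (\<gamma> - 1) * M" using \<gamma> by (simp add: field_simps)
  finally show ?case .
qed

text \<open>This bounds the density of every law of the chain by
  \<open>1 + 6 * \<gamma> / (\<gamma> - 1)\<close>. The Lasota-Yorke bound sees only the sup norm of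
  the primitive, which for nonnegative \<open>g\<close> is at most the integral of
  \<open>g\<close>.\<close>

lemma digit_chain_integral_le:
  fixes g :: "real \<Rightarrow> real"
  assumes \<gamma>: "\<gamma> > 1" and g: "continuous_on UNIV g" "\<And>x. 0 \<le> g x" "\<And>x. g x \<le> G"
  shows "(\<integral>x. g x \<partial>digit_chain \<gamma> n) \<le> (1 + 6 * \<gamma> / (\<gamma> - 1)) * (\<integral>x. g x \<partial>unit_uniform)"
proof -
  have [measurable]: "g \<in> borel_measurable borel" using g(1) by (rule borel_measurable_continuous_onI)
  interpret prob_space "digit_chain \<gamma> n" by (rule prob_space_digit_chain)
  define m where "m = integral {0..1} g"
  have gint: "g integrable_on {a..b}" for a b
    using g(1) by (intro integrable_continuous_real) (rule continuous_on_subset, auto)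
  have m0: "0 \<le> m" unfolding m_def using gint g by (intro Henstock_Kurzweil_Integration.integral_nonneg) auto
  have m1: "m \<le> G"
  proof -
    have "(g has_integral m) {0..1}" unfolding m_def using gint by (rule integrable_integral)
    moreover have "((\<lambda>_. G) has_integral G) {0..1::real}" using has_integral_const_real[of G 0 1] by simp
    ultimately show ?thesis using g(3) by (rule has_integral_le)
  qed
  have mU: "m = (\<integral>x. g x \<partial>unit_uniform)"
  proof -
    have "set_integrable lborel {0..1} g"
      by (rule borel_integrable_atLeastAtMost') (rule continuous_on_subset[OF g(1)], simp)
    then have "m = (\<integral>x. indicator {0..1} x *\<^sub>R g x \<partial>lborel)"
      unfolding m_def by (simp add: set_borel_integral_eq_integral(2)[symmetric] set_lebesgue_integral_def)
    also have "\<dots> = (\<integral>x. indicator {0..<1} x *\<^sub>R g x \<partial>lborel)"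
    proof (rule integral_cong_AE)
      have "AE x in lborel. x \<noteq> (1::real)" by (rule AE_lborel_singleton)
      then show "AE x in lborel. indicator {0..1} x *\<^sub>R g x = indicator {0..<1} x *\<^sub>R g x"
        by eventually_elim (auto simp: indicator_def)
    qed measurable
    also have "\<dots> = (\<integral>x. g x \<partial>unit_uniform)" by (subst integral_density) auto
    finally show ?thesis .
  qed
  \<comment> \<open>Subtracting the mean makes the primitive periodic. Both terms lie between 0 and
    \<open>m\<close>, hence the bound \<open>m\<close>.\<close>
  define \<Psi> where "\<Psi> t = integral {0..t} g - t * m" for t
  have \<Psi>_deriv: "(\<Psi> has_real_derivative g t - m) (at t within {0..1})" if "t \<in> {0..1}" for t
  proof -
    have "((\<lambda>t. integral {0..t} g) has_real_derivative g t) (at t within {0..1})"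
      using that by (intro integral_has_real_derivative continuous_on_subset[OF g(1)]) auto
    then show ?thesis unfolding \<Psi>_def[abs_def] by (auto intro!: derivative_eq_intros)
  qed
  have gm: "\<bar>g x - m\<bar> \<le> G" for x using g(2,3)[of x] m0 m1 by linarith
  have \<Psi>_lip: "\<bar>\<Psi> x - \<Psi> y\<bar> \<le> G * (y - x)" if "0 \<le> x" "x \<le> y" "y \<le> 1" for x y
  proof -
    have "norm (\<Psi> x - \<Psi> y) \<le> G * norm (x - y)"
      by (rule field_differentiable_bound[where S = "{0..1}"]) (use \<Psi>_deriv gm that in auto)
    then show ?thesis using that by simp
  qed
  have \<Psi>01: "\<Psi> 0 = \<Psi> 1" by (simp add: \<Psi>_def m_def)
  have \<Psi>_bound: "\<bar>\<Psi> t\<bar> \<le> m" if "0 \<le> t" "t \<le> 1" for t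
  proof -
    have "0 \<le> integral {0..t} g" using gint g by (intro Henstock_Kurzweil_Integration.integral_nonneg) auto
    moreover have "integral {0..t} g \<le> m"
      unfolding m_def using gint g that by (intro integral_subset_le) auto
    moreover have "0 \<le> t * m" "t * m \<le> m" using m0 that by (auto intro!: mult_left_le_one_le)
    ultimately show ?thesis unfolding \<Psi>_def by linarith
  qed
  have T: "test_pair m (\<lambda>x. \<Psi> (frac x)) (\<lambda>x. g (frac x) - m)"
    unfolding test_pair_def
  proof (intro conjI allI)
    show "\<bar>\<Psi> (frac x)\<bar> \<le> m" for x using frac_lt_1[of x] by (intro \<Psi>_bound) auto
    have "\<bar>\<Psi> (frac x) - \<Psi> (frac y)\<bar> \<le> G * \<bar>x - y\<bar>" for x y
      by (rule lipschitz_frac[OF \<Psi>_lip \<Psi>01])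
    then show "\<exists>L. \<forall>x y. \<bar>\<Psi> (frac x) - \<Psi> (frac y)\<bar> \<le> L * \<bar>x - y\<bar>" by (intro exI allI)
    show "\<exists>B. \<forall>x. \<bar>g (frac x) - m\<bar> \<le> B" using gm by (intro exI allI)
    show "\<exists>S. countable S \<and> (\<forall>x. x \<notin> S \<longrightarrow> ((\<lambda>x. \<Psi> (frac x)) has_real_derivative g (frac x) - m) (at x))"
    proof (intro exI[of _ "\<int>"] conjI allI impI)
      show "countable (\<int> :: real set)" unfolding Ints_def by simp
      fix x :: real assume x: "x \<notin> \<int>"
      then have s: "0 < frac x" "frac x < 1" using frac_lt_1[of x] by auto
      then have D: "(\<Psi> has_real_derivative g (frac x) - m) (at (frac x))"
        using \<Psi>_deriv[of "frac x"] by (simp add: at_within_Icc_at)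
      define k where "k = real_of_int \<lfloor>x\<rfloor>"
      have "((\<lambda>y. \<Psi> (y - k)) has_real_derivative (g (frac x) - m) * 1) (at x)"
      proof (rule DERIV_chain2[where f = \<Psi> and g = "\<lambda>y. y - k"])
        show "(\<Psi> has_real_derivative g (frac x) - m) (at (x - k))"
          using D by (simp add: frac_def k_def)
        show "((\<lambda>y. y - k) has_real_derivative 1) (at x)" by (auto intro!: derivative_eq_intros)
      qed
      then show "((\<lambda>x. \<Psi> (frac x)) has_real_derivative g (frac x) - m) (at x)"
        unfolding mult_1_right
      proof (rule has_field_derivative_transform_within_open)
        show "open {k<..<k + 1}" by simp
        show "x \<in> {k<..<k + 1}" using s by (auto simp: k_def frac_def)
        fix y assume "y \<in> {k<..<k + 1}"
        then have "\<lfloor>y\<rfloor> = \<lfloor>x\<rfloor>" by (auto simp: k_def floor_eq_iff)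
        then show "\<Psi> (y - k) = \<Psi> (frac y)" by (simp add: frac_def k_def)
      qed
    qed
  qed auto
  have gi: "integrable (digit_chain \<gamma> n) g"
    by (rule integrable_digit_chain[where B = G]) (use g in auto)
  have "(\<integral>x. g (frac x) - m \<partial>digit_chain \<gamma> n) = (\<integral>x. g x - m \<partial>digit_chain \<gamma> n)"
  proof (rule integral_cong_AE)
    show "AE x in digit_chain \<gamma> n. g (frac x) - m = g x - m"
      using AE_digit_chain by eventually_elim simp
  qed measurable
  also have "\<dots> = (\<integral>x. g x \<partial>digit_chain \<gamma> n) - m" using gi prob_space by simp
  finally have "\<bar>(\<integral>x. g x \<partial>digit_chain \<gamma> n) - m\<bar> \<le> 6 * \<gamma> / (\<gamma> - 1) * m"
    using digit_chain_lasota_yorke[OF \<gamma> T, of n] by simp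
  then have "(\<integral>x. g x \<partial>digit_chain \<gamma> n) \<le> m + 6 * \<gamma> / (\<gamma> - 1) * m" by linarith
  then show ?thesis by (simp add: mU[symmetric] distrib_right)
qed

section \<open>Stationary density as a weak limit of time averages\<close>

text \<open>The Cesaro mean of the first \<open>n + 1\<close> laws, written as the law at a
  uniformly random time.\<close>

definition digit_average :: "real \<Rightarrow> nat \<Rightarrow> real measure" where
  "digit_average \<gamma> n = measure_pmf (pmf_of_set {..n}) \<bind> digit_chain \<gamma>"

lemma digit_chain_measurable: "digit_chain \<gamma> \<in> measurable (measure_pmf p) (subprob_algebra borel)"
  using prob_space_digit_chain
  by (auto simp: measurable_pmf_measure1 space_subprob_algebra prob_space_imp_subprob_space)

lemma integral_digit_average:
  fixes \<phi> :: "real \<Rightarrow> real"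
  assumes "\<phi> \<in> borel_measurable borel" "\<And>x. \<bar>\<phi> x\<bar> \<le> B"
  shows "(\<integral>x. \<phi> x \<partial>digit_average \<gamma> n) = (\<Sum>k\<le>n. \<integral>x. \<phi> x \<partial>digit_chain \<gamma> k) / real (Suc n)"
proof -
  have "(\<integral>x. \<phi> x \<partial>digit_average \<gamma> n) = (\<integral>k. (\<integral>x. \<phi> x \<partial>digit_chain \<gamma> k) \<partial>measure_pmf (pmf_of_set {..n}))"
    unfolding digit_average_def
  proof (rule integral_bind[OF assms(1) _ digit_chain_measurable])
    show "finite_measure (measure_pmf (pmf_of_set {..n}))" by (rule measure_pmf.finite_measure)
    show "AE k in measure_pmf (pmf_of_set {..n}). emeasure (digit_chain \<gamma> k) (space (digit_chain \<gamma> k)) \<le> ennreal 1"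
      using prob_space.emeasure_space_1[OF prob_space_digit_chain] by simp
  qed (rule assms(2))
  then show ?thesis by (simp add: integral_pmf_of_set)
qed

lemma real_distribution_digit_average: "real_distribution (digit_average \<gamma> n)"
proof -
  have s: "sets (digit_average \<gamma> n) = sets borel"
    unfolding digit_average_def by (rule sets_bind) auto
  have "prob_space (digit_average \<gamma> n)"
    unfolding digit_average_def
    using prob_space_digit_chain by (intro measure_pmf.prob_space_bind[OF _ digit_chain_measurable]) auto
  then show ?thesis
    using s sets_eq_imp_space_eq[OF s] by (intro real_distribution.intro real_distribution_axioms.intro) auto
qed

lemma tight_digit_average: "tight (digit_average \<gamma>)"
  unfolding tight_def
proof (intro conjI allI impI)
  fix e :: real assume "e > 0"
  \<comment> \<open>The chain lives in \<open>[0, 1)\<close>; the left end is \<open>-1\<close>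
    because tightness is stated with intervals open on the left and 0 must be inside.\<close>
  have "measure (digit_average \<gamma> n) {-1<..1} = 1" for n
  proof -
    interpret A: real_distribution "digit_average \<gamma> n" by (rule real_distribution_digit_average)
    have "(\<integral>x. indicator {-1<..1} x \<partial>digit_chain \<gamma> k) = (1::real)" for k
    proof -
      interpret prob_space "digit_chain \<gamma> k" by (rule prob_space_digit_chain)
      have "(\<integral>x. indicator {-1<..1} x \<partial>digit_chain \<gamma> k) = (\<integral>x. 1 \<partial>digit_chain \<gamma> k :: real)"
      proof (rule integral_cong_AE)
        show "AE x in digit_chain \<gamma> k. indicator {-1<..1} x = (1::real)"
          using AE_digit_chain by eventually_elim (auto simp: indicator_def)
      qed measurable
      then show ?thesis using prob_space by simp
    qed
    moreover have "(\<integral>x. indicator {-1<..1} x \<partial>digit_average \<gamma> n) = (\<Sum>k\<le>n. \<integral>x. indicator {-1<..1} x \<partial>digit_chain \<gamma> k) / real (Suc n)"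
      by (rule integral_digit_average[where B = 1]) (auto simp: indicator_def)
    ultimately have "(\<integral>x. indicator {-1<..1} x \<partial>digit_average \<gamma> n) = (1 :: real)" by simp
    then show ?thesis by simp
  qed
  then show "\<exists>a b. a < b \<and> (\<forall>n. measure (digit_average \<gamma> n) {a<..b} > 1 - e)"
    using \<open>e > 0\<close> by (intro exI[of _ "-1"] exI[of _ 1]) auto
qed (rule real_distribution_digit_average)

text \<open>Weak convergence needs test functions that are continuous and bounded on the whole line;
  composing with this map changes nothing on \<open>[0, 1]\<close>.\<close>

definition clamp_unit :: "real \<Rightarrow> real" where
  "clamp_unit s = max 0 (min 1 s)"

text \<open>The critical point is 0, where \<open>\<phi> (\<gamma> / c)\<close> may have no limit;
  it is bounded, and its coefficient \<open>1 - digit_prob c\<close> tends to 0.\<close>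

lemma isCont_digit_operator_clamp:
  fixes \<phi> :: "real \<Rightarrow> real"
  assumes \<phi>: "continuous_on UNIV \<phi>" and B: "\<And>x. \<bar>\<phi> x\<bar> \<le> B"
  shows "isCont (\<lambda>s. digit_operator \<gamma> \<phi> (clamp_unit s)) s"
proof -
  have \<phi>': "isCont \<phi> x" for x using \<phi> by (simp add: continuous_on_eq_continuous_at)
  have 1: "isCont (\<lambda>c. (1 - digit_prob c) * \<phi> (\<gamma> / c)) c" for c
  proof (cases "c = 0")
    case False
    then have "isCont (\<lambda>c. \<phi> (\<gamma> / c)) c"
      by (intro isCont_o2[where f = "\<lambda>c. \<gamma> / c" and g = \<phi>] \<phi>' continuous_intros) auto
    then show ?thesis unfolding digit_prob_def by (intro continuous_intros)
  next
    case True
    have "((\<lambda>c. (1 - digit_prob c) * \<phi> (\<gamma> / c)) \<longlongrightarrow> 0) (at 0)"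
    proof (rule Lim_null_comparison)
      show "\<forall>\<^sub>F c in at 0. norm ((1 - digit_prob c) * \<phi> (\<gamma> / c)) \<le> \<bar>1 - digit_prob c\<bar> * B"
        using B by (simp add: abs_mult mult_left_mono)
      show "((\<lambda>c. \<bar>1 - digit_prob c\<bar> * B) \<longlongrightarrow> 0) (at 0)"
        unfolding digit_prob_def by (auto intro!: tendsto_eq_intros)
    qed
    then show ?thesis using True by (simp add: isCont_def digit_prob_def)
  qed
  have 2: "isCont (\<lambda>c. digit_prob c * \<phi> (\<gamma> / (1 + c))) c" if "c \<ge> 0" for c
  proof -
    have "isCont (\<lambda>c. \<phi> (\<gamma> / (1 + c))) c"
      using that by (intro isCont_o2[where f = "\<lambda>c. \<gamma> / (1 + c)" and g = \<phi>] \<phi>' continuous_intros) auto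
    then show ?thesis unfolding digit_prob_def by (intro continuous_intros)
  qed
  have "isCont (\<lambda>c. digit_operator \<gamma> \<phi> c) (clamp_unit s)"
    unfolding digit_operator_def by (rule continuous_add[OF 1 2]) (simp add: clamp_unit_def)
  moreover have "isCont clamp_unit s" unfolding clamp_unit_def[abs_def] by (intro continuous_intros)
  ultimately show ?thesis by (rule isCont_o2[rotated])
qed

text \<open>The Markov operator shifts time by one, so the difference of the two averages telescopes
  to its first and last term.\<close>

lemma digit_average_almost_stationary:
  fixes \<phi> :: "real \<Rightarrow> real"
  assumes [measurable]: "\<phi> \<in> borel_measurable borel" and B: "\<And>x. \<bar>\<phi> x\<bar> \<le> B" and per: "\<And>x. \<phi> (frac x) = \<phi> x"
  shows "\<bar>(\<integral>x. \<phi> x \<partial>digit_average \<gamma> n) - (\<integral>x. digit_operator \<gamma> \<phi> (clamp_unit x) \<partial>digit_average \<gamma> n)\<bar> \<le> 2 * B / real (Suc n)"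
proof -
  define I where "I k = (\<integral>x. \<phi> x \<partial>digit_chain \<gamma> k)" for k
  have [measurable]: "clamp_unit \<in> borel_measurable borel" unfolding clamp_unit_def[abs_def] by measurable
  have cl: "0 \<le> clamp_unit x" "clamp_unit x \<le> 1" for x by (auto simp: clamp_unit_def)
  have "(\<integral>x. digit_operator \<gamma> \<phi> (clamp_unit x) \<partial>digit_chain \<gamma> k) = I (Suc k)" for k
  proof -
    have "(\<integral>x. digit_operator \<gamma> \<phi> (clamp_unit x) \<partial>digit_chain \<gamma> k) = (\<integral>x. digit_operator \<gamma> \<phi> x \<partial>digit_chain \<gamma> k)"
    proof (rule integral_cong_AE)
      show "AE x in digit_chain \<gamma> k. digit_operator \<gamma> \<phi> (clamp_unit x) = digit_operator \<gamma> \<phi> x"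
        using AE_digit_chain by eventually_elim (simp add: clamp_unit_def)
    qed measurable
    also have "\<dots> = I (Suc k)"
      unfolding I_def by (rule integral_digit_chain_Suc[symmetric, where B = B]) (use B per in auto)
    finally show ?thesis .
  qed
  moreover have "(\<integral>x. digit_operator \<gamma> \<phi> (clamp_unit x) \<partial>digit_average \<gamma> n) =
      (\<Sum>k\<le>n. \<integral>x. digit_operator \<gamma> \<phi> (clamp_unit x) \<partial>digit_chain \<gamma> k) / real (Suc n)"
    by (rule integral_digit_average[where B = B]) (use digit_operator_bounded[OF B cl] in auto)
  moreover have "(\<integral>x. \<phi> x \<partial>digit_average \<gamma> n) = (\<Sum>k\<le>n. I k) / real (Suc n)"
    unfolding I_def by (rule integral_digit_average[where B = B]) (use B in auto)
  moreover have "(\<Sum>k\<le>n. I k) - (\<Sum>k\<le>n. I (Suc k)) = I 0 - I (Suc n)"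
    by (induction n) auto
  ultimately have "(\<integral>x. \<phi> x \<partial>digit_average \<gamma> n) - (\<integral>x. digit_operator \<gamma> \<phi> (clamp_unit x) \<partial>digit_average \<gamma> n) =
      (I 0 - I (Suc n)) / real (Suc n)"
    by (simp add: diff_divide_distrib[symmetric] del: of_nat_Suc)
  note diff = this
  have IB: "\<bar>I k\<bar> \<le> B" for k
  proof -
    interpret prob_space "digit_chain \<gamma> k" by (rule prob_space_digit_chain)
    have "\<bar>I k\<bar> \<le> (\<integral>x. \<bar>\<phi> x\<bar> \<partial>digit_chain \<gamma> k)" unfolding I_def by (rule integral_abs_bound)
    also have "\<dots> \<le> (\<integral>x. B \<partial>digit_chain \<gamma> k)"
      using integrable_digit_chain[of \<phi> B \<gamma> k] B by (intro integral_mono) auto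
    finally show ?thesis using prob_space by simp
  qed
  have "\<bar>I 0 - I (Suc n)\<bar> \<le> 2 * B" using IB[of 0] IB[of "Suc n"] by linarith
  then show ?thesis unfolding diff by (simp add: divide_right_mono del: of_nat_Suc)
qed

text \<open>The Krylov-Bogolyubov argument: a weak limit of the time averages is stationary. The
  uniform density bound survives the limit and makes it absolutely continuous.\<close>

lemma ex_stationary_density:
  assumes \<gamma>: "\<gamma> > 1"
  obtains P :: "real \<Rightarrow> real" where "integrable lborel P" "\<And>x. 0 \<le> P x" "\<And>x. x \<notin> {0..<1} \<Longrightarrow> P x = 0"
    "(\<integral>x. P x \<partial>lborel) = 1"
    "\<And>\<phi>. continuous_on UNIV \<phi> \<Longrightarrow> (\<And>x. \<bar>\<phi> x\<bar> \<le> 1) \<Longrightarrow> (\<And>x. \<phi> (frac x) = \<phi> x) \<Longrightarrow>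
       (\<integral>x. P x * \<phi> x \<partial>lborel) = (\<integral>x. P x * digit_operator \<gamma> \<phi> x \<partial>lborel)"
proof -
  obtain r M where r: "strict_mono (r :: nat \<Rightarrow> nat)" and M: "real_distribution M"
    and conv: "weak_conv_m (digit_average \<gamma> \<circ> r) M"
    using tight_imp_convergent_subsubsequence[OF tight_digit_average[of \<gamma>], of id]
    by (auto simp: strict_mono_id)
  interpret M: real_distribution M by (rule M)
  interpret U: prob_space unit_uniform by (rule prob_space_unit_uniform)
  have lim: "(\<lambda>n. \<integral>x. \<phi> x \<partial>digit_average \<gamma> (r n)) \<longlonglongrightarrow> (\<integral>x. \<phi> x \<partial>M)"
    if "\<And>x. isCont \<phi> x" "\<And>x. \<bar>\<phi> x\<bar> \<le> B" for \<phi> :: "real \<Rightarrow> real" and B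
    using weak_conv_imp_integral_bdd_continuous_conv[of "digit_average \<gamma> \<circ> r" M \<phi> B]
      real_distribution_digit_average M conv that by (simp add: comp_def)
  define C where "C = 1 + 6 * \<gamma> / (\<gamma> - 1)"
  have C: "C \<ge> 1" using \<gamma> by (simp add: C_def)
  have M_le: "(\<integral>x. g x \<partial>M) \<le> C * (\<integral>x. g x \<partial>unit_uniform)"
    if g: "continuous_on UNIV g" "\<And>x. 0 \<le> g x" "\<And>x. g x \<le> 1" for g :: "real \<Rightarrow> real"
  proof (rule LIMSEQ_le_const2[OF lim[of g 1]])
    have [measurable]: "g \<in> borel_measurable borel" using g(1) by (rule borel_measurable_continuous_onI)
    show "isCont g x" for x using g(1) by (simp add: continuous_on_eq_continuous_at)
    show "\<exists>N. \<forall>n\<ge>N. (\<integral>x. g x \<partial>digit_average \<gamma> (r n)) \<le> C * (\<integral>x. g x \<partial>unit_uniform)"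
    proof (intro exI allI impI)
      fix n
      have "(\<integral>x. g x \<partial>digit_average \<gamma> (r n)) = (\<Sum>k\<le>r n. \<integral>x. g x \<partial>digit_chain \<gamma> k) / real (Suc (r n))"
        by (rule integral_digit_average[where B = 1]) (use g in auto)
      also have "\<dots> \<le> (\<Sum>k\<le>r n. C * (\<integral>x. g x \<partial>unit_uniform)) / real (Suc (r n))"
        unfolding C_def by (intro divide_right_mono sum_mono digit_chain_integral_le[OF \<gamma> g]) auto
      also have "\<dots> = C * (\<integral>x. g x \<partial>unit_uniform)" by simp
      finally show "(\<integral>x. g x \<partial>digit_average \<gamma> (r n)) \<le> C * (\<integral>x. g x \<partial>unit_uniform)" .
    qed
  qed (use g in auto)
  \<comment> \<open>Weak limits respect the bound for continuous functions; the cut-offs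
    \<open>1 - \<phi> n\<close> converge to the indicator of \<open>V\<close> and carry it over to
    open sets.\<close>
  have M_open: "measure M V \<le> C * measure unit_uniform V" if V: "open V" for V
  proof (cases "- V = {}")
    case True
    then have "V = UNIV" by auto
    then show ?thesis using C M.prob_space U.prob_space by simp
  next
    case False
    define \<phi> where "\<phi> n z = max 0 (1 - real n * infdist z (- V))" for n z
    have "closed (- V)" using V by (rule open_closed[THEN iffD1])
    note \<phi> = indicator_approx[OF this False, folded \<phi>_def]
    have [measurable]: "\<phi> n \<in> borel_measurable borel" for n using \<phi>(1) by (rule borel_measurable_continuous_onI)
    have [measurable]: "V \<in> sets borel" using V by simp
    have L: "(\<lambda>n. \<integral>x. 1 - \<phi> n x \<partial>N) \<longlonglongrightarrow> (\<integral>x. indicator V x \<partial>N)"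
      if N: "prob_space N" "sets N = sets borel" for N
    proof (rule integral_dominated_convergence)
      interpret N: prob_space N by (rule N)
      have meas: "f \<in> borel_measurable N \<longleftrightarrow> f \<in> borel_measurable borel" for f :: "real \<Rightarrow> real"
        by (simp only: measurable_cong_sets[OF N(2) refl])
      show "integrable N (\<lambda>_. 1 :: real)" by simp
      show "AE x in N. (\<lambda>n. 1 - \<phi> n x) \<longlonglongrightarrow> indicator V x"
      proof (rule AE_I2)
        fix x
        have "(\<lambda>n. 1 - \<phi> n x) \<longlonglongrightarrow> 1 - indicator (- V) x" by (intro tendsto_intros \<phi>)
        then show "(\<lambda>n. 1 - \<phi> n x) \<longlonglongrightarrow> indicator V x" by (cases "x \<in> V") simp_all
      qed
      show "AE x in N. norm (1 - \<phi> n x) \<le> 1" for n using \<phi>(2,3) by (auto simp: abs_le_iff intro: order_trans)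
      show "(\<lambda>x. indicator V x) \<in> borel_measurable N"
        by (rule borel_measurable_indicator) (use V N(2) in simp)
      show "(\<lambda>x. 1 - \<phi> n x) \<in> borel_measurable N" for n
        unfolding meas by (intro borel_measurable_continuous_onI continuous_intros \<phi>)
    qed
    have "(\<integral>x. indicator V x \<partial>M) \<le> C * (\<integral>x. indicator V x \<partial>unit_uniform)"
    proof (rule LIMSEQ_le[OF L tendsto_mult_left[OF L]])
      show "\<exists>N. \<forall>n\<ge>N. (\<integral>x. 1 - \<phi> n x \<partial>M) \<le> C * (\<integral>x. 1 - \<phi> n x \<partial>unit_uniform)"
        using \<phi> by (intro exI allI impI M_le continuous_intros) auto
    qed (use M.prob_space_axioms U.prob_space_axioms in auto)
    then show ?thesis by simp
  qed
  have "absolutely_continuous unit_uniform M"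
    unfolding absolutely_continuous_def
  proof
    fix B assume B: "B \<in> null_sets unit_uniform"
    then have Bm: "B \<in> sets borel" by auto
    \<comment> \<open>Outer regularity: a null set is covered by open sets of small uniform measure,
      whose \<open>M\<close>-measure is at most \<open>C\<close> times as large.\<close>
    have "(INF V \<in> {V. B \<subseteq> V \<and> open V}. emeasure unit_uniform V) = 0"
      using outer_regular[of unit_uniform B] B Bm U.emeasure_finite by auto
    have "measure M B \<le> 0"
    proof (rule field_le_epsilon)
      fix e :: real assume e: "e > 0"
      then have "(INF V \<in> {V. B \<subseteq> V \<and> open V}. emeasure unit_uniform V) < ennreal (e / C)"
        using \<open>_ = 0\<close> C by (simp add: ennreal_less_zero_iff)
      then obtain V where V: "B \<subseteq> V" "open V" "emeasure unit_uniform V < ennreal (e / C)"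
        unfolding INF_less_iff by auto
      then have "measure unit_uniform V < e / C"
        using e C by (simp add: U.emeasure_eq_measure ennreal_less_iff)
      have "measure M B \<le> measure M V" using V Bm by (intro M.finite_measure_mono) auto
      also have "\<dots> \<le> C * measure unit_uniform V" by (rule M_open[OF V(2)])
      also have "\<dots> \<le> C * (e / C)" using \<open>measure unit_uniform V < e / C\<close> C by (intro mult_left_mono) auto
      finally show "measure M B \<le> 0 + e" using C by simp
    qed
    then have "measure M B = 0" using measure_nonneg[of M B] by linarith
    then show "B \<in> null_sets M" using Bm by (simp add: null_sets_def M.emeasure_eq_measure)
  qed
  then obtain f where f[measurable]: "f \<in> borel_measurable unit_uniform" and df: "density unit_uniform f = M"
    using U.Radon_Nikodym[of M] by auto
  have [measurable]: "f \<in> borel_measurable borel" using f by simp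
  have "(\<integral>\<^sup>+x. f x \<partial>unit_uniform) = emeasure M UNIV"
    unfolding df[symmetric] by (subst emeasure_density) auto
  then have "(\<integral>\<^sup>+x. f x \<partial>unit_uniform) \<noteq> \<infinity>" using M.emeasure_finite by simp
  then have fin: "AE x in unit_uniform. f x \<noteq> \<infinity>" by (intro nn_integral_PInf_AE) auto
  define P where "P x = indicator {0..<1} x * enn2real (f x)" for x
  have P0: "0 \<le> P x" for x by (simp add: P_def)
  have [measurable]: "P \<in> borel_measurable borel" unfolding P_def by measurable
  have MP: "M = density lborel (\<lambda>x. ennreal (P x))"
  proof -
    have "M = density unit_uniform (\<lambda>x. ennreal (enn2real (f x)))"
      unfolding df[symmetric] by (rule density_cong) (use fin in \<open>auto elim!: eventually_mono simp: less_top\<close>)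
    also have "\<dots> = density lborel (\<lambda>x. ennreal (indicator {0..<1} x) * ennreal (enn2real (f x)))"
      by (rule density_density_eq) auto
    also have "\<dots> = density lborel (\<lambda>x. ennreal (P x))"
      by (simp add: P_def ennreal_mult'')
    finally show ?thesis .
  qed
  have int: "(\<integral>x. \<phi> x \<partial>M) = (\<integral>x. P x * \<phi> x \<partial>lborel)" if "\<phi> \<in> borel_measurable borel" for \<phi> :: "real \<Rightarrow> real"
    unfolding MP using that P0 by (subst integral_density) auto
  show thesis
  proof
    have "integrable M (\<lambda>_. 1 :: real)" by simp
    then show "integrable lborel P" unfolding MP using P0 by (subst (asm) integrable_density) auto
    show "0 \<le> P x" for x by (rule P0)
    show "P x = 0" if "x \<notin> {0..<1}" for x using that by (simp add: P_def)
    show "(\<integral>x. P x \<partial>lborel) = 1" using int[of "\<lambda>_. 1"] M.prob_space by simp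
    fix \<phi> :: "real \<Rightarrow> real"
    assume \<phi>: "continuous_on UNIV \<phi>" and b: "\<And>x. \<bar>\<phi> x\<bar> \<le> 1" and per: "\<And>x. \<phi> (frac x) = \<phi> x"
    have [measurable]: "\<phi> \<in> borel_measurable borel" using \<phi> by (rule borel_measurable_continuous_onI)
    have [measurable]: "clamp_unit \<in> borel_measurable borel" unfolding clamp_unit_def[abs_def] by measurable
    let ?k = "\<lambda>x. digit_operator \<gamma> \<phi> (clamp_unit x)"
    have bk: "\<bar>?k x\<bar> \<le> 1" for x by (rule digit_operator_bounded[OF b]) (auto simp: clamp_unit_def)
    have 1: "(\<lambda>n. (\<integral>x. \<phi> x \<partial>digit_average \<gamma> (r n)) - (\<integral>x. ?k x \<partial>digit_average \<gamma> (r n))) \<longlonglongrightarrow> (\<integral>x. \<phi> x \<partial>M) - (\<integral>x. ?k x \<partial>M)"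
  proof (intro tendsto_diff)
      show "(\<lambda>n. \<integral>x. \<phi> x \<partial>digit_average \<gamma> (r n)) \<longlonglongrightarrow> (\<integral>x. \<phi> x \<partial>M)"
        using \<phi> b by (intro lim) (auto simp: continuous_on_eq_continuous_at)
      show "(\<lambda>n. \<integral>x. ?k x \<partial>digit_average \<gamma> (r n)) \<longlonglongrightarrow> (\<integral>x. ?k x \<partial>M)"
        using bk isCont_digit_operator_clamp[OF \<phi> b] by (intro lim)
    qed
    have 2: "(\<lambda>n. (\<integral>x. \<phi> x \<partial>digit_average \<gamma> (r n)) - (\<integral>x. ?k x \<partial>digit_average \<gamma> (r n))) \<longlonglongrightarrow> 0"
    proof (rule Lim_null_comparison)
      show "\<forall>\<^sub>F n in sequentially. norm ((\<integral>x. \<phi> x \<partial>digit_average \<gamma> (r n)) - (\<integral>x. ?k x \<partial>digit_average \<gamma> (r n))) \<le> 2 * 1 / real (Suc (r n))"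
        using digit_average_almost_stationary[of \<phi> 1 \<gamma>] b per by (intro always_eventually allI) simp
      have "(\<lambda>n. 2 * 1 / real (Suc n)) \<longlonglongrightarrow> 0" by real_asymp
      from LIMSEQ_subseq_LIMSEQ[OF this r] show "(\<lambda>n. 2 * 1 / real (Suc (r n))) \<longlonglongrightarrow> 0" by (simp add: comp_def)
    qed
    have "(\<integral>x. \<phi> x \<partial>M) = (\<integral>x. ?k x \<partial>M)" using LIMSEQ_unique[OF 1 2] by simp
    then have "(\<integral>x. P x * \<phi> x \<partial>lborel) = (\<integral>x. P x * ?k x \<partial>lborel)" by (simp add: int)
    also have "\<dots> = (\<integral>x. P x * digit_operator \<gamma> \<phi> x \<partial>lborel)"
      by (rule Bochner_Integration.integral_cong) (auto simp: P_def clamp_unit_def indicator_def)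
    finally show "(\<integral>x. P x * \<phi> x \<partial>lborel) = (\<integral>x. P x * digit_operator \<gamma> \<phi> x \<partial>lborel)" .
  qed
qed

section \<open>Conclusion\<close>

lemma integrable_mult_bounded_real:
  fixes P :: "real \<Rightarrow> real"
  assumes "integrable lborel P" "\<phi> \<in> borel_measurable borel" "\<And>x. P x \<noteq> 0 \<Longrightarrow> \<bar>\<phi> x\<bar> \<le> C"
  shows "integrable lborel (\<lambda>x. P x * \<phi> x)"
proof (rule Bochner_Integration.integrable_bound)
  show "integrable lborel (\<lambda>x. C * P x)" using assms by simp
  show "AE x in lborel. norm (P x * \<phi> x) \<le> norm (C * P x)"
  proof (rule AE_I2)
    fix x
    show "norm (P x * \<phi> x) \<le> norm (C * P x)"
    proof (cases "P x = 0")
      case False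
      then have "\<bar>\<phi> x\<bar> \<le> \<bar>C\<bar>" using assms(3)[of x] by linarith
      then have "\<bar>P x\<bar> * \<bar>\<phi> x\<bar> \<le> \<bar>P x\<bar> * \<bar>C\<bar>" by (rule mult_left_mono) simp
      then show ?thesis by (simp add: abs_mult mult.commute)
    qed simp
  qed
qed (use assms in auto)

text \<open>The flow that carries the stationary density \<open>P\<close> from the circle of \<open>x mod 1\<close> to the circle of
  \<open>\<gamma> / x mod 1\<close>: the mass at \<open>s\<close> is split between \<open>x = s\<close> and \<open>x = s + 1\<close>.\<close>

lemma ex_annihilating_supercritical:
  assumes \<gamma>: "\<gamma> > 1"
  shows "\<exists>f. annihilating \<gamma> f \<and> \<not> (AE x in lborel. f x = 0)"
proof -
  obtain P :: "real \<Rightarrow> real" where P: "integrable lborel P" "\<And>x. 0 \<le> P x" "\<And>x. x \<notin> {0..<1} \<Longrightarrow> P x = 0"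
    "(\<integral>x. P x \<partial>lborel) = 1"
    and stat: "\<And>\<phi>. continuous_on UNIV \<phi> \<Longrightarrow> (\<And>x. \<bar>\<phi> x\<bar> \<le> 1) \<Longrightarrow> (\<And>x. \<phi> (frac x) = \<phi> x) \<Longrightarrow>
       (\<integral>x. P x * \<phi> x \<partial>lborel) = (\<integral>x. P x * digit_operator \<gamma> \<phi> x \<partial>lborel)"
    using ex_stationary_density[OF \<gamma>] by blast
  have [measurable]: "P \<in> borel_measurable borel" using P(1) by auto
  define b where "b = digit_prob"
  have b: "0 \<le> b x" "b x \<le> 1" if "P x \<noteq> 0" for x
    using digit_prob_bounds[of x] P(3)[of x] that by (cases "x \<in> {0..<1}"; auto simp: b_def)+
  have [measurable]: "b \<in> borel_measurable borel" unfolding b_def by measurable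
  define p where "p x = P x * (1 - b x) + P (x - 1) * b (x - 1)" for x
  \<comment> \<open>At \<open>x = 0\<close> this uses \<open>digit_prob 0 = 1\<close>.\<close>
  have p0: "p x = 0" if "x \<le> 0" for x
    using that P(3)[of x] P(3)[of "x - 1"] by (cases "x = 0") (auto simp: p_def b_def digit_prob_def)
  have [measurable]: "p \<in> borel_measurable borel" unfolding p_def by measurable
  have int1: "integrable lborel (\<lambda>x. P x * (1 - b x) * \<phi> x)" and int2: "integrable lborel (\<lambda>x. P x * b x * \<phi> x)"
    if "\<phi> \<in> borel_measurable borel" "\<And>x. \<bar>\<phi> x\<bar> \<le> 1" for \<phi> :: "real \<Rightarrow> real"
  proof -
    have i1: "integrable lborel (\<lambda>x. P x * (1 - b x))" and i2: "integrable lborel (\<lambda>x. P x * b x)"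
      using b by (auto intro!: integrable_mult_bounded_real[OF P(1), where C = 1] simp: abs_le_iff intro: order_trans[of _ 0])
    show "integrable lborel (\<lambda>x. P x * (1 - b x) * \<phi> x)" "integrable lborel (\<lambda>x. P x * b x * \<phi> x)"
      using i1 i2 that by (auto intro!: integrable_mult_bounded_real[where C = 1])
  qed
  have p\<phi>: "integrable lborel (\<lambda>x. p x * \<phi> x)"
    "(\<integral>x. p x * \<phi> x \<partial>lborel) = (\<integral>x. P x * ((1 - b x) * \<phi> x + b x * \<phi> (1 + x)) \<partial>lborel)"
    if [measurable]: "\<phi> \<in> borel_measurable borel" and 1: "\<And>x. \<bar>\<phi> x\<bar> \<le> 1" for \<phi> :: "real \<Rightarrow> real"
  proof -
    have s: "integrable lborel (\<lambda>x. P x * b x * \<phi> (1 + x))" using 1 by (intro int2) auto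
    have s': "integrable lborel (\<lambda>x. P (x - 1) * b (x - 1) * \<phi> x)"
      using lborel_integrable_real_affine[OF s, of 1 "-1"] by (simp add: add.commute)
    have e: "(\<integral>x. P (x - 1) * b (x - 1) * \<phi> x \<partial>lborel) = (\<integral>x. P x * b x * \<phi> (1 + x) \<partial>lborel)"
      by (subst lborel_integral_real_affine[where c = 1 and t = 1]) simp_all
    have p_eq: "p x * \<phi> x = P x * (1 - b x) * \<phi> x + P (x - 1) * b (x - 1) * \<phi> x" for x
      by (simp add: p_def distrib_right)
    show "integrable lborel (\<lambda>x. p x * \<phi> x)"
      unfolding p_eq by (intro Bochner_Integration.integrable_add int1 s' that)
    have "(\<integral>x. p x * \<phi> x \<partial>lborel) = (\<integral>x. P x * (1 - b x) * \<phi> x \<partial>lborel) + (\<integral>x. P x * b x * \<phi> (1 + x) \<partial>lborel)"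
      unfolding p_eq e[symmetric] by (intro Bochner_Integration.integral_add int1 s' that)
    also have "\<dots> = (\<integral>x. P x * (1 - b x) * \<phi> x + P x * b x * \<phi> (1 + x) \<partial>lborel)"
      by (intro Bochner_Integration.integral_add[symmetric] int1 s that)
    also have "\<dots> = (\<integral>x. P x * ((1 - b x) * \<phi> x + b x * \<phi> (1 + x)) \<partial>lborel)"
      by (intro Bochner_Integration.integral_cong) (auto simp: algebra_simps)
    finally show "(\<integral>x. p x * \<phi> x \<partial>lborel) = (\<integral>x. P x * ((1 - b x) * \<phi> x + b x * \<phi> (1 + x)) \<partial>lborel)" .
  qed
  have p: "integrable lborel p" "(\<integral>x. p x \<partial>lborel) = 1"
    using p\<phi>[of "\<lambda>_. 1"] P(4) by simp_all
  \<comment> \<open>Modulo 1 the two shares of \<open>p\<close> recombine to \<open>P\<close>, and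
    under \<open>\<gamma> / x\<close> modulo 1 they give the law after one step of the chain;
    stationarity equates the two.\<close>
  have per: "(\<integral>x. p x * \<phi> x \<partial>lborel) = (\<integral>x. p x * \<phi> (\<gamma> / x) \<partial>lborel)"
    if \<phi>: "continuous_on UNIV \<phi>" "\<And>x. \<bar>\<phi> x\<bar> \<le> 1" "\<And>x. \<phi> (frac x) = \<phi> x" for \<phi> :: "real \<Rightarrow> real"
  proof -
    have [measurable]: "\<phi> \<in> borel_measurable borel" using \<phi>(1) by (rule borel_measurable_continuous_onI)
    have shift: "\<phi> (1 + x) = \<phi> x" for x using \<phi>(3) frac_1_eq[of x] by (metis add.commute)
    have "(\<integral>x. p x * \<phi> x \<partial>lborel) = (\<integral>x. P x * ((1 - b x) * \<phi> x + b x * \<phi> (1 + x)) \<partial>lborel)"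
      by (rule p\<phi>(2)) (use \<phi> in auto)
    also have "\<dots> = (\<integral>x. P x * \<phi> x \<partial>lborel)"
      unfolding shift by (simp flip: distrib_right)
    also have "\<dots> = (\<integral>x. P x * digit_operator \<gamma> \<phi> x \<partial>lborel)" by (rule stat[OF \<phi>])
    also have "\<dots> = (\<integral>x. p x * \<phi> (\<gamma> / x) \<partial>lborel)"
      unfolding digit_operator_def b_def[symmetric]
      by (rule p\<phi>(2)[symmetric]) (use \<phi> in auto)
    finally show ?thesis .
  qed
  have moments: "(\<integral>x. of_real (p x) * cis (2 * pi * j * x) \<partial>lborel) = (\<integral>x. of_real (p x) * cis (2 * pi * j * (\<gamma> / x)) \<partial>lborel)" for j :: int
  proof -
    have split: "(\<integral>x. of_real (p x) * cis (2 * pi * j * X x) \<partial>lborel) =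
        of_real (\<integral>x. p x * cos (2 * pi * j * X x) \<partial>lborel) + \<i> * of_real (\<integral>x. p x * sin (2 * pi * j * X x) \<partial>lborel)"
      if [measurable]: "X \<in> borel_measurable borel" for X
    proof -
      have i: "integrable lborel (\<lambda>x. complex_of_real (p x * cos (2 * pi * j * X x)))"
        "integrable lborel (\<lambda>x. complex_of_real (p x * sin (2 * pi * j * X x)))"
        by (intro integrable_of_real p\<phi>(1); measurable; simp)+
      have "(\<integral>x. of_real (p x) * cis (2 * pi * j * X x) \<partial>lborel) =
          (\<integral>x. of_real (p x * cos (2 * pi * j * X x)) + \<i> * of_real (p x * sin (2 * pi * j * X x)) \<partial>lborel)"
        by (intro Bochner_Integration.integral_cong) (auto simp: complex_eq_iff)
      also have "\<dots> = of_real (\<integral>x. p x * cos (2 * pi * j * X x) \<partial>lborel) + \<i> * of_real (\<integral>x. p x * sin (2 * pi * j * X x) \<partial>lborel)"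
        using i by (subst Bochner_Integration.integral_add) (auto simp del: of_real_mult)
      finally show ?thesis .
    qed
    have fr: "cos (2 * pi * j * frac x) = cos (2 * pi * j * x)" "sin (2 * pi * j * frac x) = sin (2 * pi * j * x)" for x :: real
      using cis_frac[of j x] by (simp_all add: complex_eq_iff)
    have "(\<integral>x. p x * cos (2 * pi * j * x) \<partial>lborel) = (\<integral>x. p x * cos (2 * pi * j * (\<gamma> / x)) \<partial>lborel)"
      by (rule per) (auto intro!: continuous_intros simp: fr)
    moreover have "(\<integral>x. p x * sin (2 * pi * j * x) \<partial>lborel) = (\<integral>x. p x * sin (2 * pi * j * (\<gamma> / x)) \<partial>lborel)"
      by (rule per) (auto intro!: continuous_intros simp: fr)
    ultimately show ?thesis by (subst (1 2) split) auto
  qed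
  define f where "f x = of_real (p x) - of_real (\<gamma> / x\<^sup>2) * complex_of_real (p (\<gamma> / x))" for x
  have "annihilating \<gamma> f"
    unfolding f_def using \<gamma> p p0 moments by (intro annihilating_inversion_diff) auto
  \<comment> \<open>Otherwise \<open>p\<close> would be symmetric under the inversion, which forces
    half of its mass above \<open>sqrt \<gamma>\<close>. Then \<open>P\<close> vanishes below
    \<open>1 / 2\<close>, and at most a quarter of the mass of \<open>p\<close> lies above
    1.\<close>
  moreover have "\<not> (AE x in lborel. f x = 0)"
  proof
    assume "AE x in lborel. f x = 0"
    then have AE: "AE x in lborel. p x = \<gamma> / x\<^sup>2 * p (\<gamma> / x)"
    proof eventually_elim
      case (elim x)
      then have "complex_of_real (p x) = of_real (\<gamma> / x\<^sup>2 * p (\<gamma> / x))" by (simp add: f_def)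
      then show ?case unfolding of_real_eq_iff .
    qed
    \<comment> \<open>For \<open>0 < x < 1 / 2\<close> the mirror point \<open>\<gamma> / x\<close>
      exceeds 2 and is outside the support of \<open>p\<close>; the factor
      \<open>1 - b x = x * (2 - x)\<close> is positive and can be cancelled.\<close>
    have P_half: "AE x in lborel. x < 1 / 2 \<longrightarrow> P x = 0"
    proof -
      have "AE x in lborel. x \<noteq> (0::real)" by (rule AE_lborel_singleton)
      with AE show ?thesis
      proof eventually_elim
        case (elim x)
        show ?case
        proof
          assume x: "x < 1 / 2"
          show "P x = 0"
          proof (cases "x > 0")
            case True
            have "2 * x < \<gamma>" using x \<gamma> by linarith
            then have "\<gamma> / x > 2" using True by (simp add: less_divide_eq)
            then have "p (\<gamma> / x) = 0" using P(3)[of "\<gamma> / x"] P(3)[of "\<gamma> / x - 1"] by (simp add: p_def)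
            then have "P x * (1 - b x) = 0" using elim x P(3)[of "x - 1"] by (simp add: p_def)
            moreover have "b x \<noteq> 1"
            proof -
              have "1 - b x = x * (2 - x)" by (simp add: b_def digit_prob_def algebra_simps power2_eq_square)
              moreover have "x * (2 - x) > 0" using True x by simp
              ultimately show ?thesis by linarith
            qed
            ultimately show ?thesis by simp
          qed (use P(3)[of x] elim in auto)
        qed
      qed
    qed
    have "sqrt \<gamma> > 1" using \<gamma> by simp
    \<comment> \<open>The fixed point of the inversion, which exchanges \<open>(0, w)\<close> and
      \<open>(w, \<infinity>)\<close>.\<close>
    define w where "w = sqrt \<gamma>"
    have w: "w > 1" "w * w = \<gamma>" using \<gamma> by (auto simp: w_def)
    define F where "F x = complex_of_real (indicator {w<..} x * p x)" for x
    have ind: "integrable lborel (\<lambda>x. indicator A x * p x)" if "A \<in> sets borel" for A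
      using p(1) that by (intro integrable_indicator_mult) auto
    have intF: "integrable lborel F" unfolding F_def by (intro integrable_of_real ind) simp
    have F0: "F x = 0" if "x \<le> 0" for x using that by (simp add: F_def p0)
    have "(\<integral>v. of_real (\<gamma> / v\<^sup>2) * F (\<gamma> / v) \<partial>lborel) = (\<integral>x. F x \<partial>lborel)"
      by (rule integral_inversion[OF _ intF F0]) (use \<gamma> in simp)
    moreover have "(\<integral>v. of_real (\<gamma> / v\<^sup>2) * F (\<gamma> / v) \<partial>lborel) = (\<integral>v. of_real (indicator {..<w} v * p v) \<partial>lborel)"
    proof (rule integral_cong_AE)
      show "AE v in lborel. of_real (\<gamma> / v\<^sup>2) * F (\<gamma> / v) = of_real (indicator {..<w} v * p v)"
        using AE
      proof eventually_elim
        case (elim v)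
        show ?case
        proof (cases "v > 0")
          case True
          have "w < \<gamma> / v \<longleftrightarrow> v < w"
            using True w(1) unfolding w(2)[symmetric] by (simp add: pos_less_divide_eq)
          then have "of_real (\<gamma> / v\<^sup>2) * F (\<gamma> / v) = complex_of_real (indicator {..<w} v * (\<gamma> / v\<^sup>2 * p (\<gamma> / v)))"
            by (simp add: F_def indicator_def)
          then show ?thesis by (simp only: elim[symmetric])
        next
          case False
          then have "\<gamma> / v \<le> 0" using \<gamma> by (simp add: divide_nonneg_nonpos)
          then show ?thesis using False F0 p0[of v] by simp
        qed
      qed
    qed (use intF in measurable)
    ultimately have "(\<integral>v. indicator {..<w} v * p v \<partial>lborel) = (\<integral>x. indicator {w<..} x * p x \<partial>lborel)"
      unfolding F_def by (simp only: integral_complex_of_real of_real_eq_iff)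
    moreover have "(\<integral>v. indicator {..<w} v * p v \<partial>lborel) + (\<integral>x. indicator {w<..} x * p x \<partial>lborel) = (\<integral>x. p x \<partial>lborel)"
    proof -
      have "(\<integral>v. indicator {..<w} v * p v \<partial>lborel) + (\<integral>x. indicator {w<..} x * p x \<partial>lborel) =
          (\<integral>x. indicator {..<w} x * p x + indicator {w<..} x * p x \<partial>lborel)"
        by (intro Bochner_Integration.integral_add[symmetric] ind) auto
      also have "\<dots> = (\<integral>x. p x \<partial>lborel)"
      proof (rule integral_cong_AE)
        have "AE x in lborel. x \<noteq> w" by (rule AE_lborel_singleton)
        then show "AE x in lborel. indicator {..<w} x * p x + indicator {w<..} x * p x = p x"
          by eventually_elim (auto simp: indicator_def)
      qed measurable
      finally show ?thesis .
    qed
    ultimately have half: "(\<integral>x. indicator {w<..} x * p x \<partial>lborel) = 1 / 2" using p(2) by simp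
    have Pb: "integrable lborel (\<lambda>x. P x * b x)" using int2[of "\<lambda>_. 1"] by simp
    have Pb': "integrable lborel (\<lambda>x. P (x - 1) * b (x - 1))"
      using lborel_integrable_real_affine[OF Pb, of 1 "-1"] by (simp add: add.commute)
    \<comment> \<open>As \<open>w > 1\<close>, only the share moved to \<open>x = s + 1\<close> lies
      above \<open>w\<close>. It carries the factor \<open>b\<close>, which is at most
      \<open>1 / 4\<close> on \<open>[1 / 2, 1)\<close>.\<close>
    have "(\<integral>x. indicator {w<..} x * p x \<partial>lborel) \<le> (\<integral>x. P (x - 1) * b (x - 1) \<partial>lborel)"
    proof (rule integral_mono[OF ind Pb'])
      fix x
      have "0 \<le> P (x - 1) * b (x - 1)" using P(2)[of "x - 1"] b[of "x - 1"] by (cases "P (x - 1) = 0") auto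
      then show "indicator {w<..} x * p x \<le> P (x - 1) * b (x - 1)"
        using P(3)[of x] w by (auto simp: indicator_def p_def)
    qed simp
    also have "\<dots> = (\<integral>x. P x * b x \<partial>lborel)"
      by (subst lborel_integral_real_affine[where c = 1 and t = 1]) simp_all
    also have "\<dots> \<le> (\<integral>x. P x * (1 / 4) \<partial>lborel)"
    proof (rule integral_mono_AE[OF Pb])
      show "integrable lborel (\<lambda>x. P x * (1 / 4))" using P(1) by simp
      show "AE x in lborel. P x * b x \<le> P x * (1 / 4)"
        using P_half
      proof eventually_elim
        case (elim x)
        show ?case
        proof (cases "P x = 0")
          case False
          then have x: "1 / 2 \<le> x" "x < 1" using elim P(3)[of x] by force+
          have "b x \<le> (1 / 2)\<^sup>2" unfolding b_def digit_prob_def using x by (intro power_mono) auto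
          then show ?thesis using P(2)[of x] by (intro mult_left_mono) (auto simp: power2_eq_square)
        qed simp
      qed
    qed
    also have "\<dots> = 1 / 4" using P(1,4) by simp
    finally show False using half by simp
  qed
  ultimately show ?thesis by blast
qed

section \<open>From densities back to measures on the branch\<close>

lemma annihilated_measures_eq:
  fixes m \<alpha> \<beta> :: real
  assumes \<alpha>: "\<alpha> > 0"
  shows "annihilated_measures m (lattice_cross \<alpha> \<beta>) =
    hyperbola_measure m \<alpha> ` {f. annihilating (\<alpha> * \<beta> * m\<^sup>2 / (16 * pi\<^sup>2)) f}"
proof (intro equalityI subsetI)
  fix \<mu> assume \<mu>: "\<mu> \<in> annihilated_measures m (lattice_cross \<alpha> \<beta>)"
  then have "\<mu> \<in> AC m" by (simp add: annihilated_measures_def)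
  then obtain f where f: "integrable lborel f" "\<And>s. s \<le> 0 \<Longrightarrow> f s = 0" "\<mu> = hyperbola_measure m \<alpha> f"
    using AC_eq_hyperbola_measure[OF \<alpha>] by metis
  with \<mu> have "annihilating (\<alpha> * \<beta> * m\<^sup>2 / (16 * pi\<^sup>2)) f"
    using annihilates_lattice_cross_iff[OF \<alpha> f(1), where m = m and \<beta> = \<beta>]
    by (simp add: annihilated_measures_def annihilating_def)
  then show "\<mu> \<in> hyperbola_measure m \<alpha> ` {f. annihilating (\<alpha> * \<beta> * m\<^sup>2 / (16 * pi\<^sup>2)) f}" using f by blast
next
  fix \<mu> assume "\<mu> \<in> hyperbola_measure m \<alpha> ` {f. annihilating (\<alpha> * \<beta> * m\<^sup>2 / (16 * pi\<^sup>2)) f}"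
  then obtain f where f: "annihilating (\<alpha> * \<beta> * m\<^sup>2 / (16 * pi\<^sup>2)) f" "\<mu> = hyperbola_measure m \<alpha> f" by blast
  then have "integrable lborel f" "\<And>s. s \<le> 0 \<Longrightarrow> f s = 0" by (auto simp: annihilating_def)
  then show "\<mu> \<in> annihilated_measures m (lattice_cross \<alpha> \<beta>)"
    using f hyperbola_measure_in_AC[OF \<alpha>] annihilates_lattice_cross_iff[OF \<alpha>, where f = f and m = m and \<beta> = \<beta>]
    by (simp add: annihilated_measures_def annihilating_def)
qed

text \<open>One combination serves for differences and, with \<open>f = 0\<close>, for scalar
  multiples.\<close>

lemma annihilating_diff_scale:
  assumes f: "annihilating \<gamma> f" and g: "annihilating \<gamma> g"
  shows "annihilating \<gamma> (\<lambda>s. f s - c * g s)"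
proof -
  have [measurable]: "cis \<in> borel_measurable borel"
    by (intro borel_measurable_continuous_onI continuous_intros)
  have fint: "integrable lborel f" and gint: "integrable lborel g"
    using f g unfolding annihilating_def by blast+
  have int: "integrable lborel (\<lambda>x. r x * cis (X x))" if "integrable lborel r" "X \<in> borel_measurable borel"
    for r :: "real \<Rightarrow> complex" and X :: "real \<Rightarrow> real"
    using that(2) by (intro integrable_mult_bounded[OF that(1), where C = 1]) auto
  have 0: "(\<integral>s. (f s - c * g s) * cis (X s) \<partial>lborel) = 0"
    if X: "X \<in> borel_measurable borel" and "(\<integral>s. f s * cis (X s) \<partial>lborel) = 0" "(\<integral>s. g s * cis (X s) \<partial>lborel) = 0"
    for X :: "real \<Rightarrow> real"
  proof -
    have "(\<integral>s. (f s - c * g s) * cis (X s) \<partial>lborel) = (\<integral>s. f s * cis (X s) - c * (g s * cis (X s)) \<partial>lborel)"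
      by (simp only: left_diff_distrib mult.assoc)
    also have "\<dots> = (\<integral>s. f s * cis (X s) \<partial>lborel) - c * (\<integral>s. g s * cis (X s) \<partial>lborel)"
      by (subst Bochner_Integration.integral_diff) (intro int fint gint X integrable_mult_right, intro int fint gint X integrable_mult_right, simp only: integral_mult_right_zero)
    finally show ?thesis using that(2,3) by simp
  qed
  show ?thesis unfolding annihilating_def
  proof (intro conjI allI impI)
    show "integrable lborel (\<lambda>s. f s - c * g s)" using fint gint by simp
    show "f s - c * g s = 0" if "s \<le> 0" for s using f g that by (simp add: annihilating_def)
    show "(\<integral>s. (f s - c * g s) * cis (2 * pi * j * s) \<partial>lborel) = 0" for j :: int
      by (rule 0) (measurable, use f g in \<open>unfold annihilating_def, blast+\<close>)
    show "(\<integral>s. (f s - c * g s) * cis (2 * pi * j * (\<gamma> / s)) \<partial>lborel) = 0" for j :: int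
      by (rule 0) (measurable, use f g in \<open>unfold annihilating_def, blast+\<close>)
  qed
qed

text \<open>The integral over \<open>(0, 1)\<close> is a linear functional on annihilating densities
  whose kernel is trivial by \<open>annihilating_critical_eq_0\<close> and which does not vanish at
  \<open>g\<close>.\<close>

lemma defect_one_critical:
  fixes m \<alpha> \<beta> :: real
  assumes \<alpha>: "\<alpha> > 0" and crit: "\<alpha> * \<beta> * m\<^sup>2 / (16 * pi\<^sup>2) = 1"
  shows "heisenberg_uniqueness_pair_defect m (lattice_cross \<alpha> \<beta>) 1"
proof -
  obtain g where g: "annihilating 1 g" "(\<integral>s. indicator {0<..<1} s * g s \<partial>lborel) \<noteq> 0"
    using ex_annihilating_critical by blast
  define \<nu> where "\<nu> = hyperbola_measure m \<alpha> g"
  have gint: "integrable lborel g" using g by (simp add: annihilating_def)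
  have "\<nu> \<noteq> 0"
  proof
    assume "\<nu> = 0"
    then have "AE s in lborel. g s = 0" using hyperbola_measure_eq_0_iff[OF \<alpha> gint] by (simp add: \<nu>_def)
    then have "AE s in lborel. indicator {0<..<1} s * g s = 0" by eventually_elim simp
    then show False using g(2) by (simp add: integral_eq_zero_AE)
  qed
  have E: "annihilated_measures m (lattice_cross \<alpha> \<beta>) = hyperbola_measure m \<alpha> ` {f. annihilating 1 f}"
    using annihilated_measures_eq[OF \<alpha>, of m \<beta>] crit by simp
  have "complex_fun.span {\<nu>} = annihilated_measures m (lattice_cross \<alpha> \<beta>)"
  proof (intro equalityI subsetI)
    fix \<mu> assume "\<mu> \<in> complex_fun.span {\<nu>}"
    then obtain c where c: "\<mu> = scale_fun c \<nu>" by (auto simp: complex_fun.span_singleton)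
    have z: "annihilating 1 (\<lambda>_. 0)" by (simp add: annihilating_def)
    have "annihilating 1 (\<lambda>s. 0 - (- c) * g s)" by (rule annihilating_diff_scale[OF z g(1)])
    moreover have "\<mu> = hyperbola_measure m \<alpha> (\<lambda>s. 0 - (- c) * g s)"
    proof
      fix A
      have "hyperbola_measure m \<alpha> (\<lambda>s. 0 - (- c) * g s) A = hyperbola_measure m \<alpha> (\<lambda>_. 0) A - (- c) * hyperbola_measure m \<alpha> g A"
        using gint by (intro hyperbola_measure_diff_scale) auto
      also have "hyperbola_measure m \<alpha> (\<lambda>_. 0) A = 0" by (simp add: hyperbola_measure_def)
      finally show "\<mu> A = hyperbola_measure m \<alpha> (\<lambda>s. 0 - (- c) * g s) A" by (simp add: c scale_fun_def \<nu>_def)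
    qed
    ultimately show "\<mu> \<in> annihilated_measures m (lattice_cross \<alpha> \<beta>)" unfolding E by blast
  next
    fix \<mu> assume "\<mu> \<in> annihilated_measures m (lattice_cross \<alpha> \<beta>)"
    then obtain f where f: "annihilating 1 f" "\<mu> = hyperbola_measure m \<alpha> f" unfolding E by blast
    \<comment> \<open>Chosen so that \<open>f - c * g\<close> is in the kernel of the
      functional.\<close>
    define c where "c = (\<integral>s. indicator {0<..<1} s * f s \<partial>lborel) / (\<integral>s. indicator {0<..<1} s * g s \<partial>lborel)"
    have fint: "integrable lborel f" using f by (simp add: annihilating_def)
    have ann: "annihilating 1 (\<lambda>s. f s - c * g s)" by (rule annihilating_diff_scale[OF f(1) g(1)])
    have "(\<integral>s. indicator {0<..<1} s * (f s - c * g s) \<partial>lborel) =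
        (\<integral>s. indicator {0<..<1} s * f s - c * (indicator {0<..<1} s * g s) \<partial>lborel)"
      by (intro Bochner_Integration.integral_cong) (auto simp: algebra_simps)
    also have "\<dots> = (\<integral>s. indicator {0<..<1} s * f s \<partial>lborel) - c * (\<integral>s. indicator {0<..<1} s * g s \<partial>lborel)"
      using integrable_indicator_mult[OF fint, of "{0<..<1}"] integrable_indicator_mult[OF gint, of "{0<..<1}"] by simp
    also have "\<dots> = 0" using g(2) by (simp add: c_def)
    finally have "AE s in lborel. f s - c * g s = 0" by (rule annihilating_critical_eq_0[OF ann])
    then have "hyperbola_measure m \<alpha> (\<lambda>s. f s - c * g s) = 0"
      using hyperbola_measure_eq_0_iff[OF \<alpha>] ann by (simp add: annihilating_def)
    then have "\<mu> A = c * \<nu> A" for A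
      using hyperbola_measure_diff_scale[OF fint gint, of m \<alpha> c A] by (simp add: f(2) \<nu>_def zero_fun_def)
    then have "\<mu> = scale_fun c \<nu>" by (simp add: scale_fun_def fun_eq_iff)
    then show "\<mu> \<in> complex_fun.span {\<nu>}" by (auto simp: complex_fun.span_singleton)
  qed
  moreover have "complex_fun.independent {\<nu>}" using \<open>\<nu> \<noteq> 0\<close> by simp
  ultimately show ?thesis unfolding heisenberg_uniqueness_pair_defect_def by (intro exI[of _ "{\<nu>}"]) auto
qed

lemma heisenberg_uniqueness_pair_iff:
  fixes m \<alpha> \<beta> :: real
  assumes \<alpha>: "\<alpha> > 0"
  shows "heisenberg_uniqueness_pair m (lattice_cross \<alpha> \<beta>) \<longleftrightarrow>
    (\<forall>f. annihilating (\<alpha> * \<beta> * m\<^sup>2 / (16 * pi\<^sup>2)) f \<longrightarrow> (AE s in lborel. f s = 0))"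
proof -
  have "heisenberg_uniqueness_pair m (lattice_cross \<alpha> \<beta>) \<longleftrightarrow> (\<forall>\<mu>\<in>annihilated_measures m (lattice_cross \<alpha> \<beta>). \<mu> = 0)"
    by (auto simp: heisenberg_uniqueness_pair_def annihilated_measures_def)
  also have "\<dots> \<longleftrightarrow> (\<forall>f. annihilating (\<alpha> * \<beta> * m\<^sup>2 / (16 * pi\<^sup>2)) f \<longrightarrow> hyperbola_measure m \<alpha> f = 0)"
    unfolding annihilated_measures_eq[OF \<alpha>] by auto
  also have "\<dots> \<longleftrightarrow> (\<forall>f. annihilating (\<alpha> * \<beta> * m\<^sup>2 / (16 * pi\<^sup>2)) f \<longrightarrow> (AE s in lborel. f s = 0))"
    using hyperbola_measure_eq_0_iff[OF \<alpha>] by (auto simp: annihilating_def)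
  finally show ?thesis .
qed

theorem theorem4p1:
  fixes m \<alpha> \<beta> :: real
  assumes "m > 0" and "\<alpha> > 0" and "\<beta> > 0"
  shows "(heisenberg_uniqueness_pair m (lattice_cross \<alpha> \<beta>) \<longleftrightarrow> \<alpha> * \<beta> * m\<^sup>2 < 16 * pi\<^sup>2) \<and>
    (\<alpha> * \<beta> * m\<^sup>2 = 16 * pi\<^sup>2 \<longrightarrow>
      heisenberg_uniqueness_pair_defect m (lattice_cross \<alpha> \<beta>) 1)"
proof -
  define \<gamma> where "\<gamma> = \<alpha> * \<beta> * m\<^sup>2 / (16 * pi\<^sup>2)"
  have \<gamma>: "\<gamma> > 0" using assms by (simp add: \<gamma>_def)
  have lt: "\<alpha> * \<beta> * m\<^sup>2 < 16 * pi\<^sup>2 \<longleftrightarrow> \<gamma> < 1" and eq: "\<alpha> * \<beta> * m\<^sup>2 = 16 * pi\<^sup>2 \<longleftrightarrow> \<gamma> = 1"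
    by (auto simp: \<gamma>_def divide_less_eq)
  have "(\<forall>f. annihilating \<gamma> f \<longrightarrow> (AE s in lborel. f s = 0)) \<longleftrightarrow> \<gamma> < 1"
  proof
    assume *: "\<forall>f. annihilating \<gamma> f \<longrightarrow> (AE s in lborel. f s = 0)"
    have "\<gamma> \<noteq> 1"
    proof
      assume "\<gamma> = 1"
      obtain g where g: "annihilating 1 g" "(\<integral>s. indicator {0<..<1} s * g s \<partial>lborel) \<noteq> 0"
        using ex_annihilating_critical by blast
      have "AE s in lborel. g s = 0" using *[rule_format, of g] g(1) \<open>\<gamma> = 1\<close> by simp
      then have "AE s in lborel. indicator {0<..<1} s * g s = 0" by eventually_elim simp
      then show False using g(2) by (simp add: integral_eq_zero_AE)
    qed
    moreover have "\<not> \<gamma> > 1" using ex_annihilating_supercritical[of \<gamma>] * by metis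
    ultimately show "\<gamma> < 1" by linarith
  next
    assume "\<gamma> < 1"
    then show "\<forall>f. annihilating \<gamma> f \<longrightarrow> (AE s in lborel. f s = 0)"
      using annihilating_eq_0_subcritical[OF _ \<gamma>] by (intro allI impI) simp
  qed
  then have "heisenberg_uniqueness_pair m (lattice_cross \<alpha> \<beta>) \<longleftrightarrow> \<gamma> < 1"
    unfolding heisenberg_uniqueness_pair_iff[OF assms(2)] \<gamma>_def .
  then show ?thesis
    using lt eq defect_one_critical[OF assms(2), of \<beta> m, folded \<gamma>_def] by simp
qed

end
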